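(* Let $B\in(0,1)$ and $b>0$ be constants with $b\frac{1-B}{1+B}<1$, and let $\Delta\geq 3$ be an integer. Then there exists $M_0>0$ such that for all $M>M_0$ the following holds. There is a polynomial-time algorithm that, on input an $n$-vertex graph $G=(V,E)$ of maximum degree at most $\Delta$ and average growth $b$ up to depth $L=\lceil M\log n\rceil$, outputs a configuration $\tau:V\to\{1,2\}$ whose distribution $\nu_\tau$ satisfies $\|\nu_\tau-\pi_G\|_{\mathrm{TV}}\leq 1/n^{10}$. Moreover, the algorithm, when given as additional input two vertices $u$ and $v$ of $G$, outputs a configuration $\tau:V\to\{1,2\}$ with $\tau_u=1$ and $\tau_v=2$ whose distribution $\nu_\tau$ satisfies $\|\nu_\tau-\pi^{1,2}_{G,u,v}\|_{\mathrm{TV}}\leq 1/n^{10}$, where $\pi^{1,2}_{G,u,v}$ is the Ising distribution on $G$ conditioned on $u$ having state $1$ and $v$ having state $2$.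
   Context: The Ising distribution on $G=(V,E)$ with parameter $B$ is $\pi_G(\sigma)=B^{m(\sigma)}/Z$ for $\sigma:V\to\{1,2\}$, where $m(\sigma)$ is the number of edges whose endpoints have the same state. A graph $G$ with $n$ vertices has average growth $b$ up to depth $L=\lceil M\log n\rceil$ if for every vertex $v$ the total number of paths with $L$ vertices starting from $v$ is less than $b^{L}$. $\log$ is the natural logarithm. *)

theory Defs
  imports
    "HOL-Probability.Probability"
    "HOL-Computational_Algebra.Polynomial"
    "HOL-Library.Log_Nat"
begin

section \<open>Graphs and growth\<close>

definition simple_graph :: "'a set \<Rightarrow> 'a set set \<Rightarrow> bool" where
  "simple_graph V E \<longleftrightarrow> finite V \<and> (\<forall>e\<in>E. e \<subseteq> V \<and> card e = 2)"

definition degree :: "'a set set \<Rightarrow> 'a \<Rightarrow> nat" where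
  "degree E v = card {e \<in> E. v \<in> e}"

definition max_degree_le :: "'a set \<Rightarrow> 'a set set \<Rightarrow> nat \<Rightarrow> bool" where
  "max_degree_le V E \<Delta> \<longleftrightarrow> (\<forall>v\<in>V. degree E v \<le> \<Delta>)"

text \<open>A path does not repeat vertices; it is given as its non-empty vertex sequence.\<close>

definition is_path :: "'a set \<Rightarrow> 'a set set \<Rightarrow> 'a list \<Rightarrow> bool" where
  "is_path V E p \<longleftrightarrow> p \<noteq> [] \<and> set p \<subseteq> V \<and> distinct p \<and>
     (\<forall>i. Suc i < length p \<longrightarrow> {p ! i, p ! Suc i} \<in> E)"

definition paths_from :: "'a set \<Rightarrow> 'a set set \<Rightarrow> 'a \<Rightarrow> nat \<Rightarrow> 'a list set" where
  "paths_from V E v l = {p. is_path V E p \<and> hd p = v \<and> length p = l}"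

definition average_growth :: "'a set \<Rightarrow> 'a set set \<Rightarrow> real \<Rightarrow> nat \<Rightarrow> bool" where
  "average_growth V E b L \<longleftrightarrow> (\<forall>v\<in>V. real (card (paths_from V E v L)) < b ^ L)"

definition depth :: "real \<Rightarrow> nat \<Rightarrow> nat" where
  "depth M n = nat \<lceil>M * ln (real n)\<rceil>"

section \<open>The Ising distribution\<close>

definition configs :: "'a set \<Rightarrow> ('a \<Rightarrow> nat) set" where
  "configs V = V \<rightarrow>\<^sub>E {1, 2}"

definition mono_edges :: "'a set set \<Rightarrow> ('a \<Rightarrow> nat) \<Rightarrow> nat" where
  "mono_edges E \<sigma> = card {e \<in> E. \<forall>x\<in>e. \<forall>y\<in>e. \<sigma> x = \<sigma> y}"

definition partition_fn :: "'a set \<Rightarrow> 'a set set \<Rightarrow> real \<Rightarrow> real" where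
  "partition_fn V E B = (\<Sum>\<sigma>\<in>configs V. B ^ mono_edges E \<sigma>)"

definition ising :: "'a set \<Rightarrow> 'a set set \<Rightarrow> real \<Rightarrow> ('a \<Rightarrow> nat) pmf" where
  "ising V E B = embed_pmf (\<lambda>\<sigma>. if \<sigma> \<in> configs V
     then B ^ mono_edges E \<sigma> / partition_fn V E B else 0)"

definition ising_cond ::
  "'a set \<Rightarrow> 'a set set \<Rightarrow> real \<Rightarrow> 'a \<Rightarrow> 'a \<Rightarrow> ('a \<Rightarrow> nat) pmf" where
  "ising_cond V E B u v = cond_pmf (ising V E B) {\<sigma>. \<sigma> u = 1 \<and> \<sigma> v = 2}"

definition tv_dist :: "'b pmf \<Rightarrow> 'b pmf \<Rightarrow> real" where
  "tv_dist \<mu> \<nu> = (SUP A. \<bar>measure_pmf.prob \<mu> A - measure_pmf.prob \<nu> A\<bar>)"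

text \<open>The side conditions of \<^const>\<open>embed_pmf\<close> and \<^const>\<open>cond_pmf\<close> hold for
  \<open>B > 0\<close>.\<close>

lemma finite_configs: "finite V \<Longrightarrow> finite (configs V)"
  by (simp add: configs_def finite_PiE)

lemma partition_fn_pos:
  assumes "finite V" "0 < B"
  shows "0 < partition_fn V E B"
proof -
  have "configs V \<noteq> {}" by (simp add: configs_def PiE_eq_empty_iff)
  then show ?thesis
    unfolding partition_fn_def using assms by (intro sum_pos finite_configs) auto
qed

lemma pmf_ising:
  assumes "finite V" "0 < B"
  shows "pmf (ising V E B) \<sigma> =
    (if \<sigma> \<in> configs V then B ^ mono_edges E \<sigma> / partition_fn V E B else 0)"
  unfolding ising_def
proof (rule pmf_embed_pmf)
  let ?f = "\<lambda>\<sigma>. if \<sigma> \<in> configs V then B ^ mono_edges E \<sigma> / partition_fn V E B else 0"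
  note Z = partition_fn_pos[OF assms, of E]
  show nn: "0 \<le> ?f \<sigma>" for \<sigma> using Z assms by auto
  have "(\<integral>\<^sup>+ \<sigma>. ennreal (?f \<sigma>) \<partial>count_space UNIV)
      = (\<Sum>\<sigma>\<in>configs V. ennreal (?f \<sigma>))"
    using finite_configs[OF assms(1)]
    by (intro nn_integral_count_space') auto
  also have "\<dots> = ennreal (\<Sum>\<sigma>\<in>configs V. ?f \<sigma>)"
    by (rule sum_ennreal) (rule nn)
  also have "(\<Sum>\<sigma>\<in>configs V. ?f \<sigma>) = (\<Sum>\<sigma>\<in>configs V. B ^ mono_edges E \<sigma>) / partition_fn V E B"
    by (simp add: sum_divide_distrib)
  also have "\<dots> = 1" using Z by (simp flip: partition_fn_def)
  finally show "(\<integral>\<^sup>+ \<sigma>. ennreal (?f \<sigma>) \<partial>count_space UNIV) = 1" by simp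
qed

lemma set_pmf_ising:
  assumes "finite V" "0 < B"
  shows "set_pmf (ising V E B) = configs V"
  using partition_fn_pos[OF assms, of E] assms
  by (auto simp: set_pmf_eq pmf_ising)

lemma ising_cond_nonempty:
  assumes "finite V" "0 < B" "u \<in> V" "v \<in> V" "u \<noteq> v"
  shows "set_pmf (ising V E B) \<inter> {\<sigma>. \<sigma> u = 1 \<and> \<sigma> v = 2} \<noteq> {}"
proof -
  have "(\<lambda>x\<in>V. if x = u then 1 else 2) \<in> set_pmf (ising V E B) \<inter> {\<sigma>. \<sigma> u = 1 \<and> \<sigma> v = 2}"
    using assms by (auto simp: set_pmf_ising configs_def)
  then show ?thesis by blast
qed

section \<open>Randomised algorithms\<close>

text \<open>
  The machine model is the random-access machine with logarithmic cost, presented as a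
  structured programming language and extended by fair coin flips. Memory consists of banks
  of registers holding natural numbers; a program mentions only finitely many banks, but
  addresses inside a bank are computed (indirect addressing). Every operation is charged
  the binary lengths of the numbers it involves, so running times agree with those of
  (probabilistic) Turing machines up to a polynomial.

  An arbitrary real constant \<open>\<beta>\<close> cannot be written into a finite program, so a program may
  ask for \<open>\<beta>\<close> to \<open>k\<close> binary places, that is, for \<open>\<lfloor>\<beta> * 2 ^ k\<rfloor>\<close>; this is charged at least
  \<open>k\<close>, the number of binary digits requested. Whenever the binary digits of \<open>\<beta>\<close> are
  computable in polynomial time, this operation can be replaced by a subroutine.
\<close>

type_synonym mem = "nat \<Rightarrow> nat \<Rightarrow> nat"

datatype expr =
    Const nat
  | Read nat expr
  | Add expr expr
  | Sub expr expr
  | Mul expr expr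
  | Div expr expr
  | Approx expr

fun eval :: "real \<Rightarrow> mem \<Rightarrow> expr \<Rightarrow> nat" where
  "eval \<beta> s (Const k) = k"
| "eval \<beta> s (Read a e) = s a (eval \<beta> s e)"
| "eval \<beta> s (Add e f) = eval \<beta> s e + eval \<beta> s f"
| "eval \<beta> s (Sub e f) = eval \<beta> s e - eval \<beta> s f"
| "eval \<beta> s (Mul e f) = eval \<beta> s e * eval \<beta> s f"
| "eval \<beta> s (Div e f) = eval \<beta> s e div eval \<beta> s f"
| "eval \<beta> s (Approx e) = nat \<lfloor>\<beta> * 2 ^ eval \<beta> s e\<rfloor>"

text \<open>\<open>floorlog 2 k\<close> is the number of binary digits of \<open>k\<close>. The lengths of the operands are
  accounted for by the costs of the subexpressions.\<close>

fun cost :: "real \<Rightarrow> mem \<Rightarrow> expr \<Rightarrow> nat" where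
  "cost \<beta> s (Const k) = 1 + floorlog 2 k"
| "cost \<beta> s (Read a e) = 1 + floorlog 2 (eval \<beta> s (Read a e)) + cost \<beta> s e"
| "cost \<beta> s (Add e f) = 1 + floorlog 2 (eval \<beta> s (Add e f)) + cost \<beta> s e + cost \<beta> s f"
| "cost \<beta> s (Sub e f) = 1 + floorlog 2 (eval \<beta> s (Sub e f)) + cost \<beta> s e + cost \<beta> s f"
| "cost \<beta> s (Mul e f) = 1 + floorlog 2 (eval \<beta> s (Mul e f)) + cost \<beta> s e + cost \<beta> s f"
| "cost \<beta> s (Div e f) = 1 + floorlog 2 (eval \<beta> s (Div e f)) + cost \<beta> s e + cost \<beta> s f"
| "cost \<beta> s (Approx e) =
     1 + floorlog 2 (eval \<beta> s (Approx e)) + eval \<beta> s e + cost \<beta> s e"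

text \<open>\<open>Write a e f\<close> stores the value of \<open>f\<close>, and \<open>Flip a e\<close> a fair coin, at the address given
  by \<open>e\<close> in bank \<open>a\<close>. Conditions are true when they are non-zero.\<close>

datatype com =
    Skip
  | Write nat expr expr
  | Flip nat expr
  | Seq com com
  | If expr com com
  | While expr com

definition upd :: "mem \<Rightarrow> nat \<Rightarrow> nat \<Rightarrow> nat \<Rightarrow> mem" where
  "upd s a i x = s(a := (s a)(i := x))"

text \<open>\<open>exec \<beta> c (s, r) t (s', r')\<close>: program \<open>c\<close>, started in memory \<open>s\<close> with the sequence \<open>r\<close> of
  coin flips still to come, stops after time \<open>t\<close> in memory \<open>s'\<close>, leaving the flips \<open>r'\<close> unused.\<close>

inductive exec ::
  "real \<Rightarrow> com \<Rightarrow> mem \<times> bool list \<Rightarrow> nat \<Rightarrow> mem \<times> bool list \<Rightarrow> bool" for \<beta> where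
  Skip: "exec \<beta> Skip (s, r) 1 (s, r)"
| Write: "exec \<beta> (Write a e f) (s, r) (1 + cost \<beta> s e + cost \<beta> s f)
     (upd s a (eval \<beta> s e) (eval \<beta> s f), r)"
| Flip: "exec \<beta> (Flip a e) (s, x # r) (1 + cost \<beta> s e)
     (upd s a (eval \<beta> s e) (of_bool x), r)"
| Seq: "exec \<beta> c C t C' \<Longrightarrow> exec \<beta> d C' t' C'' \<Longrightarrow> exec \<beta> (Seq c d) C (1 + t + t') C''"
| IfTrue: "eval \<beta> s e \<noteq> 0 \<Longrightarrow> exec \<beta> c (s, r) t C \<Longrightarrow>
     exec \<beta> (If e c d) (s, r) (1 + cost \<beta> s e + t) C"
| IfFalse: "eval \<beta> s e = 0 \<Longrightarrow> exec \<beta> d (s, r) t C \<Longrightarrow>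
     exec \<beta> (If e c d) (s, r) (1 + cost \<beta> s e + t) C"
| WhileFalse: "eval \<beta> s e = 0 \<Longrightarrow> exec \<beta> (While e c) (s, r) (1 + cost \<beta> s e) (s, r)"
| WhileTrue: "eval \<beta> s e \<noteq> 0 \<Longrightarrow> exec \<beta> c (s, r) t C \<Longrightarrow> exec \<beta> (While e c) C t' C' \<Longrightarrow>
     exec \<beta> (While e c) (s, r) (1 + cost \<beta> s e + t + t') C'"

lemma exec_deterministic:
  "exec \<beta> c C t C' \<Longrightarrow> exec \<beta> c C t' C'' \<Longrightarrow> t' = t \<and> C'' = C'"
proof (induction arbitrary: t' C'' rule: exec.induct)
  case (Seq c C t C' d u D)
  from Seq.prems show ?case
    by (cases rule: exec.cases) (use Seq.IH in blast)+
next
  case (IfTrue s e c r t C d)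
  from IfTrue.prems show ?case
    by (cases rule: exec.cases) (use IfTrue in blast)+
next
  case (IfFalse s e d r t C c)
  from IfFalse.prems show ?case
    by (cases rule: exec.cases) (use IfFalse in blast)+
next
  case (WhileTrue s e c r t C u D)
  from WhileTrue.prems show ?case
    by (cases rule: exec.cases) (use WhileTrue in blast)+
qed (auto elim: exec.cases)

text \<open>Since every coin flip takes at least one unit of time, a run of length at most \<open>T\<close> never
  needs more than \<open>T\<close> flips.\<close>

definition halts_within :: "real \<Rightarrow> com \<Rightarrow> mem \<Rightarrow> nat \<Rightarrow> bool" where
  "halts_within \<beta> c s T \<longleftrightarrow>
     (\<forall>r. length r = T \<longrightarrow> (\<exists>t s' r'. exec \<beta> c (s, r) t (s', r') \<and> t \<le> T))"

definition final_mem :: "real \<Rightarrow> com \<Rightarrow> mem \<Rightarrow> bool list \<Rightarrow> mem" where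
  "final_mem \<beta> c s r = (THE s'. \<exists>t r'. exec \<beta> c (s, r) t (s', r'))"

text \<open>Input and output conventions for graphs with vertex set \<open>{..<n}\<close>: register 0 of bank 0
  holds \<open>n\<close>; bank 1 holds the adjacency matrix, row by row; bank 2 holds the optional pair of
  vertices, preceded by a flag telling whether it is present. All other registers are
  initially 0. The output is read from bank 3, whose register \<open>x\<close> holds the state of
  vertex \<open>x\<close>.\<close>

definition input :: "nat \<Rightarrow> nat set set \<Rightarrow> (nat \<times> nat) option \<Rightarrow> mem" where
  "input n E q = (\<lambda>a i.
     if a = 0 then (if i = 0 then n else 0)
     else if a = 1 then of_bool (i < n * n \<and> {i div n, i mod n} \<in> E)
     else if a = 2 then
       (case q of None \<Rightarrow> 0
        | Some (u, v) \<Rightarrow> if i = 0 then 1 else if i = 1 then u else if i = 2 then v else 0)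
     else 0)"

definition output_config :: "nat \<Rightarrow> mem \<Rightarrow> nat \<Rightarrow> nat" where
  "output_config n s = restrict (s 3) {..<n}"

definition output_pmf ::
  "real \<Rightarrow> com \<Rightarrow> nat \<Rightarrow> nat set set \<Rightarrow> (nat \<times> nat) option \<Rightarrow> nat \<Rightarrow> (nat \<Rightarrow> nat) pmf" where
  "output_pmf \<beta> c n E q T =
     map_pmf (\<lambda>r. output_config n (final_mem \<beta> c (input n E q) r)) (pmf_of_set {r. length r = T})"

end

(* Marginal ratios of the Ising model with vertex fields satisfy an exact recursion: splitting a
   vertex v into one copy per edge, the ratio at v is its field times the product, over the
   neighbours w, of F(R) = (B R + 1) / (R + B), where R is the ratio at w in the graph without v and
   where the other neighbours of v carry a changed field. The calls of the recursion correspond to the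
   paths from v, and ln F contracts ln R by the factor (1 - B) / (1 + B); truncating at a depth of
   order log n therefore costs only a power of 1/n, while the recursion tree stays polynomial because
   the degree is bounded. Vertices are sampled one after the other from these approximate marginals; a
   fixed vertex is removed and acts on its neighbours through their fields, so the two pinned
   vertices are just the first two fixed ones. All errors are one-sided factors
   (output probability >= (1 - eps) * target), which multiply along the sampling and bound the
   total variation distance. B is replaced by a fraction a/c with c a power of 2. *)

theory Submission
  imports Defs
begin

section \<open>A step-counting semantics\<close>

text \<open>Errors have to be relative, because up to \<open>n\<close> conditional probabilities are
  multiplied, while the lower bound available for one of them is only of the order
  \<open>(a / c) ^ (2 * n)\<close>; hence a precision of \<open>K\<close> bits with \<open>K\<close>
  linear in \<open>n\<close>. The number \<open>c = 2 ^ K\<close> serves twice: as the denominator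
  of the rounded parameter and as the range of the uniform integer read off \<open>K\<close> coin
  flips, so that one precision governs both errors. Rounding \<open>B\<close> upwards keeps the
  contraction rate at most that of \<open>B\<close>. Since the machine charges bit lengths and the
  ratios are kept as unreduced integer pairs, every level of the recursion multiplies the length of
  the numbers by a constant; only the logarithmic depth keeps this polynomial.\<close>

fun approx_free :: "expr \<Rightarrow> bool" where
  "approx_free (Const k) \<longleftrightarrow> True"
| "approx_free (Read a e) \<longleftrightarrow> approx_free e"
| "approx_free (Add e f) \<longleftrightarrow> approx_free e \<and> approx_free f"
| "approx_free (Sub e f) \<longleftrightarrow> approx_free e \<and> approx_free f"
| "approx_free (Mul e f) \<longleftrightarrow> approx_free e \<and> approx_free f"
| "approx_free (Div e f) \<longleftrightarrow> approx_free e \<and> approx_free f"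
| "approx_free (Approx e) \<longleftrightarrow> False"

text \<open>The number of \<open>W\<close>-bit blocks that hold the value when all registers have
  \<open>W\<close> bits, a constant of the expression. \<open>Approx\<close> has to be left out,
  because its value is as long as its argument is large, not as its argument is long; its entry 0 is
  a dummy. \<open>Suc k\<close> for a constant is crude but avoids a logarithm.\<close>

fun expr_bits :: "expr \<Rightarrow> nat" where
  "expr_bits (Const k) = Suc k"
| "expr_bits (Read a e) = 1"
| "expr_bits (Add e f) = expr_bits e + expr_bits f + 1"
| "expr_bits (Sub e f) = expr_bits e"
| "expr_bits (Mul e f) = expr_bits e + expr_bits f"
| "expr_bits (Div e f) = expr_bits e"
| "expr_bits (Approx e) = 0"

fun expr_cost :: "expr \<Rightarrow> nat" where
  "expr_cost (Const k) = 1 + expr_bits (Const k)"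
| "expr_cost (Read a e) = 1 + expr_bits (Read a e) + expr_cost e"
| "expr_cost (Add e f) = 1 + expr_bits (Add e f) + expr_cost e + expr_cost f"
| "expr_cost (Sub e f) = 1 + expr_bits (Sub e f) + expr_cost e + expr_cost f"
| "expr_cost (Mul e f) = 1 + expr_bits (Mul e f) + expr_cost e + expr_cost f"
| "expr_cost (Div e f) = 1 + expr_bits (Div e f) + expr_cost e + expr_cost f"
| "expr_cost (Approx e) = 0"

fun com_approx_free :: "com \<Rightarrow> bool" where
  "com_approx_free Skip \<longleftrightarrow> True"
| "com_approx_free (Write a e f) \<longleftrightarrow> approx_free e \<and> approx_free f"
| "com_approx_free (Flip a e) \<longleftrightarrow> approx_free e"
| "com_approx_free (Seq c d) \<longleftrightarrow> com_approx_free c \<and> com_approx_free d"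
| "com_approx_free (If e c d) \<longleftrightarrow> approx_free e \<and> com_approx_free c \<and> com_approx_free d"
| "com_approx_free (While e c) \<longleftrightarrow> approx_free e \<and> com_approx_free c"

fun com_cost :: "com \<Rightarrow> nat" where
  "com_cost Skip = 1"
| "com_cost (Write a e f) = 1 + expr_cost e + expr_cost f"
| "com_cost (Flip a e) = 1 + expr_cost e"
| "com_cost (Seq c d) = 1 + com_cost c + com_cost d"
| "com_cost (If e c d) = 1 + expr_cost e + com_cost c + com_cost d"
| "com_cost (While e c) = 1 + expr_cost e + com_cost c"

text \<open>All registers are bounded, also those never written, so an indirect read needs no
  information about the address it computes.\<close>

definition mem_bdd :: "nat \<Rightarrow> mem \<Rightarrow> bool" where
  "mem_bdd W s \<longleftrightarrow> (\<forall>a i. s a i < 2 ^ W)"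

lemma eval_bdd:
  assumes "approx_free e" "mem_bdd W s" "1 \<le> W"
  shows "eval \<beta> s e < 2 ^ (expr_bits e * W)"
  using assms(1)
proof (induction e)
  case (Const k)
  have "k < 2 ^ k" by (rule less_exp)
  also have "(2::nat) ^ k \<le> 2 ^ (Suc k * W)"
    using assms(3) by (intro power_increasing) (cases W; simp)+
  finally show ?case by simp
next
  case (Read a e)
  then show ?case using assms(2) by (simp add: mem_bdd_def)
next
  case (Add e f)
  let ?x = "expr_bits e * W" and ?y = "expr_bits f * W"
  have "eval \<beta> s e + eval \<beta> s f < 2 ^ ?x + 2 ^ ?y" using Add by simp
  also have "\<dots> \<le> 2 ^ (?x + ?y) + (2::nat) ^ (?x + ?y)"
    by (intro add_mono power_increasing) auto
  also have "\<dots> = 2 ^ Suc (?x + ?y)" by simp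
  also have "\<dots> \<le> 2 ^ (expr_bits (Add e f) * W)"
    using assms(3) by (intro power_increasing) (auto simp: algebra_simps)
  finally show ?case by simp
next
  case (Sub e f)
  then show ?case by (simp add: less_imp_diff_less)
next
  case (Mul e f)
  then show ?case by (auto simp: add_mult_distrib power_add intro!: mult_strict_mono)
next
  case (Div e f)
  then show ?case by (auto intro: le_less_trans[OF div_le_dividend])
qed auto

lemma floorlog2_le: "x < 2 ^ k \<Longrightarrow> floorlog 2 x \<le> k"
  by (simp add: floorlog_leI)

lemma cost_bdd:
  assumes "approx_free e" "mem_bdd W s" "1 \<le> W"
  shows "cost \<beta> s e \<le> expr_cost e * W"
  using assms(1)
proof (induction e)
  case (Const k)
  have "floorlog 2 k \<le> Suc k * W"
    using eval_bdd[OF Const(1) assms(2,3)] by (intro floorlog2_le) simp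
  then show ?case using assms(3) by (simp add: algebra_simps)
next
  case (Read a e)
  have "floorlog 2 (eval \<beta> s (Read a e)) \<le> expr_bits (Read a e) * W"
    using eval_bdd[OF Read(2) assms(2,3)] by (rule floorlog2_le)
  then show ?case using assms(3) Read by (simp add: algebra_simps)
next
  case (Add e f)
  have "floorlog 2 (eval \<beta> s (Add e f)) \<le> expr_bits (Add e f) * W"
    using eval_bdd[OF Add(3) assms(2,3)] by (rule floorlog2_le)
  then show ?case using assms(3) Add by (simp add: algebra_simps)
next
  case (Sub e f)
  have "floorlog 2 (eval \<beta> s (Sub e f)) \<le> expr_bits (Sub e f) * W"
    using eval_bdd[OF Sub(3) assms(2,3)] by (rule floorlog2_le)
  then show ?case using assms(3) Sub by (simp add: algebra_simps)
next
  case (Mul e f)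
  have "floorlog 2 (eval \<beta> s (Mul e f)) \<le> expr_bits (Mul e f) * W"
    using eval_bdd[OF Mul(3) assms(2,3)] by (rule floorlog2_le)
  then show ?case using assms(3) Mul by (simp add: algebra_simps)
next
  case (Div e f)
  have "floorlog 2 (eval \<beta> s (Div e f)) \<le> expr_bits (Div e f) * W"
    using eval_bdd[OF Div(3) assms(2,3)] by (rule floorlog2_le)
  then show ?case using assms(3) Div by (simp add: algebra_simps)
qed auto

text \<open>Only steps are counted, and every stored number must stay below \<open>2 ^ W\<close>; the logarithmic
  cost is then at most the number of steps times \<open>W\<close> times a constant of the program.\<close>

inductive bexec ::
  "real \<Rightarrow> nat \<Rightarrow> com \<Rightarrow> mem \<times> bool list \<Rightarrow> nat \<Rightarrow> mem \<times> bool list \<Rightarrow> bool" for \<beta> W where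
  Skip: "bexec \<beta> W Skip (s, r) 1 (s, r)"
| Write: "eval \<beta> s f < 2 ^ W \<Longrightarrow>
     bexec \<beta> W (Write a e f) (s, r) 1 (upd s a (eval \<beta> s e) (eval \<beta> s f), r)"
| Flip: "bexec \<beta> W (Flip a e) (s, x # r) 1 (upd s a (eval \<beta> s e) (of_bool x), r)"
| Seq: "bexec \<beta> W c C t C' \<Longrightarrow> bexec \<beta> W d C' t' C'' \<Longrightarrow> bexec \<beta> W (Seq c d) C (1 + t + t') C''"
| IfTrue: "eval \<beta> s e \<noteq> 0 \<Longrightarrow> bexec \<beta> W c (s, r) t C \<Longrightarrow>
     bexec \<beta> W (If e c d) (s, r) (1 + t) C"
| IfFalse: "eval \<beta> s e = 0 \<Longrightarrow> bexec \<beta> W d (s, r) t C \<Longrightarrow>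
     bexec \<beta> W (If e c d) (s, r) (1 + t) C"
| WhileFalse: "eval \<beta> s e = 0 \<Longrightarrow> bexec \<beta> W (While e c) (s, r) 1 (s, r)"
| WhileTrue: "eval \<beta> s e \<noteq> 0 \<Longrightarrow> bexec \<beta> W c (s, r) t C \<Longrightarrow> bexec \<beta> W (While e c) C t' C' \<Longrightarrow>
     bexec \<beta> W (While e c) (s, r) (1 + t + t') C'"

lemma mem_bdd_upd: "mem_bdd W s \<Longrightarrow> x < 2 ^ W \<Longrightarrow> mem_bdd W (upd s a i x)"
  by (simp add: mem_bdd_def upd_def)

lemma bexec_mem_bdd:
  assumes "bexec \<beta> W c C k C'" "mem_bdd W (fst C)" "1 \<le> W"
  shows "mem_bdd W (fst C')"
  using assms
proof (induction rule: bexec.induct)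
  case (Flip a e s x r)
  have "(1::nat) < 2 ^ W" using Flip(2) less_exp[of W] by linarith
  then show ?case using Flip by (auto intro!: mem_bdd_upd)
qed (auto intro: mem_bdd_upd)

text \<open>Each counted step evaluates the expressions at one node of the program, and
  \<open>com_cost c\<close> sums their costs over all nodes. The same factor
  \<open>com_cost c * W\<close> therefore serves every step, however often a loop returns to its
  body.\<close>

lemma bexec_exec:
  assumes "bexec \<beta> W c C k C'" "mem_bdd W (fst C)" "1 \<le> W" "com_approx_free c"
  shows "\<exists>t\<le>k * com_cost c * W. exec \<beta> c C t C'"
  using assms
proof (induction rule: bexec.induct)
  case (Skip s r)
  then show ?case by (auto intro!: exI[of _ 1] exec.Skip)
next
  case (Write s f a e r)
  have "1 + cost \<beta> s e + cost \<beta> s f \<le> 1 * com_cost (Write a e f) * W"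
    using cost_bdd[of e W s \<beta>] cost_bdd[of f W s \<beta>] Write by (simp add: algebra_simps)
  then show ?case by (blast intro: exec.Write)
next
  case (Flip a e s x r)
  have "1 + cost \<beta> s e \<le> 1 * com_cost (Flip a e) * W"
    using cost_bdd[of e W s \<beta>] Flip by (simp add: algebra_simps)
  then show ?case by (blast intro: exec.Flip)
next
  case (Seq c C k C' d k' C'')
  have "mem_bdd W (fst C')" using bexec_mem_bdd[OF Seq(1)] Seq by blast
  then obtain t t' where t: "t \<le> k * com_cost c * W" "exec \<beta> c C t C'"
    "t' \<le> k' * com_cost d * W" "exec \<beta> d C' t' C''"
    using Seq by auto
  have "1 \<le> com_cost (Seq c d) * W" using Seq(6) by simp
  moreover have "k * com_cost c * W \<le> k * com_cost (Seq c d) * W"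
    "k' * com_cost d * W \<le> k' * com_cost (Seq c d) * W" by (intro mult_le_mono; simp)+
  ultimately have "1 + t + t' \<le> (1 + k + k') * com_cost (Seq c d) * W"
    using t by (simp only: add_mult_distrib mult_1)
  then show ?case using t by (blast intro: exec.Seq)
next
  case (IfTrue s e c r k C d)
  then obtain t where t: "t \<le> k * com_cost c * W" "exec \<beta> c (s, r) t C" by auto
  have "1 + cost \<beta> s e \<le> com_cost (If e c d) * W"
    using cost_bdd[of e W s \<beta>] IfTrue by (simp add: algebra_simps)
  moreover have "k * com_cost c * W \<le> k * com_cost (If e c d) * W" by (intro mult_le_mono; simp)
  ultimately have "1 + cost \<beta> s e + t \<le> (1 + k) * com_cost (If e c d) * W"
    using t by (simp only: add_mult_distrib mult_1)
  then show ?case using t IfTrue by (blast intro: exec.IfTrue)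
next
  case (IfFalse s e d r k C c)
  then obtain t where t: "t \<le> k * com_cost d * W" "exec \<beta> d (s, r) t C" by auto
  have "1 + cost \<beta> s e \<le> com_cost (If e c d) * W"
    using cost_bdd[of e W s \<beta>] IfFalse by (simp add: algebra_simps)
  moreover have "k * com_cost d * W \<le> k * com_cost (If e c d) * W" by (intro mult_le_mono; simp)
  ultimately have "1 + cost \<beta> s e + t \<le> (1 + k) * com_cost (If e c d) * W"
    using t by (simp only: add_mult_distrib mult_1)
  then show ?case using t IfFalse by (blast intro: exec.IfFalse)
next
  case (WhileFalse s e c r)
  have "1 + cost \<beta> s e \<le> 1 * com_cost (While e c) * W"
    using cost_bdd[of e W s \<beta>] WhileFalse by (simp add: algebra_simps)
  then show ?case using WhileFalse by (blast intro: exec.WhileFalse)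
next
  case (WhileTrue s e c r k C k' C')
  have "mem_bdd W (fst C)" using bexec_mem_bdd[OF WhileTrue(2)] WhileTrue by simp
  then obtain t t' where t: "t \<le> k * com_cost c * W" "exec \<beta> c (s, r) t C"
    "t' \<le> k' * com_cost (While e c) * W" "exec \<beta> (While e c) C t' C'"
    using WhileTrue by auto
  have "1 + cost \<beta> s e \<le> com_cost (While e c) * W"
    using cost_bdd[of e W s \<beta>] WhileTrue by (simp add: algebra_simps)
  moreover have "k * com_cost c * W \<le> k * com_cost (While e c) * W" by (intro mult_le_mono; simp)
  ultimately have "1 + cost \<beta> s e + t + t' \<le> (1 + k + k') * com_cost (While e c) * W"
    using t by (simp only: add_mult_distrib mult_1)
  then show ?case using t WhileTrue by (blast intro: exec.WhileTrue)
qed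

text \<open>Total correctness with explicit coin flips: \<open>bs\<close> is exactly what the run
  consumes, and steps and final memory are the same for every continuation \<open>r\<close>. The
  result is thus a function of \<open>bs\<close>, which is what the counting of flip sequences later
  relies on.\<close>

definition wp ::
  "real \<Rightarrow> nat \<Rightarrow> com \<Rightarrow> bool list \<Rightarrow> nat \<Rightarrow> (mem \<Rightarrow> bool) \<Rightarrow> mem \<Rightarrow> bool" where
  "wp \<beta> W c bs k Q s \<longleftrightarrow> (\<exists>k'\<le>k. \<exists>s'. Q s' \<and> (\<forall>r. bexec \<beta> W c (s, bs @ r) k' (s', r)))"

lemma wp_mono:
  assumes "wp \<beta> W c bs k Q s" "k \<le> k'" "\<And>s'. Q s' \<Longrightarrow> Q' s'"
  shows "wp \<beta> W c bs k' Q' s"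
  using assms unfolding wp_def by (meson le_trans)

text \<open>Every \<open>Write\<close> of \<open>bexec\<close> is checked for overflow and a flip
  stores at most 1, so the bound on all registers is an invariant that postconditions do not have to
  carry.\<close>

lemma wp_mono_bdd:
  assumes "wp \<beta> W c bs k Q s" "k \<le> k'" "mem_bdd W s" "1 \<le> W"
    "\<And>s'. Q s' \<Longrightarrow> mem_bdd W s' \<Longrightarrow> Q' s'"
  shows "wp \<beta> W c bs k' Q' s"
proof -
  from assms(1) obtain j s' where j: "j \<le> k" "Q s'" "\<forall>r. bexec \<beta> W c (s, bs @ r) j (s', r)"
    unfolding wp_def by blast
  from j(3) have "bexec \<beta> W c (s, bs @ []) j (s', [])" by blast
  from bexec_mem_bdd[OF this] assms have "mem_bdd W s'" by simp
  with j assms show ?thesis unfolding wp_def by (meson le_trans)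
qed

lemma wp_SeqI:
  assumes "wp \<beta> W c bs k (wp \<beta> W d bs' k' Q) s"
  shows "wp \<beta> W (Seq c d) (bs @ bs') (1 + k + k') Q s"
proof -
  from assms obtain j s' where j: "j \<le> k" "wp \<beta> W d bs' k' Q s'"
    "\<forall>r. bexec \<beta> W c (s, bs @ r) j (s', r)" unfolding wp_def by blast
  from j(2) obtain j' s'' where j': "j' \<le> k'" "Q s''"
    "\<forall>r. bexec \<beta> W d (s', bs' @ r) j' (s'', r)" unfolding wp_def by blast
  have "\<forall>r. bexec \<beta> W (Seq c d) (s, (bs @ bs') @ r) (1 + j + j') (s'', r)"
    using j j' by (auto intro!: bexec.Seq[where ?c = c, simplified])
  then show ?thesis unfolding wp_def using j j' by (meson add_le_mono le_refl)
qed

lemma wp_Seq: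
  assumes "wp \<beta> W c [] k (wp \<beta> W d bs k' Q) s" "1 + k + k' \<le> l"
  shows "wp \<beta> W (Seq c d) bs l Q s"
  using wp_mono[OF wp_SeqI[OF assms(1)] assms(2)] by auto

lemma wp_WhileTrueI:
  assumes "eval \<beta> s e \<noteq> 0" "wp \<beta> W c bs k (wp \<beta> W (While e c) bs' k' Q) s"
  shows "wp \<beta> W (While e c) (bs @ bs') (1 + k + k') Q s"
proof -
  from assms(2) obtain j s' where j: "j \<le> k" "wp \<beta> W (While e c) bs' k' Q s'"
    "\<forall>r. bexec \<beta> W c (s, bs @ r) j (s', r)" unfolding wp_def by blast
  from j(2) obtain j' s'' where j': "j' \<le> k'" "Q s''"
    "\<forall>r. bexec \<beta> W (While e c) (s', bs' @ r) j' (s'', r)" unfolding wp_def by blast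
  have "\<forall>r. bexec \<beta> W (While e c) (s, (bs @ bs') @ r) (1 + j + j') (s'', r)"
    using j j' assms(1) by (auto intro!: bexec.WhileTrue[simplified])
  then show ?thesis unfolding wp_def using j j' by (meson add_le_mono le_refl)
qed

lemma wp_WhileFalseI:
  assumes "eval \<beta> s e = 0" "Q s" "1 \<le> k"
  shows "wp \<beta> W (While e c) [] k Q s"
  using assms bexec.WhileFalse[OF assms(1), of W c] unfolding wp_def by auto

lemma wp_IfI:
  assumes "eval \<beta> s e \<noteq> 0 \<Longrightarrow> wp \<beta> W c bs k Q s" "eval \<beta> s e = 0 \<Longrightarrow> wp \<beta> W d bs k Q s"
  shows "wp \<beta> W (If e c d) bs (1 + k) Q s"
proof (cases "eval \<beta> s e = 0")
  case True
  from assms(2)[OF this] obtain j s' where "j \<le> k" "Q s'"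
    "\<forall>r. bexec \<beta> W d (s, bs @ r) j (s', r)" unfolding wp_def by blast
  then show ?thesis unfolding wp_def using bexec.IfFalse[OF True, of W d _ _ _ c]
    by (meson add_le_mono le_refl)
next
  case False
  from assms(1)[OF this] obtain j s' where "j \<le> k" "Q s'"
    "\<forall>r. bexec \<beta> W c (s, bs @ r) j (s', r)" unfolding wp_def by blast
  then show ?thesis unfolding wp_def using bexec.IfTrue[OF False, of W c _ _ _ d]
    by (meson add_le_mono le_refl)
qed

section \<open>Straight-line code and counted loops\<close>

fun straight :: "com \<Rightarrow> bool" where
  "straight Skip \<longleftrightarrow> True"
| "straight (Write a e f) \<longleftrightarrow> True"
| "straight (Seq c d) \<longleftrightarrow> straight c \<and> straight d"
| "straight _ \<longleftrightarrow> False"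

text \<open>Code without branches and flips is evaluated by rewriting: this function yields the
  memory as nested updates, and \<open>straight_bdd\<close> collects the overflow conditions met on
  the way.\<close>

fun straight_run :: "real \<Rightarrow> com \<Rightarrow> mem \<Rightarrow> mem" where
  "straight_run \<beta> (Write a e f) s = upd s a (eval \<beta> s e) (eval \<beta> s f)"
| "straight_run \<beta> (Seq c d) s = straight_run \<beta> d (straight_run \<beta> c s)"
| "straight_run \<beta> _ s = s"

fun straight_bdd :: "real \<Rightarrow> nat \<Rightarrow> com \<Rightarrow> mem \<Rightarrow> bool" where
  "straight_bdd \<beta> W (Write a e f) s \<longleftrightarrow> eval \<beta> s f < 2 ^ W"
| "straight_bdd \<beta> W (Seq c d) s \<longleftrightarrow> straight_bdd \<beta> W c s \<and> straight_bdd \<beta> W d (straight_run \<beta> c s)"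
| "straight_bdd \<beta> W _ s \<longleftrightarrow> True"

fun straight_steps :: "com \<Rightarrow> nat" where
  "straight_steps (Seq c d) = 1 + straight_steps c + straight_steps d"
| "straight_steps _ = 1"

lemma bexec_straight:
  "straight c \<Longrightarrow> straight_bdd \<beta> W c s \<Longrightarrow> bexec \<beta> W c (s, r) (straight_steps c) (straight_run \<beta> c s, r)"
  by (induction c arbitrary: s) (auto intro!: bexec.intros bexec.Skip[simplified]
    bexec.Write[simplified] bexec.Seq[simplified])

lemma wp_straight:
  assumes "straight c" "straight_bdd \<beta> W c s" "Q (straight_run \<beta> c s)" "straight_steps c \<le> k"
  shows "wp \<beta> W c [] k Q s"
  unfolding wp_def using bexec_straight[OF assms(1,2)] assms(3,4) by auto

text \<open>Induction on the passes still to come. This serves the loops whose length is known in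
  advance and which flip no coins; the search loop, whose invariant changes with the level of the
  recursion, is treated through \<open>reach\<close>.\<close>

lemma wp_While_count:
  assumes "\<And>i s. i < m \<Longrightarrow> I i s \<Longrightarrow> eval \<beta> s e \<noteq> 0 \<and> wp \<beta> W c [] k (I (Suc i)) s"
    and "\<And>s. I m s \<Longrightarrow> eval \<beta> s e = 0" and "I 0 s"
  shows "wp \<beta> W (While e c) [] (1 + m * (1 + k)) (I m) s"
proof -
  have "wp \<beta> W (While e c) [] (1 + j * (1 + k)) (I m) s"
    if "j \<le> m" "I (m - j) s" for j s
    using that
  proof (induction j arbitrary: s)
    case 0
    then show ?case using assms(2) by (auto intro: wp_WhileFalseI)
  next
    case (Suc j)
    then have *: "m - Suc j < m" "Suc (m - Suc j) = m - j" by auto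
    from assms(1)[OF this(1) Suc.prems(2)] *(2)
    have 1: "eval \<beta> s e \<noteq> 0" "wp \<beta> W c [] k (I (m - j)) s" by auto
    have "wp \<beta> W c [] k (wp \<beta> W (While e c) [] (1 + j * (1 + k)) (I m)) s"
      using Suc by (intro wp_mono[OF 1(2) le_refl]) auto
    from wp_WhileTrueI[OF 1(1) this] show ?case
      by (simp add: algebra_simps)
  qed
  from this[of m s] assms(3) show ?thesis by simp
qed

section \<open>Weighted configurations and the ratio recursion\<close>

text \<open>The field \<open>g x t\<close> is the weight of state \<open>t\<close> at vertex \<open>x\<close>; edges weigh \<open>a\<close> (equal states) or
  \<open>c\<close> (different states), so that \<open>a / c\<close> plays the role of \<open>B\<close> and everything is an integer.
  In \<open>split_fields\<close> the removed vertex looks like state 1 to the neighbours \<open>y < \<theta> - 1\<close>, like state 2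
  to those with \<open>y > \<theta> - 1\<close>, and is invisible to \<open>\<theta> - 1\<close>: the call for the child \<open>w\<close> uses
  \<open>\<theta> = w + 1\<close>, while \<open>n + 1\<close> and \<open>0\<close> fix the vertex to state 1 and 2.\<close>

definition fix_fields :: "nat set set \<Rightarrow> nat \<Rightarrow> nat \<Rightarrow> (nat \<Rightarrow> nat \<Rightarrow> nat) \<Rightarrow> nat \<Rightarrow> nat \<Rightarrow> (nat \<Rightarrow> nat \<Rightarrow> nat)" where
  "fix_fields E a c g v s = (\<lambda>y t. g y t * (if {v, y} \<in> E then if t = s then a else c else 1))"

definition split_fields :: "nat set set \<Rightarrow> nat \<Rightarrow> nat \<Rightarrow> (nat \<Rightarrow> nat \<Rightarrow> nat) \<Rightarrow> nat \<Rightarrow> nat \<Rightarrow> (nat \<Rightarrow> nat \<Rightarrow> nat)" where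
  "split_fields E a c g v \<theta> = (\<lambda>y t. g y t * (if {v, y} \<in> E then
     (if y + 1 < \<theta> then if t = 1 then a else c
      else if \<theta> < y + 1 then if t = 1 then c else a else 1) else 1))"

definition weight :: "nat set set \<Rightarrow> nat \<Rightarrow> nat \<Rightarrow> nat set \<Rightarrow> (nat \<Rightarrow> nat \<Rightarrow> nat) \<Rightarrow> (nat \<Rightarrow> nat) \<Rightarrow> nat" where
  "weight E a c U g \<sigma> = (\<Prod>x\<in>U. g x (\<sigma> x)) *
     (\<Prod>e\<in>{e \<in> E. e \<subseteq> U}. if \<forall>x\<in>e. \<forall>y\<in>e. \<sigma> x = \<sigma> y then a else c)"

definition weight_sum :: "nat set set \<Rightarrow> nat \<Rightarrow> nat \<Rightarrow> nat set \<Rightarrow> (nat \<Rightarrow> nat \<Rightarrow> nat) \<Rightarrow> nat" where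
  "weight_sum E a c U g = (\<Sum>\<sigma>\<in>configs U. weight E a c U g \<sigma>)"

text \<open>The total weight of the configurations of \<open>U\<close> with state \<open>s\<close>
  at \<open>v\<close>, written as a partition sum of the graph without \<open>v\<close>.\<close>

definition marginal :: "nat set set \<Rightarrow> nat \<Rightarrow> nat \<Rightarrow> nat set \<Rightarrow> (nat \<Rightarrow> nat \<Rightarrow> nat) \<Rightarrow> nat \<Rightarrow> nat \<Rightarrow> nat" where
  "marginal E a c U g v s = g v s * weight_sum E a c (U - {v}) (fix_fields E a c g v s)"

text \<open>Numerator (\<open>t = 1\<close>) and denominator (\<open>t = 2\<close>) of the ratio recursion, cut off at depth \<open>d\<close>.\<close>

fun approx_marg :: "nat set set \<Rightarrow> nat \<Rightarrow> nat \<Rightarrow> nat \<Rightarrow> nat set \<Rightarrow> (nat \<Rightarrow> nat \<Rightarrow> nat) \<Rightarrow> nat \<Rightarrow> nat \<Rightarrow> nat" where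
  "approx_marg E a c 0 U g v t = g v t"
| "approx_marg E a c (Suc d) U g v t = g v t * (\<Prod>w\<in>{w \<in> U - {v}. {v, w} \<in> E}.
     (if t = 1 then a else c) * approx_marg E a c d (U - {v}) (split_fields E a c g v (w + 1)) w 1 +
     (if t = 1 then c else a) * approx_marg E a c d (U - {v}) (split_fields E a c g v (w + 1)) w 2)"

text \<open>Self-avoiding walks with \<open>d\<close> edges. The recursion is that of
  \<open>approx_marg\<close>, so these are the leaves of its call tree at depth
  \<open>d\<close>.\<close>

fun walks :: "nat set set \<Rightarrow> nat \<Rightarrow> nat set \<Rightarrow> nat \<Rightarrow> nat" where
  "walks E 0 U v = 1"
| "walks E (Suc d) U v = (\<Sum>w\<in>{w \<in> U - {v}. {v, w} \<in> E}. walks E d (U - {v}) w)"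

lemma simple_graph_subset:
  "simple_graph V E \<Longrightarrow> e \<in> E \<Longrightarrow> e \<subseteq> V \<and> card e = 2"
  by (simp add: simple_graph_def)

lemma simple_graph_finite: "simple_graph V E \<Longrightarrow> finite E"
  unfolding simple_graph_def by (meson Pow_iff finite_Pow_iff finite_subset subsetI)

lemma simple_graph_irrefl: "simple_graph V E \<Longrightarrow> {v, v} \<notin> E"
  using simple_graph_subset[of V E "{v, v}"] by auto

text \<open>Fields are compared at the states 1 and 2 only, because \<open>fix_fields\<close> and
  \<open>split_fields\<close> may carry different values at other arguments.\<close>

lemma weight_cong:
  assumes "\<And>x t. x \<in> U \<Longrightarrow> t \<in> {1, 2} \<Longrightarrow> g x t = h x t" "\<And>x. x \<in> U \<Longrightarrow> \<sigma> x = \<rho> x"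
    "\<And>x. x \<in> U \<Longrightarrow> \<rho> x \<in> {1, 2}"
  shows "weight E a c U g \<sigma> = weight E a c U h \<rho>"
proof -
  have "(\<Prod>x\<in>U. g x (\<sigma> x)) = (\<Prod>x\<in>U. h x (\<rho> x))"
    using assms by (intro prod.cong) auto
  moreover have "(\<Prod>e\<in>{e \<in> E. e \<subseteq> U}. if \<forall>x\<in>e. \<forall>y\<in>e. \<sigma> x = \<sigma> y then a else c) =
    (\<Prod>e\<in>{e \<in> E. e \<subseteq> U}. if \<forall>x\<in>e. \<forall>y\<in>e. \<rho> x = \<rho> y then a else c)"
    using assms(2) by (intro prod.cong refl if_cong) (auto simp: subset_eq)
  ultimately show ?thesis by (simp add: weight_def)
qed

lemma configs_mem: "\<sigma> \<in> configs U \<Longrightarrow> x \<in> U \<Longrightarrow> \<sigma> x \<in> {1, 2}"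
  unfolding configs_def by (rule PiE_mem)

lemma weight_sum_cong:
  assumes "\<And>x t. x \<in> U \<Longrightarrow> t \<in> {1, 2} \<Longrightarrow> g x t = h x t"
  shows "weight_sum E a c U g = weight_sum E a c U h"
  unfolding weight_sum_def by (intro sum.cong refl weight_cong assms) (auto dest: configs_mem)

text \<open>Once the state of \<open>v\<close> is known, an edge at \<open>v\<close> weighs
  \<open>a\<close> or \<open>c\<close> according to its other endpoint alone, and can be charged to
  the field there.\<close>

lemma weight_step:
  assumes "simple_graph V E" "U \<subseteq> V" "v \<in> U" "\<sigma> v = s"
  shows "weight E a c U g \<sigma> = g v s * weight E a c (U - {v}) (fix_fields E a c g v s) \<sigma>"
proof -
  let ?N = "{x \<in> U - {v}. {v, x} \<in> E}"
  let ?m = "\<lambda>e. if \<forall>x\<in>e. \<forall>y\<in>e. \<sigma> x = \<sigma> y then a else c"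
  have fin: "finite U" "finite E"
    using assms simple_graph_finite by (auto simp: simple_graph_def intro: finite_subset)
  have split: "{e \<in> E. e \<subseteq> U} = {e \<in> E. e \<subseteq> U - {v}} \<union> (\<lambda>x. {v, x}) ` ?N"
  proof (intro equalityI subsetI)
    fix e assume e: "e \<in> {e \<in> E. e \<subseteq> U}"
    show "e \<in> {e \<in> E. e \<subseteq> U - {v}} \<union> (\<lambda>x. {v, x}) ` ?N"
    proof (cases "v \<in> e")
      case True
      have "card e = 2" using simple_graph_subset[OF assms(1)] e by auto
      then obtain x y where xy: "e = {x, y}" "x \<noteq> y" by (auto simp: card_2_iff)
      then show ?thesis using e True by (auto simp: insert_commute)
    qed (use e in auto)
  qed (use assms in auto)
  have "(\<Prod>e\<in>{e \<in> E. e \<subseteq> U}. ?m e) = (\<Prod>e\<in>{e \<in> E. e \<subseteq> U - {v}}. ?m e) * (\<Prod>e\<in>(\<lambda>x. {v, x}) ` ?N. ?m e)"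
    unfolding split using fin by (intro prod.union_disjoint) auto
  also have "(\<Prod>e\<in>(\<lambda>x. {v, x}) ` ?N. ?m e) = (\<Prod>x\<in>?N. if \<sigma> x = s then a else c)"
    using assms(4) by (subst prod.reindex) (auto simp: inj_on_def doubleton_eq_iff intro!: prod.cong)
  finally have e: "(\<Prod>e\<in>{e \<in> E. e \<subseteq> U}. ?m e) =
    (\<Prod>e\<in>{e \<in> E. e \<subseteq> U - {v}}. ?m e) * (\<Prod>x\<in>?N. if \<sigma> x = s then a else c)" .
  have "(\<Prod>x\<in>U - {v}. fix_fields E a c g v s x (\<sigma> x)) = (\<Prod>x\<in>U - {v}. g x (\<sigma> x)) *
      (\<Prod>x\<in>U - {v}. if {v, x} \<in> E then if \<sigma> x = s then a else c else 1)"
    by (simp add: fix_fields_def prod.distrib)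
  also have "(\<Prod>x\<in>U - {v}. if {v, x} \<in> E then if \<sigma> x = s then a else c else 1) =
      (\<Prod>x\<in>?N. if \<sigma> x = s then a else c)"
    using fin by (subst prod.inter_filter) auto
  finally have f: "(\<Prod>x\<in>U - {v}. fix_fields E a c g v s x (\<sigma> x)) =
    (\<Prod>x\<in>U - {v}. g x (\<sigma> x)) * (\<Prod>x\<in>?N. if \<sigma> x = s then a else c)" .
  have "(\<Prod>x\<in>U. g x (\<sigma> x)) = g v s * (\<Prod>x\<in>U - {v}. g x (\<sigma> x))"
    using fin assms by (subst prod.remove[of _ v]) auto
  then show ?thesis unfolding weight_def e f by (simp add: algebra_simps)
qed

lemma sum_configs_step:
  fixes f :: "(nat \<Rightarrow> nat) \<Rightarrow> nat"
  assumes "v \<in> U" "finite U"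
  shows "(\<Sum>\<sigma>\<in>configs U. f \<sigma>) = (\<Sum>s\<in>{1, 2}. \<Sum>\<sigma>\<in>configs (U - {v}). f (\<sigma>(v := s)))"
proof -
  have U: "U = insert v (U - {v})" using assms by auto
  have "configs U = (\<lambda>(s, \<sigma>). \<sigma>(v := s)) ` ({1, 2} \<times> configs (U - {v}))"
    unfolding configs_def by (subst U, subst PiE_insert_eq) simp
  moreover have "inj_on (\<lambda>(s, \<sigma>). \<sigma>(v := s)) ({1, 2} \<times> configs (U - {v}))"
    unfolding configs_def using inj_combinator[of v "U - {v}" "\<lambda>_. {1, 2 :: nat}"] by simp
  ultimately have "(\<Sum>\<sigma>\<in>configs U. f \<sigma>) =
      (\<Sum>(s, \<sigma>)\<in>{1, 2} \<times> configs (U - {v}). f (\<sigma>(v := s)))"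
    by (simp add: sum.reindex case_prod_unfold)
  then show ?thesis by (simp add: sum.cartesian_product)
qed

lemma weight_sum_step:
  assumes "simple_graph V E" "U \<subseteq> V" "v \<in> U"
  shows "weight_sum E a c U g = marginal E a c U g v 1 + marginal E a c U g v 2"
proof -
  have fin: "finite U" using assms by (auto simp: simple_graph_def intro: finite_subset)
  have *: "weight E a c U g (\<sigma>(v := s)) = g v s * weight E a c (U - {v}) (fix_fields E a c g v s) \<sigma>"
    if "\<sigma> \<in> configs (U - {v})" for \<sigma> s
  proof -
    have "weight E a c (U - {v}) (fix_fields E a c g v s) (\<sigma>(v := s)) = weight E a c (U - {v}) (fix_fields E a c g v s) \<sigma>"
      using that by (intro weight_cong) (auto dest: configs_mem)
    then show ?thesis using weight_step[OF assms, of "\<sigma>(v := s)" s] by simp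
  qed
  show ?thesis
    unfolding weight_sum_def marginal_def sum_configs_step[OF assms(3) fin]
    by (simp add: * sum_distrib_left)
qed

lemma weight_pos:
  assumes "0 < a" "0 < c" "\<And>x t. 0 < g x t"
  shows "0 < weight E a c U g \<sigma>"
  unfolding weight_def using assms by (auto intro!: prod_pos)

lemma configs_nonempty: "configs U \<noteq> {}"
  by (simp add: configs_def PiE_eq_empty_iff)

lemma weight_sum_pos:
  assumes "0 < a" "0 < c" "\<And>x t. 0 < g x t" "finite U"
  shows "0 < weight_sum E a c U g"
  unfolding weight_sum_def using assms weight_pos configs_nonempty finite_configs
  by (intro sum_pos) blast+

lemma fix_fields_pos: "0 < a \<Longrightarrow> 0 < c \<Longrightarrow> (\<And>x t. 0 < g x t) \<Longrightarrow> 0 < fix_fields E a c g v s x t"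
  by (simp add: fix_fields_def)

lemma split_fields_pos: "0 < a \<Longrightarrow> 0 < c \<Longrightarrow> (\<And>x t. 0 < g x t) \<Longrightarrow> 0 < split_fields E a c g v s x t"
  by (simp add: split_fields_def)

lemma marginal_pos:
  assumes "0 < a" "0 < c" "\<And>x t. 0 < g x t" "finite U"
  shows "0 < marginal E a c U g v s"
  unfolding marginal_def using assms by (auto intro!: weight_sum_pos fix_fields_pos)

lemma approx_marg_pos:
  assumes "0 < a" "0 < c" "\<And>x t. 0 < g x t"
  shows "0 < approx_marg E a c d U g v t"
  using assms(3)
proof (induction d arbitrary: U g v t)
  case (Suc d)
  have *: "0 < approx_marg E a c d (U - {v}) (split_fields E a c g v (w + 1)) w t" for w t
    using assms Suc.prems by (intro Suc.IH split_fields_pos)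
  show ?case using Suc.prems * assms by (auto intro!: prod_pos simp del: One_nat_def)
qed auto

text \<open>The map \<open>F\<close> of the overview for \<open>B = a / c\<close>, expanded by
  \<open>c\<close>.\<close>

definition edge_map :: "real \<Rightarrow> real \<Rightarrow> real \<Rightarrow> real" where
  "edge_map a c R = (a * R + c) / (c * R + a)"

text \<open>Replacing state 2 of \<open>v\<close>, as seen by its neighbours, by state 1 one neighbour at a time
  makes the ratio of the two marginals at \<open>v\<close> telescope into ratios of smaller graphs.\<close>

lemma marginal_ratio_recursion:
  assumes "simple_graph {..<n} E" "U \<subseteq> {..<n}" "v \<in> U" "0 < a" "0 < c" "\<And>x t. 0 < g x t"
  shows "real (marginal E a c U g v 1) / real (marginal E a c U g v 2) = real (g v 1) / real (g v 2) *
    (\<Prod>w\<in>{w \<in> U - {v}. {v, w} \<in> E}. edge_map a c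
       (marginal E a c (U - {v}) (split_fields E a c g v (w + 1)) w 1 /
        marginal E a c (U - {v}) (split_fields E a c g v (w + 1)) w 2))"
proof -
  let ?V = "U - {v}"
  \<comment> \<open>In \<open>h k\<close> the neighbours of \<open>v\<close> below \<open>k\<close>
    see state 1 and the others state 2; \<open>h n\<close> and \<open>h 0\<close> are the fields
    that belong to the two states of \<open>v\<close>.\<close>
  define h where "h k = (\<lambda>y t. g y t * (if {v, y} \<in> E then
     (if y < k then if t = 1 then a else c else if t = 1 then c else a) else 1))" for k
  let ?f = "\<lambda>w. edge_map a c (marginal E a c ?V (split_fields E a c g v (w + 1)) w 1 /
        marginal E a c ?V (split_fields E a c g v (w + 1)) w 2)"
  have fin: "finite ?V" using assms(2) by (auto intro: finite_subset)
  have hpos: "0 < h k x t" for k x t using assms by (simp add: h_def)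
  have Zpos: "0 < weight_sum E a c ?V (h k)" for k using assms hpos fin by (intro weight_sum_pos)
  have step: "real (weight_sum E a c ?V (h (Suc w))) =
      weight_sum E a c ?V (h w) * (if w \<in> ?V \<and> {v, w} \<in> E then ?f w else 1)" for w
  proof (cases "w \<in> ?V \<and> {v, w} \<in> E")
    case False
    have "weight_sum E a c ?V (h (Suc w)) = weight_sum E a c ?V (h w)"
      using False by (intro weight_sum_cong) (auto simp: h_def less_Suc_eq)
    then show ?thesis by (simp only: False if_False mult_1_right)
  next
    case True
    define X where "X s = weight_sum E a c (?V - {w}) (fix_fields E a c (split_fields E a c g v (w + 1)) w s)" for s
    \<comment> \<open>Away from \<open>w\<close>, both \<open>h w\<close> and
      \<open>h (Suc w)\<close> coincide with the fields of the child call, because the threshold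
      \<open>w + 1\<close> makes \<open>v\<close> invisible to \<open>w\<close> alone. One pair
      \<open>X 1\<close>, \<open>X 2\<close> therefore serves both partition sums and the child's
      marginals.\<close>
    have X: "weight_sum E a c (?V - {w}) (fix_fields E a c (h k) w s) = X s" if "k = w \<or> k = Suc w" for s k
      unfolding X_def using that by (intro weight_sum_cong) (auto simp: h_def fix_fields_def split_fields_def)
    have Xpos: "0 < X s" for s
      unfolding X_def using assms fin by (intro weight_sum_pos fix_fields_pos split_fields_pos) auto
    have V: "?V \<subseteq> {..<n}" using assms by auto
    have Z: "weight_sum E a c ?V (h k) = h k w 1 * X 1 + h k w 2 * X 2" if "k = w \<or> k = Suc w" for k
      using weight_sum_step[OF assms(1) V, of w a c "h k"] True X[OF that] by (simp add: marginal_def)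
    have m: "marginal E a c ?V (split_fields E a c g v (w + 1)) w s = g w s * X s" for s
      unfolding marginal_def X_def by (simp add: split_fields_def)
    have h: "h w w 1 = g w 1 * c" "h w w 2 = g w 2 * a" "h (Suc w) w 1 = g w 1 * a"
      "h (Suc w) w 2 = g w 2 * c" using True by (simp_all add: h_def)
    define p q where "p = real (g w 1 * X 1)" and "q = real (g w 2 * X 2)"
    have pq: "0 < p" "0 < q" using assms(6) Xpos by (simp_all add: p_def q_def del: One_nat_def)
    \<comment> \<open>Passing from \<open>h w\<close> to \<open>h (Suc w)\<close> merely exchanges
      the two edge weights at \<open>w\<close>.\<close>
    have 1: "real (weight_sum E a c ?V (h w)) = c * p + a * q" "real (weight_sum E a c ?V (h (Suc w))) = a * p + c * q"
      using Z[of w] Z[of "Suc w"] h by (simp_all add: p_def q_def)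
    have "a * (p / q) + c = (a * p + c * q) / q" "c * (p / q) + a = (c * p + a * q) / q"
      using pq by (simp_all add: field_simps)
    then have "?f w = (a * p + c * q) / (c * p + a * q)"
      unfolding m edge_map_def p_def[symmetric] q_def[symmetric] using pq by simp
    moreover have "c * p + a * q > 0" using pq assms by (intro add_pos_pos) auto
    ultimately show ?thesis using 1 True by simp
  qed
  have tele: "real (weight_sum E a c ?V (h k)) = weight_sum E a c ?V (h 0) *
      (\<Prod>w<k. if w \<in> ?V \<and> {v, w} \<in> E then ?f w else 1)" for k
    by (induction k) (simp_all only: step prod.lessThan_Suc lessThan_0 prod.empty mult_1_right mult.assoc)
  have "(\<Prod>w<n. if w \<in> ?V \<and> {v, w} \<in> E then ?f w else 1) = (\<Prod>w\<in>{w\<in>?V. {v, w} \<in> E}. ?f w)"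
  proof -
    have "(\<Prod>w<n. if w \<in> ?V \<and> {v, w} \<in> E then ?f w else 1) =
       (\<Prod>w\<in>{w\<in>{..<n}. w \<in> ?V \<and> {v, w} \<in> E}. ?f w)"
      by (subst prod.inter_filter) auto
    also have "{w\<in>{..<n}. w \<in> ?V \<and> {v, w} \<in> E} = {w\<in>?V. {v, w} \<in> E}" using assms(2) by auto
    finally show ?thesis .
  qed
  with tele[of n] have r: "real (weight_sum E a c ?V (h n)) / weight_sum E a c ?V (h 0) = (\<Prod>w\<in>{w\<in>?V. {v, w} \<in> E}. ?f w)"
    using Zpos[of 0] by simp
  have "weight_sum E a c ?V (fix_fields E a c g v 1) = weight_sum E a c ?V (h n)"
    using assms(2) by (intro weight_sum_cong) (auto simp: h_def fix_fields_def)
  moreover have "weight_sum E a c ?V (fix_fields E a c g v 2) = weight_sum E a c ?V (h 0)"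
    by (intro weight_sum_cong) (auto simp: h_def fix_fields_def)
  ultimately have "marginal E a c U g v 1 = g v 1 * weight_sum E a c ?V (h n)"
    "marginal E a c U g v 2 = g v 2 * weight_sum E a c ?V (h 0)" by (simp_all add: marginal_def)
  then show ?thesis unfolding r[symmetric] by simp
qed

section \<open>Correlation decay and path counts\<close>

lemma edge_map_pos: "0 < a \<Longrightarrow> 0 < c \<Longrightarrow> 0 < R \<Longrightarrow> 0 < edge_map a c R"
  unfolding edge_map_def by (intro divide_pos_pos add_pos_pos mult_pos_pos)

lemma edge_map_divide:
  assumes "0 < p" "0 < q"
  shows "edge_map a c (p / q) = (a * p + c * q) / (c * p + a * q)"
proof -
  have "a * (p / q) + c = (a * p + c * q) / q" "c * (p / q) + a = (c * p + a * q) / q"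
    using assms by (simp_all add: field_simps)
  then show ?thesis unfolding edge_map_def using assms by simp
qed

text \<open>Both sides come down to \<open>a * a \<le> c * c\<close>. This caps the influence of a
  neighbour whose ratio is entirely unknown, as at the cut-off of the recursion.\<close>

lemma edge_map_bounds:
  assumes "0 < a" "a \<le> c" "0 < R"
  shows "a / c \<le> edge_map a c R" "edge_map a c R \<le> c / a"
proof -
  have p: "0 < c * R + a" using assms by (simp add: add_pos_pos)
  have "a * (c * R + a) \<le> c * (a * R + c)"
    using mult_mono[OF assms(2) assms(2)] assms by (simp add: algebra_simps)
  then show "a / c \<le> edge_map a c R" unfolding edge_map_def using p assms by (simp add: divide_simps mult.commute)
  have "a * (a * R + c) \<le> c * (c * R + a)"
    using mult_right_mono[OF mult_mono[OF assms(2) assms(2)], of R] assms by (simp add: algebra_simps)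
  then show "edge_map a c R \<le> c / a" unfolding edge_map_def using p assms by (simp add: divide_simps mult.commute)
qed

lemma ln_edge_map_le:
  assumes "0 < a" "a \<le> c" "0 < R"
  shows "\<bar>ln (edge_map a c R)\<bar> \<le> ln (c / a)"
proof -
  have F: "0 < edge_map a c R" using assms by (intro edge_map_pos) auto
  have "ln (edge_map a c R) \<le> ln (c / a)" using edge_map_bounds[OF assms] F assms by simp
  moreover have "ln (a / c) \<le> ln (edge_map a c R)"
    using edge_map_bounds[OF assms] F assms by (subst ln_le_cancel_iff) auto
  moreover have "ln (a / c) = - ln (c / a)" using assms by (simp add: ln_div)
  ultimately show ?thesis by linarith
qed

text \<open>Mean value theorem for \<open>ln F\<close> as a function of \<open>t = ln R\<close>.
  With \<open>x = exp t\<close> the absolute value of the derivative is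
  \<open>(c^2 - a^2) x / ((a x + c) (c x + a))\<close>, which is largest at
  \<open>x = 1\<close>.\<close>

lemma edge_map_contraction:
  assumes "0 < a" "a \<le> c" "0 < R" "0 < R'"
  shows "\<bar>ln (edge_map a c R) - ln (edge_map a c R')\<bar> \<le> (c - a) / (c + a) * \<bar>ln R - ln R'\<bar>"
proof -
  define f where "f t = ln (a * exp t + c) - ln (c * exp t + a)" for t
  define f' where "f' t = a * exp t / (a * exp t + c) - c * exp t / (c * exp t + a)" for t
  have c: "0 < c" using assms by simp
  have D: "(f has_real_derivative f' t) (at t)" for t
    unfolding f_def f'_def using assms c
    by (auto intro!: derivative_eq_intros simp: add_pos_pos mult.commute)
  have B: "\<bar>f' t\<bar> \<le> (c - a) / (c + a)" for t
  proof -
    define x where "x = exp t"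
    have x: "0 < x" by (simp add: x_def)
    have pos: "0 < a * x + c" "0 < c * x + a" using x assms c by (simp_all add: add_pos_pos)
    have "f' t = - ((c\<^sup>2 - a\<^sup>2) * x / ((a * x + c) * (c * x + a)))"
      unfolding f'_def x_def[symmetric] using pos
      by (simp add: divide_simps) (simp add: algebra_simps power2_eq_square)
    moreover have "0 \<le> (c\<^sup>2 - a\<^sup>2) * x / ((a * x + c) * (c * x + a))"
      using assms x pos by (intro divide_nonneg_pos mult_nonneg_nonneg) (auto simp: power_mono)
    ultimately have e: "\<bar>f' t\<bar> = (c\<^sup>2 - a\<^sup>2) * x / ((a * x + c) * (c * x + a))"
      by (simp only: abs_minus_cancel abs_of_nonneg)
    \<comment> \<open>The square vanishes at \<open>x = 1\<close>, where the rate is exactly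
      \<open>(c - a) / (c + a)\<close>; elsewhere it is smaller.\<close>
    have "(a * x + c) * (c * x + a) - (c + a)\<^sup>2 * x = a * c * (x - 1)\<^sup>2"
      by (simp add: algebra_simps power2_eq_square)
    moreover have "0 \<le> a * c * (x - 1)\<^sup>2" using assms c by simp
    ultimately have "(c + a)\<^sup>2 * x \<le> (a * x + c) * (c * x + a)" by linarith
    moreover have "0 \<le> (c - a) * (c + a)" using assms c by simp
    ultimately have "(c - a) * (c + a) * ((c + a)\<^sup>2 * x) \<le> (c - a) * (c + a) * ((a * x + c) * (c * x + a))"
      by (rule mult_left_mono)
    then have "(c\<^sup>2 - a\<^sup>2) * x * (c + a) * (c + a) \<le> (c - a) * (c + a) * ((a * x + c) * (c * x + a))"
      by (simp add: algebra_simps power2_eq_square)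
    then have "(c\<^sup>2 - a\<^sup>2) * x * (c + a) \<le> (c - a) * ((a * x + c) * (c * x + a))"
      using assms c by (simp add: mult_le_cancel_right mult.commute mult.left_commute)
    then show ?thesis unfolding e using pos assms c by (simp add: divide_simps mult.commute)
  qed
  have main: "\<bar>f u - f v\<bar> \<le> (c - a) / (c + a) * \<bar>u - v\<bar>" if uv: "u < v" for u v
  proof -
    obtain z where z: "f v - f u = (v - u) * f' z"
      using MVT2[where f = f and f' = f', OF uv D] by blast
    then have "\<bar>f u - f v\<bar> = \<bar>f' z\<bar> * \<bar>u - v\<bar>" by (simp add: abs_mult[symmetric] algebra_simps abs_minus_commute)
    then show ?thesis using mult_right_mono[OF B[of z], of "\<bar>u - v\<bar>"] by simp
  qed
  have "\<bar>f u - f v\<bar> \<le> (c - a) / (c + a) * \<bar>u - v\<bar>" for u v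
    using main[of u v] main[of v u] by (cases u v rule: linorder_cases) (auto simp: abs_minus_commute)
  moreover have "ln (edge_map a c R) = f (ln R)" if "0 < R" for R
    unfolding edge_map_def f_def using that assms c by (subst ln_divide_pos) (auto simp: add_pos_pos)
  ultimately show ?thesis using assms by simp
qed

text \<open>The pairs are never reduced to lowest terms, so they grow with every level; only their
  quotients satisfy the recursion of the exact ratios.\<close>

lemma approx_marg_ratio:
  assumes "0 < a" "0 < c" "\<And>x t. 0 < g x t"
  shows "real (approx_marg E a c (Suc d) U g v 1) / real (approx_marg E a c (Suc d) U g v 2) =
    real (g v 1) / real (g v 2) * (\<Prod>w\<in>{w \<in> U - {v}. {v, w} \<in> E}.
      edge_map a c (approx_marg E a c d (U - {v}) (split_fields E a c g v (w + 1)) w 1 /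
        approx_marg E a c d (U - {v}) (split_fields E a c g v (w + 1)) w 2))"
proof -
  have *: "0 < approx_marg E a c d (U - {v}) (split_fields E a c g v (w + 1)) w t" for w t
    using assms by (intro approx_marg_pos split_fields_pos)
  have e: "edge_map a c (approx_marg E a c d (U - {v}) (split_fields E a c g v (w + 1)) w 1 /
        approx_marg E a c d (U - {v}) (split_fields E a c g v (w + 1)) w 2) =
    real (a * approx_marg E a c d (U - {v}) (split_fields E a c g v (w + 1)) w 1 + c * approx_marg E a c d (U - {v}) (split_fields E a c g v (w + 1)) w 2) /
    real (c * approx_marg E a c d (U - {v}) (split_fields E a c g v (w + 1)) w 1 + a * approx_marg E a c d (U - {v}) (split_fields E a c g v (w + 1)) w 2)" for w
    by (subst edge_map_divide) (use * in \<open>simp_all del: One_nat_def\<close>)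
  show ?thesis
    unfolding e prod_dividef approx_marg.simps of_nat_mult of_nat_prod by simp
qed

text \<open>At the cut-off the estimate ignores all neighbours, an error of at most
  \<open>ln (c / a)\<close> for each. Every level above contracts by \<open>\<kappa>\<close> and
  sums over the children, whence the count of walks. The rate \<open>\<kappa>\<close> is a constant
  of its own because \<open>a / c\<close> changes with the precision.\<close>

lemma approx_marg_error:
  fixes \<kappa> :: real
  assumes "simple_graph {..<n} E" "0 < a" "a \<le> c" "(real c - real a) / (real c + real a) \<le> \<kappa>"
    and "U \<subseteq> {..<n}" "v \<in> U" "\<And>x t. 0 < g x t"
  shows "\<bar>ln (real (approx_marg E a c d U g v 1) / real (approx_marg E a c d U g v 2)) -
      ln (real (marginal E a c U g v 1) / real (marginal E a c U g v 2))\<bar>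
    \<le> \<kappa> ^ d * walks E d U v * (n * ln (c / a))"
  using assms(5-7)
proof (induction d arbitrary: U g v)
  case (0 U g v)
  let ?N = "{w \<in> U - {v}. {v, w} \<in> E}"
  let ?R = "\<lambda>w. real (marginal E a c (U - {v}) (split_fields E a c g v (w + 1)) w 1) /
        real (marginal E a c (U - {v}) (split_fields E a c g v (w + 1)) w 2)"
  let ?r = "real (g v 1) / real (g v 2)"
  have fin: "finite U" using 0 by (auto intro: finite_subset)
  have c: "0 < c" using assms by simp
  have R: "0 < ?R w" for w
    using 0 assms(2) c fin by (intro divide_pos_pos) (auto intro!: marginal_pos split_fields_pos)
  have r: "0 < ?r" using 0 by (simp del: One_nat_def)
  have F: "0 < edge_map a c (?R w)" "edge_map a c (?R w) \<noteq> 0" for w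
    using edge_map_pos[of a c "?R w"] R[of w] assms(2) c by auto
  have "ln (real (marginal E a c U g v 1) / real (marginal E a c U g v 2)) =
    ln ?r + (\<Sum>w\<in>?N. ln (edge_map a c (?R w)))"
    unfolding marginal_ratio_recursion[OF assms(1) 0(1,2) assms(2) c 0(3)]
    using r F fin by (subst ln_mult_pos) (auto intro!: prod_pos ln_prod simp del: One_nat_def)
  then have "\<bar>ln ?r - ln (real (marginal E a c U g v 1) / real (marginal E a c U g v 2))\<bar> =
    \<bar>\<Sum>w\<in>?N. ln (edge_map a c (?R w))\<bar>" by simp
  also have "\<dots> \<le> (\<Sum>w\<in>?N. \<bar>ln (edge_map a c (?R w))\<bar>)" by (rule sum_abs)
  also have "\<dots> \<le> (\<Sum>w\<in>?N. ln (c / a))"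
    using assms(2,3) R by (intro sum_mono ln_edge_map_le) auto
  also have "\<dots> = card ?N * ln (c / a)" by simp
  also have "\<dots> \<le> n * ln (c / a)"
    using assms(2,3) card_mono[of "{..<n}" ?N] 0(1) by (intro mult_right_mono) auto
  finally show ?case by simp
next
  case (Suc d U g v)
  let ?N = "{w \<in> U - {v}. {v, w} \<in> E}"
  let ?R = "\<lambda>w. real (marginal E a c (U - {v}) (split_fields E a c g v (w + 1)) w 1) /
        real (marginal E a c (U - {v}) (split_fields E a c g v (w + 1)) w 2)"
  let ?S = "\<lambda>w. real (approx_marg E a c d (U - {v}) (split_fields E a c g v (w + 1)) w 1) /
        real (approx_marg E a c d (U - {v}) (split_fields E a c g v (w + 1)) w 2)"
  let ?r = "real (g v 1) / real (g v 2)"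
  have fin: "finite U" using Suc by (auto intro: finite_subset)
  have c: "0 < c" using assms by simp
  have R: "0 < ?R w" for w
    using Suc.prems assms(2) c fin by (intro divide_pos_pos) (auto intro!: marginal_pos split_fields_pos)
  have S: "0 < ?S w" for w
    using Suc.prems assms(2) c fin by (intro divide_pos_pos) (auto intro!: approx_marg_pos split_fields_pos)
  have r: "0 < ?r" using Suc.prems by (simp del: One_nat_def)
  have F: "0 < edge_map a c (?R w)" "edge_map a c (?R w) \<noteq> 0"
    "0 < edge_map a c (?S w)" "edge_map a c (?S w) \<noteq> 0" for w
    using edge_map_pos[of a c "?R w"] edge_map_pos[of a c "?S w"] R[of w] S[of w] assms(2) c
    by auto
  have "ln (real (marginal E a c U g v 1) / real (marginal E a c U g v 2)) =
    ln ?r + (\<Sum>w\<in>?N. ln (edge_map a c (?R w)))"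
    unfolding marginal_ratio_recursion[OF assms(1) Suc.prems(1,2) assms(2) c Suc.prems(3)]
    using r F fin by (subst ln_mult_pos) (auto intro!: prod_pos ln_prod simp del: One_nat_def)
  moreover have "ln (real (approx_marg E a c (Suc d) U g v 1) / real (approx_marg E a c (Suc d) U g v 2)) =
    ln ?r + (\<Sum>w\<in>?N. ln (edge_map a c (?S w)))"
    unfolding approx_marg_ratio[OF assms(2) c Suc.prems(3)]
    using r F fin by (subst ln_mult_pos) (auto intro!: prod_pos ln_prod simp del: One_nat_def)
  ultimately have "\<bar>ln (real (approx_marg E a c (Suc d) U g v 1) / real (approx_marg E a c (Suc d) U g v 2)) -
      ln (real (marginal E a c U g v 1) / real (marginal E a c U g v 2))\<bar> =
    \<bar>\<Sum>w\<in>?N. ln (edge_map a c (?S w)) - ln (edge_map a c (?R w))\<bar>" by (simp add: sum_subtractf)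
  also have "\<dots> \<le> (\<Sum>w\<in>?N. \<bar>ln (edge_map a c (?S w)) - ln (edge_map a c (?R w))\<bar>)" by (rule sum_abs)
  also have "\<dots> \<le> (\<Sum>w\<in>?N. \<kappa> * (\<kappa> ^ d * walks E d (U - {v}) w * (n * ln (c / a))))"
  proof (rule sum_mono)
    fix w assume w: "w \<in> ?N"
    have k: "0 \<le> (real c - real a) / (real c + real a)" using assms(2,3) by simp
    have "\<bar>ln (edge_map a c (?S w)) - ln (edge_map a c (?R w))\<bar>
      \<le> (real c - real a) / (real c + real a) * \<bar>ln (?S w) - ln (?R w)\<bar>"
      using assms(2,3) R S by (intro edge_map_contraction) auto
    also have "\<dots> \<le> \<kappa> * (\<kappa> ^ d * walks E d (U - {v}) w * (n * ln (c / a)))"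
      using assms(2-4) k order_trans[OF k assms(4)] Suc.prems w c by (intro mult_mono Suc.IH split_fields_pos) auto
    finally show "\<bar>ln (edge_map a c (?S w)) - ln (edge_map a c (?R w))\<bar>
      \<le> \<kappa> * (\<kappa> ^ d * walks E d (U - {v}) w * (n * ln (c / a)))" .
  qed
  also have "\<dots> = \<kappa> ^ Suc d * walks E (Suc d) U v * (n * ln (c / a))"
    by (simp add: sum_distrib_left sum_distrib_right algebra_simps)
  finally show ?case .
qed

lemma walks_le_paths:
  assumes "finite V" "U \<subseteq> V" "v \<in> U"
  shows "walks E d U v \<le> card (paths_from V E v (Suc d))"
proof -
  have fin: "finite (paths_from U E v l)" if "finite U" for U :: "nat set" and v l
    by (rule finite_subset[OF _ finite_lists_length_eq[OF that, of l]])
       (auto simp: paths_from_def is_path_def)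
  \<comment> \<open>The induction counts paths inside the remaining set \<open>U\<close> rather than
    inside \<open>V\<close>: the removal of \<open>v\<close> is what keeps the prolonged sequence
    \<open>v # p\<close> free of repetitions.\<close>
  have "walks E d U v \<le> card (paths_from U E v (Suc d))" if "finite U" "v \<in> U" for U
    using that
  proof (induction d arbitrary: U v)
    case 0
    have "[v] \<in> paths_from U E v (Suc 0)" using 0 by (simp add: paths_from_def is_path_def)
    then have "card {[v]} \<le> card (paths_from U E v (Suc 0))" using fin[OF 0(1)] by (intro card_mono) auto
    then show ?case by simp
  next
    case (Suc d)
    let ?N = "{w \<in> U - {v}. {v, w} \<in> E}"
    let ?S = "SIGMA w:?N. paths_from (U - {v}) E w (Suc d)"
    have "walks E (Suc d) U v \<le> (\<Sum>w\<in>?N. card (paths_from (U - {v}) E w (Suc d)))"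
      using Suc by (auto intro!: sum_mono)
    also have "\<dots> = card ?S" using Suc.prems fin[of "U - {v}"] by (subst card_SigmaI) auto
    also have "\<dots> = card ((\<lambda>(w, p). v # p) ` ?S)"
      by (intro card_image[symmetric]) (auto simp: inj_on_def paths_from_def)
    also have "\<dots> \<le> card (paths_from U E v (Suc (Suc d)))"
    proof (intro card_mono fin Suc.prems subsetI)
      fix q assume "q \<in> (\<lambda>(w, p). v # p) ` ?S"
      then obtain w p where q: "q = v # p" "w \<in> ?N" "p \<in> paths_from (U - {v}) E w (Suc d)" by auto
      then have p: "p \<noteq> []" "set p \<subseteq> U - {v}" "distinct p" "hd p = w" "length p = Suc d"
        "\<And>i. Suc i < length p \<Longrightarrow> {p ! i, p ! Suc i} \<in> E"
        by (auto simp: paths_from_def is_path_def)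
      have "{q ! i, q ! Suc i} \<in> E" if "Suc i < length q" for i
        using that p q by (cases i) (auto simp: hd_conv_nth)
      then show "q \<in> paths_from U E v (Suc (Suc d))"
        using p q Suc.prems by (auto simp: paths_from_def is_path_def)
    qed
    finally show ?case .
  qed
  from this[OF finite_subset[OF assms(2,1)] assms(3)]
  have "walks E d U v \<le> card (paths_from U E v (Suc d))" .
  also have "\<dots> \<le> card (paths_from V E v (Suc d))"
    using assms fin[OF assms(1)] by (intro card_mono) (auto simp: paths_from_def is_path_def)
  finally show ?thesis .
qed

lemma card_neighbours_le:
  assumes "simple_graph {..<n} E" "max_degree_le {..<n} E \<Delta>" "U \<subseteq> {..<n}" "v < n"
  shows "card {w \<in> U - {v}. {v, w} \<in> E} \<le> \<Delta>"
proof -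
  have "card {w \<in> U - {v}. {v, w} \<in> E} = card ((\<lambda>w. {v, w}) ` {w \<in> U - {v}. {v, w} \<in> E})"
    by (intro card_image[symmetric]) (auto simp: inj_on_def doubleton_eq_iff)
  also have "\<dots> \<le> card {e \<in> E. v \<in> e}"
    using simple_graph_finite[OF assms(1)] by (intro card_mono) auto
  also have "\<dots> \<le> \<Delta>" using assms by (auto simp: max_degree_le_def degree_def)
  finally show ?thesis .
qed

lemma walks_le_power:
  assumes "simple_graph {..<n} E" "max_degree_le {..<n} E \<Delta>" "U \<subseteq> {..<n}" "v \<in> U"
  shows "walks E j U v \<le> \<Delta> ^ j"
  using assms(3,4)
proof (induction j arbitrary: U v)
  case (Suc j)
  let ?N = "{w \<in> U - {v}. {v, w} \<in> E}"
  have "(\<Sum>w\<in>?N. walks E j (U - {v}) w) \<le> (\<Sum>w\<in>?N. \<Delta> ^ j)"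
    using Suc.prems by (intro sum_mono Suc.IH) auto
  then have "walks E (Suc j) U v \<le> (\<Sum>w\<in>?N. \<Delta> ^ j)" by simp
  also have "\<dots> = card ?N * \<Delta> ^ j" by simp
  also have "\<dots> \<le> \<Delta> * \<Delta> ^ j"
    using card_neighbours_le[OF assms(1,2), of U v] Suc.prems by (intro mult_right_mono) auto
  finally show ?case by simp
qed simp

text \<open>The growth hypothesis concerns one length only; each further level can only be charged
  the full degree \<open>\<Delta>\<close>.\<close>

lemma walks_add:
  assumes "simple_graph {..<n} E" "max_degree_le {..<n} E \<Delta>" "U \<subseteq> {..<n}" "v \<in> U"
  shows "walks E (d + j) U v \<le> walks E d U v * \<Delta> ^ j"
  using assms(3,4)
proof (induction d arbitrary: U v)
  case 0
  then show ?case using walks_le_power[OF assms(1,2)] by simp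
next
  case (Suc d)
  show ?case using Suc.prems
    by (auto simp: sum_distrib_right intro!: sum_mono Suc.IH)
qed

text \<open>A self-avoiding walk with \<open>d\<close> edges visits \<open>d + 1\<close> vertices.
  At depth \<open>n\<close> the error bound therefore vanishes and the recursion is exact.\<close>

lemma walks_eq_0:
  assumes "finite U" "v \<in> U" "card U \<le> d"
  shows "walks E d U v = 0"
  using assms
proof (induction d arbitrary: U v)
  case (Suc d)
  then have "card (U - {v}) \<le> d" by simp
  then show ?case using Suc.prems by (auto intro!: Suc.IH)
qed auto

section \<open>The idealised sampler\<close>

text \<open>The test \<open>x / c < p / (p + q)\<close> with cleared denominators, meant for
  \<open>x\<close> uniform below \<open>c\<close>.\<close>

definition decide :: "nat \<Rightarrow> nat \<Rightarrow> nat \<Rightarrow> nat \<Rightarrow> nat" where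
  "decide c p q x = (if x * (p + q) < p * c then 1 else 2)"

definition bits_value :: "bool list \<Rightarrow> nat" where
  "bits_value bs = foldl (\<lambda>u b. 2 * u + of_bool b) 0 bs"

text \<open>The sampler as a function of its coin flips, independent of the machine. Vertices
  outside \<open>U\<close> are already fixed and consume no flips.\<close>

fun sample_run :: "nat set set \<Rightarrow> nat \<Rightarrow> nat \<Rightarrow> nat \<Rightarrow> nat \<Rightarrow> nat \<Rightarrow>
    nat list \<Rightarrow> nat set \<Rightarrow> (nat \<Rightarrow> nat \<Rightarrow> nat) \<Rightarrow> bool list \<Rightarrow> (nat \<Rightarrow> nat) \<Rightarrow> (nat \<Rightarrow> nat)" where
  "sample_run E a c n l K [] U g bs out = out"
| "sample_run E a c n l K (x # xs) U g bs out =
    (if x \<in> U then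
       let s = decide c (approx_marg E a c l U g x 1) (approx_marg E a c l U g x 2) (bits_value (take K bs)) in
       sample_run E a c n l K xs (U - {x}) (split_fields E a c g x (if s = 1 then n + 1 else 0)) (drop K bs) (out(x := s))
     else sample_run E a c n l K xs U g bs out)"

lemma bits_value_snoc [simp]: "bits_value (bs @ [b]) = 2 * bits_value bs + of_bool b"
  by (simp add: bits_value_def)

lemma bval_Nil [simp]: "bits_value [] = 0"
  by (simp add: bits_value_def)

lemma bits_value_less: "bits_value bs < 2 ^ length bs"
  by (induction bs rule: rev_induct) auto

lemma bits_value_inj: "length bs = length bs' \<Longrightarrow> bits_value bs = bits_value bs' \<Longrightarrow> bs = bs'"
proof (induction bs arbitrary: bs' rule: rev_induct)
  case (snoc b bs)
  then obtain b' cs where cs: "bs' = cs @ [b']" by (cases bs' rule: rev_cases) auto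
  then have e: "2 * bits_value bs + of_bool b = 2 * bits_value cs + of_bool b'" using snoc by simp
  then have "b = b'" by (cases b; cases b'; simp) presburger+
  then show ?case using e snoc cs by auto
qed auto

lemma finite_bits: "finite {bs :: bool list. length bs = k}"
  and card_bits: "card {bs :: bool list. length bs = k} = 2 ^ k"
  using finite_lists_length_eq[of "UNIV :: bool set" k] card_lists_length_eq[of "UNIV :: bool set" k]
  by simp_all

text \<open>Reading flips as binary digits is a bijection onto the integers below
  \<open>2 ^ k\<close>, so \<open>K\<close> fair coins provide the uniform integer that
  \<open>decide\<close> expects.\<close>

lemma card_bits_value: "card {bs. length bs = k \<and> P (bits_value bs)} = card {x. x < 2 ^ k \<and> P x}"
proof -
  have inj: "inj_on bits_value {bs. length bs = k}" by (auto simp: inj_on_def intro: bits_value_inj)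
  have "bits_value ` {bs. length bs = k} = {..<2 ^ k}"
  proof (rule card_subset_eq)
    show "bits_value ` {bs. length bs = k} \<subseteq> {..<2 ^ k}" using bits_value_less by auto
    show "card (bits_value ` {bs. length bs = k}) = card {..<2 ^ k :: nat}"
      by (simp add: card_image[OF inj] card_bits)
  qed simp
  then have "{x \<in> bits_value ` {bs. length bs = k}. P x} = {x. x < 2 ^ k \<and> P x}" by auto
  moreover have "{x \<in> bits_value ` {bs. length bs = k}. P x} = bits_value ` {bs. length bs = k \<and> P (bits_value bs)}"
    by auto
  ultimately have "bits_value ` {bs. length bs = k \<and> P (bits_value bs)} = {x. x < 2 ^ k \<and> P x}" by simp
  moreover have "inj_on bits_value {bs. length bs = k \<and> P (bits_value bs)}"
    using inj by (rule inj_on_subset) auto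
  ultimately show ?thesis by (metis card_image)
qed

text \<open>State 1 is taken by the natural numbers strictly below the real number \<open>y\<close>,
  and there are exactly \<open>\<lceil>y\<rceil>\<close> of them.\<close>

lemma card_decide:
  assumes "0 < p" "0 < q" "0 < c"
  shows "real (card {x. x < c \<and> decide c p q x = 1}) \<ge> real c * (real p / (real p + real q))"
    and "real (card {x. x < c \<and> decide c p q x = 2}) \<ge> real c * (real q / (real p + real q)) - 1"
proof -
  define y where "y = real c * (real p / (real p + real q))"
  have pq: "0 < real p + real q" using assms by simp
  have y: "0 \<le> y" "y \<le> c" unfolding y_def using assms by (auto simp: divide_simps mult_left_le)
  have iff: "x * (p + q) < p * c \<longleftrightarrow> real x < y" for x
  proof -
    have "x * (p + q) < p * c \<longleftrightarrow> real (x * (p + q)) < real (p * c)" by (rule of_nat_less_iff[symmetric])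
    also have "\<dots> \<longleftrightarrow> real x < y"
      unfolding y_def times_divide_eq_right pos_less_divide_eq[OF pq] by (simp add: mult.commute)
    finally show ?thesis .
  qed
  have "{x. x < c \<and> decide c p q x = 1} = {..<nat \<lceil>y\<rceil>}"
    using y by (auto simp: decide_def iff less_ceiling_iff zless_nat_eq_int_zless split: if_splits)
  then have 1: "card {x. x < c \<and> decide c p q x = 1} = nat \<lceil>y\<rceil>" by simp
  then show "real (card {x. x < c \<and> decide c p q x = 1}) \<ge> real c * (real p / (real p + real q))"
    using y unfolding y_def by (simp add: real_nat_ceiling_ge)
  have "{x. x < c \<and> decide c p q x = 2} = {..<c} - {x. x < c \<and> decide c p q x = 1}"
    by (auto simp: decide_def)
  then have "card {x. x < c \<and> decide c p q x = 2} = card {..<c} - card {x. x < c \<and> decide c p q x = 1}"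
    by (simp only:) (rule card_Diff_subset; auto)
  then have 2: "real (card {x. x < c \<and> decide c p q x = 2}) \<ge> real c - nat \<lceil>y\<rceil>"
    unfolding 1 by simp
  have "real (nat \<lceil>y\<rceil>) \<le> y + 1" using y by (simp add: of_nat_ceiling) 
  moreover have "real c * (real q / (real p + real q)) = c - y" unfolding y_def using pq by (simp add: field_simps)
  ultimately show "real (card {x. x < c \<and> decide c p q x = 2}) \<ge> real c * (real q / (real p + real q)) - 1"
    using 2 by simp
qed

text \<open>After \<open>j\<close> removals the odds of state 1 in any field are at most
  \<open>(c / a) ^ j\<close>. The bound is one-sided because the rounding in \<open>decide\<close>
  can only harm state 2.\<close>

definition field_inv :: "nat \<Rightarrow> nat \<Rightarrow> nat \<Rightarrow> (nat \<Rightarrow> nat \<Rightarrow> nat) \<Rightarrow> bool" where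
  "field_inv a c j g \<longleftrightarrow> (\<forall>x t. 0 < g x t) \<and> (\<forall>x. g x 1 * a ^ j \<le> g x 2 * c ^ j)"

lemma field_inv_split_fields:
  assumes "field_inv a c j g" "0 < a" "a \<le> c"
  shows "field_inv a c (Suc j) (split_fields E a c g v \<theta>)"
proof -
  have *: "g x 1 * a ^ j * (k * a) \<le> g x 2 * c ^ j * (k' * c)"
    if "k * a \<le> k' * c" for x k k'
  proof -
    have "g x 1 * a ^ j \<le> g x 2 * c ^ j" using assms(1) unfolding field_inv_def by blast
    from mult_le_mono[OF this that] show ?thesis .
  qed
  have "split_fields E a c g v \<theta> x 1 * a ^ Suc j \<le> split_fields E a c g v \<theta> x 2 * c ^ Suc j" for x
    using *[of 1 1 x] *[of a c x] *[of c a x] mult_le_mono[OF assms(3) assms(3)] assms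
    by (simp add: split_fields_def ac_simps)
  moreover have "\<forall>x t. 0 < split_fields E a c g v \<theta> x t"
    using assms by (auto intro!: split_fields_pos simp: field_inv_def)
  ultimately show ?thesis by (auto simp: field_inv_def)
qed

text \<open>The \<open>j\<close> removals so far contribute a factor \<open>c / a\<close> each, and
  every neighbour at most one more by \<open>edge_map_bounds\<close>; \<open>n\<close> bounds the
  number of neighbours.\<close>

lemma approx_marg_ratio_le:
  assumes "field_inv a c j g" "0 < a" "a \<le> c" "U \<subseteq> {..<n}"
  shows "real (approx_marg E a c d U g v 1) / real (approx_marg E a c d U g v 2) \<le> (c / a) ^ (j + n)"
proof -
  have g: "0 < g x t" for x t using assms by (auto simp: field_inv_def)
  have "real (g v 1 * a ^ j) \<le> real (g v 2 * c ^ j)"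
    using assms(1) unfolding field_inv_def of_nat_le_iff by blast
  then have r: "real (g v 1) / real (g v 2) \<le> (c / a) ^ j"
    using g[of v 2] assms by (simp add: field_simps power_divide)
  have ca: "1 \<le> real c / real a" using assms by simp
  show ?thesis
  proof (cases d)
    case 0
    have "(real c / real a) ^ j \<le> (c / a) ^ (j + n)" using ca by (intro power_increasing) auto
    then show ?thesis using r 0 by simp
  next
    case (Suc d')
    let ?N = "{w \<in> U - {v}. {v, w} \<in> E}"
    let ?S = "\<lambda>w. real (approx_marg E a c d' (U - {v}) (split_fields E a c g v (w + 1)) w 1) /
        real (approx_marg E a c d' (U - {v}) (split_fields E a c g v (w + 1)) w 2)"
    have c: "0 < c" using assms by simp
    have S: "0 < ?S w" for w
      using g assms(2) c by (intro divide_pos_pos) (auto intro!: approx_marg_pos split_fields_pos)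
    have "(\<Prod>w\<in>?N. edge_map a c (?S w)) \<le> (\<Prod>w\<in>?N. c / a)"
      using S assms(2,3) c edge_map_pos[OF _ _ S] edge_map_bounds(2)[OF _ _ S]
      by (intro prod_mono) (auto intro: less_imp_le)
    also have "\<dots> = (c / a) ^ card ?N" by simp
    also have "\<dots> \<le> (c / a) ^ n"
      using ca card_mono[of "{..<n}" ?N] assms(4) by (intro power_increasing) auto
    finally have "real (g v 1) / real (g v 2) * (\<Prod>w\<in>?N. edge_map a c (?S w)) \<le> (c / a) ^ j * (c / a) ^ n"
      using r ca S edge_map_pos[OF _ _ S] assms(2) c
      by (intro mult_mono prod_nonneg) (auto intro: less_imp_le)
    then show ?thesis unfolding Suc approx_marg_ratio[OF assms(2) c g] by (simp add: power_add)
  qed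
qed

text \<open>Multiplying odds \<open>t\<close> by \<open>exp (- \<delta>) \<le> 1\<close> multiplies
  the probability \<open>t / (1 + t)\<close> by at least the same factor, and
  \<open>1 - \<delta> \<le> exp (- \<delta>)\<close>. Inverting both ratios gives the second
  state.\<close>

lemma fraction_lower:
  fixes p q m1 m2 \<delta> :: real
  assumes "0 < p" "0 < q" "0 < m1" "0 < m2" "\<bar>ln (p / q) - ln (m1 / m2)\<bar> \<le> \<delta>"
  shows "(1 - \<delta>) * (m1 / (m1 + m2)) \<le> p / (p + q)" "(1 - \<delta>) * (m2 / (m1 + m2)) \<le> q / (p + q)"
proof -
  have aux: "(1 - \<delta>) * (u / (u + v)) \<le> x / (x + y)"
    if "0 < x" "0 < y" "0 < u" "0 < v" "ln (u / v) - ln (x / y) \<le> \<delta>" for x y u v :: real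
  proof -
    have d: "1 - \<delta> \<le> exp (- \<delta>)" using exp_ge_add_one_self[of "-\<delta>"] by simp
    have "ln (u / v) - \<delta> \<le> ln (x / y)" using that by simp
    then have "exp (ln (u / v) - \<delta>) \<le> exp (ln (x / y))" by simp
    then have "u / v * exp (- \<delta>) \<le> x / y" using that by (simp add: exp_diff exp_minus divide_inverse)
    then have e: "u * y * exp (- \<delta>) \<le> x * v" using that by (simp add: field_simps)
    show ?thesis
    proof (cases "exp (- \<delta>) \<le> 1")
      case True
      have "exp (- \<delta>) * (u * x) \<le> u * x" using True that by (simp add: mult_left_le_one_le)
      then have "exp (- \<delta>) * (u * (x + y)) \<le> x * (u + v)"
        using e by (simp add: algebra_simps)
      then have "exp (- \<delta>) * u \<le> x / (x + y) * (u + v)"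
        using that by (simp add: pos_le_divide_eq mult.assoc)
      then have "exp (- \<delta>) * (u / (u + v)) \<le> x / (x + y)"
        using that by (simp add: pos_divide_le_eq)
      moreover have "(1 - \<delta>) * (u / (u + v)) \<le> exp (- \<delta>) * (u / (u + v))"
        using d that by (intro mult_right_mono) auto
      ultimately show ?thesis by linarith
    next
      case False
      then have "\<delta> < 0" by simp
      then show ?thesis using that False e d assms(5) by simp
    qed
  qed
  have l: "ln (p / q) = - ln (q / p)" "ln (m1 / m2) = - ln (m2 / m1)"
    using assms by (simp_all add: ln_div)
  show "(1 - \<delta>) * (m1 / (m1 + m2)) \<le> p / (p + q)"
    using assms by (intro aux) auto
  have "(1 - \<delta>) * (m2 / (m2 + m1)) \<le> q / (q + p)"
    using assms l by (intro aux) auto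
  then show "(1 - \<delta>) * (m2 / (m1 + m2)) \<le> q / (p + q)" by (simp add: add.commute)
qed

text \<open>State 1 gets the number of \<open>x < c\<close> rounded up; only for state 2 does the rounding lose up to
  one value, which \<open>\<eta>\<close> pays for because the ratio is at most \<open>(c / a) ^ (2 * n)\<close>.\<close>

lemma step_lower:
  fixes \<kappa> \<delta> \<eta> :: real
  assumes "simple_graph {..<n} E" "0 < a" "a \<le> c" "(real c - real a) / (real c + real a) \<le> \<kappa>"
    and "U \<subseteq> {..<n}" "v \<in> U" "field_inv a c j g" "j \<le> n"
    and \<delta>: "\<kappa> ^ d * walks E d U v * (n * ln (c / a)) \<le> \<delta>"
    and \<eta>: "2 * (c / a) ^ (2 * n) \<le> \<eta> * c" "\<eta> \<le> 1"
    and s: "s \<in> {1, 2}"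
  shows "real (card {x. x < c \<and> decide c (approx_marg E a c d U g v 1) (approx_marg E a c d U g v 2) x = s}) \<ge>
    c * (1 - (\<delta> + \<eta>)) * (marginal E a c U g v s / weight_sum E a c U g)"
proof -
  define p q m1 m2 where pq: "p = approx_marg E a c d U g v 1" "q = approx_marg E a c d U g v 2"
    "m1 = marginal E a c U g v 1" "m2 = marginal E a c U g v 2"
  have g: "0 < g x t" for x t using assms by (auto simp: field_inv_def)
  have c: "0 < c" using assms by simp
  have fin: "finite U" using assms by (auto intro: finite_subset)
  have pos: "0 < p" "0 < q" "0 < m1" "0 < m2"
    unfolding pq using assms(2) c g fin by (auto intro!: approx_marg_pos marginal_pos)
  have \<kappa>: "0 \<le> \<kappa>" 
  proof -
    have "0 \<le> (real c - real a) / (real c + real a)" using assms(3) by simp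
    then show ?thesis using assms(4) by linarith
  qed
  have "\<bar>ln (real p / real q) - ln (real m1 / real m2)\<bar> \<le> \<delta>"
    using approx_marg_error[where g = g and d = d, OF assms(1-6) g] \<delta> unfolding pq by linarith
  note fl = fraction_lower[OF _ _ _ _ this]
  have \<delta>0: "0 \<le> \<delta>" using \<delta> \<kappa> assms(2,3)
    order_trans[OF abs_ge_zero approx_marg_error[where g = g and d = d, OF assms(1-6) g]] by linarith
  have ca: "1 \<le> real c / real a" using assms by simp
  have \<eta>0: "0 \<le> \<eta>"
  proof -
    have "0 < 2 * (real c / real a) ^ (2 * n)" using ca by simp
    then have "0 < \<eta> * c" using \<eta> by linarith
    then show ?thesis using c by (simp add: zero_less_mult_iff)
  qed
  have Z: "real (weight_sum E a c U g) = m1 + m2"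
    using weight_sum_step[OF assms(1,5,6), of a c g] by (simp add: pq)
  have Zpos: "0 < real m1 + real m2" using pos by simp
  have f1: "(1 - \<delta>) * (m1 / (m1 + m2)) \<le> p / (p + q)"
    and f2: "(1 - \<delta>) * (m2 / (m1 + m2)) \<le> q / (p + q)" using fl pos by auto
  show ?thesis
  proof (cases "s = 1")
    case True
    have "c * (1 - (\<delta> + \<eta>)) * (m1 / (m1 + m2)) \<le> c * ((1 - \<delta>) * (m1 / (m1 + m2)))"
      unfolding mult.assoc using \<eta>0 c pos by (intro mult_left_mono mult_right_mono) auto
    also have "\<dots> \<le> c * (p / (p + q))" using f1 by (intro mult_left_mono) auto
    also have "\<dots> \<le> card {x. x < c \<and> decide c p q x = 1}" using card_decide(1)[of p q c] pos c by simp
    finally show ?thesis unfolding Z True pq .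
  next
    case False
    then have s2: "s = 2" using s by auto
    have "real p / real q \<le> (c / a) ^ (j + n)"
      unfolding pq by (rule approx_marg_ratio_le[OF assms(7,2,3,5)])
    also have "\<dots> \<le> (c / a) ^ (2 * n)" using ca assms(8) by (intro power_increasing) auto
    finally have r: "real p / real q \<le> (c / a) ^ (2 * n)" .
    have "1 \<le> (real c / real a) ^ (2 * n)" using ca by simp
    then have "1 + real p / real q \<le> 2 * (c / a) ^ (2 * n)" using r by simp
    also have "\<dots> \<le> \<eta> * c" by (rule \<eta>)
    finally have "(p + q) / q \<le> \<eta> * c" using pos by (simp add: add_divide_distrib)
    then have "real p + real q \<le> \<eta> * c * q" using pos by (simp add: pos_divide_le_eq)
    \<comment> \<open>The ideal count of state 2 is at least \<open>1 / \<eta>\<close>, so the loss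
      of one value is a relative loss of at most \<open>\<eta>\<close>.\<close>
    then have h: "1 \<le> \<eta> * (c * (q / (p + q)))" using pos by (simp add: pos_le_divide_eq mult.assoc)
    have "c * (1 - (\<delta> + \<eta>)) * (m2 / (m1 + m2)) \<le> c * ((1 - \<eta>) * ((1 - \<delta>) * (m2 / (m1 + m2))))"
    proof -
      have "0 \<le> \<eta> * \<delta>" using \<eta>0 \<delta>0 by simp
      then have "1 - (\<delta> + \<eta>) \<le> (1 - \<eta>) * (1 - \<delta>)" by (simp add: left_diff_distrib right_diff_distrib)
      then have "(1 - (\<delta> + \<eta>)) * (m2 / (m1 + m2)) \<le> (1 - \<eta>) * (1 - \<delta>) * (m2 / (m1 + m2))"
        by (intro mult_right_mono) auto
      then show ?thesis unfolding mult.assoc by (intro mult_left_mono) auto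
    qed
    also have "\<dots> \<le> c * ((1 - \<eta>) * (q / (p + q)))"
      using f2 \<eta>(2) by (intro mult_left_mono) auto
    also have "\<dots> = c * (q / (p + q)) - \<eta> * (c * (q / (p + q)))"
      by (simp only: left_diff_distrib right_diff_distrib mult_1 mult.left_commute)
    also have "\<dots> \<le> c * (q / (p + q)) - 1" using h by simp
    also have "\<dots> \<le> card {x. x < c \<and> decide c p q x = 2}" using card_decide(2)[of p q c] pos c by simp
    finally show ?thesis unfolding Z s2 pq .
  qed
qed

text \<open>Chain rule along the list: \<open>marginal / weight_sum\<close> is the conditional
  probability of the state at \<open>x\<close>, and the partition sum inside its numerator cancels
  against the denominator of the next step, while each step costs a factor
  \<open>1 - \<epsilon>\<close>. Surplus flips in \<open>T\<close> multiply both sides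
  alike.\<close>

lemma sample_run_lower:
  fixes \<epsilon> :: real
  assumes gr: "simple_graph {..<n} E" and ac: "0 < a" "a \<le> c" and cK: "c = 2 ^ K"
    and step: "\<And>U v g s j. U \<subseteq> {..<n} \<Longrightarrow> v \<in> U \<Longrightarrow> field_inv a c j g \<Longrightarrow> j \<le> n \<Longrightarrow> s \<in> {1, 2} \<Longrightarrow>
      real (card {x. x < c \<and> decide c (approx_marg E a c l U g v 1) (approx_marg E a c l U g v 2) x = s}) \<ge>
      c * (1 - \<epsilon>) * (marginal E a c U g v s / weight_sum E a c U g)"
    and \<epsilon>: "\<epsilon> \<le> 1"
    and "U \<subseteq> set xs" "U \<subseteq> {..<n}" "field_inv a c j g" "j + card U \<le> n"
    and "\<And>x. x \<in> U \<Longrightarrow> \<tau> x \<in> {1, 2}" "\<And>x. x \<notin> U \<Longrightarrow> out x = \<tau> x" "K * card U \<le> T"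
  shows "real (card {bs. length bs = T \<and> sample_run E a c n l K xs U g bs out = \<tau>}) \<ge>
    2 ^ T * (1 - \<epsilon>) ^ card U * (weight E a c U g \<tau> / weight_sum E a c U g)"
  using assms(7-)
proof (induction xs arbitrary: U g out j T)
  case Nil
  then have U: "U = {}" by simp
  \<comment> \<open>An empty edge would lie inside the empty vertex set and contribute a
    factor.\<close>
  have "{} \<notin> E" using gr by (auto simp: simple_graph_def)
  then have "{e \<in> E. e \<subseteq> {}} = {}" by auto
  then have w: "weight E a c {} g \<sigma> = 1" for \<sigma> by (simp add: weight_def)
  have "out = \<tau>" using Nil.prems(6) unfolding U by blast
  then show ?case using U card_bits[of T] by (simp add: w weight_sum_def configs_def)
next
  case (Cons x xs)
  show ?case
  proof (cases "x \<in> U")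
    case False
    then have "U \<subseteq> set xs" using Cons.prems(1) by auto
    from Cons.IH[OF this Cons.prems(2-7)] False show ?thesis by simp
  next
    case True
    let ?U = "U - {x}" and ?s = "\<tau> x"
    let ?g = "split_fields E a c g x (if ?s = 1 then n + 1 else 0)"
    let ?d = "decide c (approx_marg E a c l U g x 1) (approx_marg E a c l U g x 2)"
    let ?A = "{bs. length bs = K \<and> ?d (bits_value bs) = ?s}"
    let ?B = "{bs. length bs = T - K \<and> sample_run E a c n l K xs ?U ?g bs (out(x := ?s)) = \<tau>}"
    have fin: "finite U" using Cons.prems(2) by (auto intro: finite_subset)
    have card: "card U = Suc (card ?U)" by (rule card.remove[OF fin True])
    have c: "0 < c" using ac by simp
    have g: "0 < g y t" for y t using Cons.prems(3) by (auto simp: field_inv_def)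
    have sx: "?s \<in> {1, 2}" by (rule Cons.prems(5)[OF True])
    have TK: "K \<le> T" using Cons.prems(7) card by simp
    \<comment> \<open>With the threshold \<open>n + 1\<close> or 0 all remaining vertices lie on the
      same side of it, so splitting becomes fixing.\<close>
    have eq: "?g y t = fix_fields E a c g x ?s y t" if "y \<in> ?U" "t \<in> {1, 2}" for y t
      using that sx Cons.prems(2) by (auto simp: split_fields_def fix_fields_def)
    have IH: "real (card ?B) \<ge> 2 ^ (T - K) * (1 - \<epsilon>) ^ card ?U * (weight E a c ?U ?g \<tau> / weight_sum E a c ?U ?g)"
    proof (rule Cons.IH)
      show "field_inv a c (Suc j) ?g" by (rule field_inv_split_fields[OF Cons.prems(3) ac])
      show "?U \<subseteq> set xs" "?U \<subseteq> {..<n}" using Cons.prems(1,2) by auto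
      show "Suc j + card ?U \<le> n" "K * card ?U \<le> T - K" using Cons.prems(4,7) card by auto
      show "\<tau> y \<in> {1, 2}" if "y \<in> ?U" for y using Cons.prems(5) that by blast
      show "(out(x := ?s)) y = \<tau> y" if "y \<notin> ?U" for y using Cons.prems(6)[of y] that by (cases "y = x") auto
    qed
    have "?A \<subseteq> {bs. length bs = K}" "?B \<subseteq> {bs. length bs = T - K}" by auto
    then have finAB: "finite ?A" "finite ?B" using finite_bits finite_subset by blast+
    \<comment> \<open>The first \<open>K\<close> flips and the later ones are independent:
      concatenation embeds the product of the two sets into the set to be counted.\<close>
    have "inj_on (\<lambda>(u, v). u @ v) (?A \<times> ?B)" by (auto simp: inj_on_def)
    then have ci: "card ((\<lambda>(u, v). u @ v) ` (?A \<times> ?B)) = card ?A * card ?B"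
      by (simp only: card_image card_cartesian_product)
    have cm: "card ((\<lambda>(u, v). u @ v) ` (?A \<times> ?B)) \<le> card {bs. length bs = T \<and> sample_run E a c n l K (x # xs) U g bs out = \<tau>}"
    proof (rule card_mono)
      show "finite {bs. length bs = T \<and> sample_run E a c n l K (x # xs) U g bs out = \<tau>}"
        by (rule finite_subset[OF _ finite_bits[of T]]) auto
      show "(\<lambda>(u, v). u @ v) ` (?A \<times> ?B) \<subseteq> {bs. length bs = T \<and> sample_run E a c n l K (x # xs) U g bs out = \<tau>}"
      proof (rule image_subsetI)
        fix z assume "z \<in> ?A \<times> ?B"
        then obtain u v where z: "z = (u, v)" and u: "length u = K" "?d (bits_value u) = ?s"
          and v: "length v = T - K" "sample_run E a c n l K xs ?U ?g v (out(x := ?s)) = \<tau>" by auto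
        have "sample_run E a c n l K (x # xs) U g (u @ v) out = sample_run E a c n l K xs ?U ?g v (out(x := ?s))"
          unfolding sample_run.simps using True u by (simp add: Let_def del: One_nat_def fun_upd_apply)
        then show "(case z of (u, v) \<Rightarrow> u @ v) \<in> {bs. length bs = T \<and> sample_run E a c n l K (x # xs) U g bs out = \<tau>}"
          using u(1) v TK by (simp add: z del: sample_run.simps fun_upd_apply)
      qed
    qed
    have le: "real (card ?A) * real (card ?B) \<le>
      real (card {bs. length bs = T \<and> sample_run E a c n l K (x # xs) U g bs out = \<tau>})"
      using cm unfolding ci by (simp only: of_nat_mult[symmetric] of_nat_le_iff)
    have A: "c * (1 - \<epsilon>) * (marginal E a c U g x ?s / weight_sum E a c U g) \<le> card ?A"
      unfolding card_bits_value[of K "\<lambda>y. ?d y = ?s"] unfolding cK[symmetric]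
      using Cons.prems(4) by (intro step[OF Cons.prems(2) True Cons.prems(3) _ sx]) simp
    have wz: "weight E a c ?U ?g \<tau> = weight E a c ?U (fix_fields E a c g x ?s) \<tau>"
      "weight_sum E a c ?U ?g = weight_sum E a c ?U (fix_fields E a c g x ?s)"
      by (rule weight_cong[OF eq]; use Cons.prems(5) in blast) (rule weight_sum_cong[OF eq])
    have Zp: "0 < weight_sum E a c ?U (fix_fields E a c g x ?s)"
      using ac c g fin by (intro weight_sum_pos fix_fields_pos) auto
    have wU: "weight E a c U g \<tau> = g x ?s * weight E a c ?U (fix_fields E a c g x ?s) \<tau>"
      by (rule weight_step[OF gr Cons.prems(2) True refl])
    have "2 ^ T * (1 - \<epsilon>) ^ card U * (weight E a c U g \<tau> / weight_sum E a c U g) =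
      (c * (1 - \<epsilon>) * (marginal E a c U g x ?s / weight_sum E a c U g)) *
      (2 ^ (T - K) * (1 - \<epsilon>) ^ card ?U * (weight E a c ?U ?g \<tau> / weight_sum E a c ?U ?g))"
    proof -
      have 1: "real c * 2 ^ (T - K) = 2 ^ T" using TK unfolding cK by (simp flip: power_add)
      have aux: "S * (e * P) * (x * w / Z) = C * e * (x * z / Z) * (R * P * (w / z))"
        if "C * R = S" "z \<noteq> 0" for C R S z e P x w Z :: real
        using that(2) by (simp add: that(1)[symmetric])
      show ?thesis unfolding wz wU marginal_def card power_Suc of_nat_mult
        by (rule aux[OF 1]) (use Zp in simp)
    qed
    moreover have "\<dots> \<le> real (card ?A) * real (card ?B)"
      using A IH \<epsilon> by (intro mult_mono) auto
    ultimately show ?thesis using le by linarith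
  qed
qed

lemma sample_run_range:
  assumes "U \<subseteq> set xs"
  shows "(x \<in> U \<longrightarrow> sample_run E a c n l K xs U g bs out x \<in> {1, 2}) \<and>
    (x \<notin> U \<longrightarrow> sample_run E a c n l K xs U g bs out x = out x)"
  using assms
proof (induction xs arbitrary: U g bs out)
  case (Cons y xs)
  show ?case
  proof (cases "y \<in> U")
    case True
    define s where "s = decide c (approx_marg E a c l U g y 1) (approx_marg E a c l U g y 2) (bits_value (take K bs))"
    define g' where "g' = split_fields E a c g y (if s = 1 then n + 1 else 0)"
    have s: "s \<in> {1, 2}" by (simp add: decide_def s_def)
    have U: "U - {y} \<subseteq> set xs" using Cons.prems by auto
    have e: "sample_run E a c n l K (y # xs) U g bs out = sample_run E a c n l K xs (U - {y}) g' (drop K bs) (out(y := s))"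
      using True by (simp add: Let_def s_def g'_def)
    define out' where "out' = out(y := s)"
    have o: "out' y = s" "x \<noteq> y \<Longrightarrow> out' x = out x" by (simp_all add: out'_def)
    show ?thesis unfolding e out'_def[symmetric]
      using Cons.IH[OF U, of g' "drop K bs" out'] True s o by (cases "x = y") auto
  next
    case False
    then have "U \<subseteq> set xs" using Cons.prems by auto
    from Cons.IH[OF this, of g bs out] False show ?thesis by simp
  qed
qed auto

section \<open>Total variation and the target distributions\<close>

text \<open>Pointwise domination bounds the excess of \<open>\<pi>\<close> over \<open>\<nu>\<close>
  on every event; the excess of \<open>\<nu>\<close> over \<open>\<pi>\<close> on \<open>A\<close>
  is that of \<open>\<pi>\<close> over \<open>\<nu>\<close> on the complement.\<close>

lemma tv_dist_le:
  fixes \<delta> :: real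
  assumes "\<And>x. (1 - \<delta>) * pmf \<pi> x \<le> pmf \<nu> x" "0 \<le> \<delta>"
  shows "tv_dist \<nu> \<pi> \<le> \<delta>"
proof -
  have *: "measure_pmf.prob \<pi> A - measure_pmf.prob \<nu> A \<le> \<delta>" for A
  proof -
    have "(1 - \<delta>) * measure_pmf.prob \<pi> A = infsetsum (\<lambda>x. (1 - \<delta>) * pmf \<pi> x) A"
      by (simp add: measure_pmf_conv_infsetsum infsetsum_cmult_right pmf_abs_summable)
    also have "\<dots> \<le> infsetsum (pmf \<nu>) A"
      by (intro infsetsum_mono abs_summable_on_cmult_right pmf_abs_summable assms(1))
    also have "\<dots> = measure_pmf.prob \<nu> A" by (simp add: measure_pmf_conv_infsetsum)
    finally have "measure_pmf.prob \<pi> A - measure_pmf.prob \<nu> A \<le> \<delta> * measure_pmf.prob \<pi> A"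
      by (simp add: algebra_simps)
    also have "\<dots> \<le> \<delta>" using assms(2) by (simp add: mult_left_le)
    finally show ?thesis .
  qed
  have "\<bar>measure_pmf.prob \<nu> A - measure_pmf.prob \<pi> A\<bar> \<le> \<delta>" for A
    using *[of A] *[of "- A"] measure_pmf.prob_compl[of A \<nu>] measure_pmf.prob_compl[of A \<pi>]
    by (simp add: Compl_eq_Diff_UNIV)
  then show ?thesis unfolding tv_dist_def by (intro cSUP_least) auto
qed

section \<open>Rounding the parameter and identifying the two targets\<close>

definition gibbs :: "nat set set \<Rightarrow> (nat \<Rightarrow> nat) set \<Rightarrow> real \<Rightarrow> (nat \<Rightarrow> nat) \<Rightarrow> real" where
  "gibbs E C B \<tau> = B ^ mono_edges E \<tau> / (\<Sum>\<sigma>\<in>C. B ^ mono_edges E \<sigma>)"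

lemma mono_edges_le: "finite E \<Longrightarrow> mono_edges E \<sigma> \<le> card E"
  unfolding mono_edges_def by (intro card_mono) auto

lemma card_edges_le:
  assumes "simple_graph {..<n} E"
  shows "card E \<le> n * n"
proof -
  have "E \<subseteq> (\<lambda>(x, y). {x, y}) ` ({..<n} \<times> {..<n})"
  proof
    fix e assume "e \<in> E"
    then have e: "e \<subseteq> {..<n}" "card e = 2" using simple_graph_subset[OF assms] by auto
    then obtain x y where "e = {x, y}" by (auto simp: card_2_iff)
    then show "e \<in> (\<lambda>(x, y). {x, y}) ` ({..<n} \<times> {..<n})" using e by auto
  qed
  then have "card E \<le> card ((\<lambda>(x, y). {x, y}) ` ({..<n} \<times> {..<n}))" by (intro card_mono) auto
  also have "\<dots> \<le> card ({..<n} \<times> {..<n})" by (intro card_image_le) auto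
  finally show ?thesis by simp
qed

text \<open>Raising the parameter does not decrease the numerator, and it raises each term of the
  normalising sum by at most \<open>(B' / B) ^ card E\<close>. Bernoulli's inequality makes the
  resulting loss linear in \<open>B' - B\<close>.\<close>

lemma gibbs_perturb:
  assumes "finite C" "\<tau> \<in> C" "finite E" "0 < B" "B \<le> B'"
  shows "(1 - card E * ((B' - B) / B)) * gibbs E C B \<tau> \<le> gibbs E C B' \<tau>"
proof -
  let ?m = "mono_edges E" and ?k = "card E"
  have B': "0 < B'" using assms by simp
  define S S' where "S = (\<Sum>\<sigma>\<in>C. B ^ ?m \<sigma>)" and "S' = (\<Sum>\<sigma>\<in>C. B' ^ ?m \<sigma>)"
  have S: "0 < S" "0 < S'" unfolding S_def S'_def using assms B' by (auto intro!: sum_pos)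
  have "S' \<le> (\<Sum>\<sigma>\<in>C. (B' / B) ^ ?k * B ^ ?m \<sigma>)" unfolding S'_def
  proof (rule sum_mono)
    fix \<sigma>
    have "B' ^ ?m \<sigma> = (B' / B) ^ ?m \<sigma> * B ^ ?m \<sigma>" using assms by (simp add: power_divide)
    also have "\<dots> \<le> (B' / B) ^ ?k * B ^ ?m \<sigma>"
      using assms mono_edges_le[OF assms(3)] by (intro mult_right_mono power_increasing) auto
    finally show "B' ^ ?m \<sigma> \<le> (B' / B) ^ ?k * B ^ ?m \<sigma>" .
  qed
  then have S': "S' \<le> (B' / B) ^ ?k * S" by (simp add: S_def sum_distrib_left)
  have "1 - ?k * ((B' - B) / B) \<le> 1 + ?k * (B / B' - 1)"
  proof -
    have "(B' - B) / B' \<le> (B' - B) / B" using assms by (intro divide_left_mono) auto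
    then have "1 - B / B' \<le> (B' - B) / B" using B' by (simp add: diff_divide_distrib)
    then have "?k * (1 - B / B') \<le> ?k * ((B' - B) / B)" by (intro mult_left_mono) auto
    then show ?thesis by (simp add: right_diff_distrib)
  qed
  also have "\<dots> \<le> (1 + (B / B' - 1)) ^ ?k"
  proof (rule Bernoulli_inequality)
    have "0 \<le> B / B'" using assms B' by simp
    then show "- 1 \<le> B / B' - 1" by linarith
  qed
  finally have r: "1 - ?k * ((B' - B) / B) \<le> (B / B') ^ ?k" by simp
  have g0: "0 \<le> gibbs E C B \<tau>" using assms S unfolding gibbs_def S_def[symmetric] by simp
  have "(1 - ?k * ((B' - B) / B)) * gibbs E C B \<tau> \<le> (B / B') ^ ?k * gibbs E C B \<tau>"
    using r g0 by (rule mult_right_mono)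
  also have "\<dots> = B ^ ?m \<tau> / ((B' / B) ^ ?k * S)"
    unfolding gibbs_def S_def[symmetric] using assms B' S by (simp add: power_divide)
  also have "\<dots> \<le> B ^ ?m \<tau> / S'" using S' S assms B' by (intro divide_left_mono) auto
  also have "\<dots> \<le> B' ^ ?m \<tau> / S'" using S assms by (intro divide_right_mono power_mono) auto
  finally show ?thesis unfolding gibbs_def[of E C B'] S'_def .
qed

text \<open>Clearing denominators multiplies all weights by the same \<open>c ^ card E\<close>,
  which disappears on normalisation.\<close>

lemma weight_full:
  assumes "simple_graph {..<n} E" "0 < c"
  shows "real (weight E a c {..<n} (\<lambda>_ _. 1) \<tau>) = real c ^ card E * (real a / real c) ^ mono_edges E \<tau>"
proof -
  have fin: "finite E" using simple_graph_finite[OF assms(1)] .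
  have E: "{e \<in> E. e \<subseteq> {..<n}} = E" using simple_graph_subset[OF assms(1)] by auto
  define P where "P e \<longleftrightarrow> (\<forall>x\<in>e. \<forall>y\<in>e. \<tau> x = \<tau> y)" for e
  have "real (weight E a c {..<n} (\<lambda>_ _. 1) \<tau>) = real (\<Prod>e\<in>E. if P e then a else c)"
    unfolding weight_def E P_def by (simp only: prod.neutral_const mult_1)
  also have "\<dots> = (\<Prod>e\<in>E. real (if P e then a else c))" by (rule of_nat_prod)
  also have "\<dots> = (\<Prod>e\<in>E. real c * (if P e then real a / real c else 1))"
    using assms(2) by (intro prod.cong) auto
  also have "\<dots> = real c ^ card E * (\<Prod>e\<in>{e\<in>E. P e}. real a / real c)"
    using fin by (subst prod.inter_filter) (simp_all add: prod.distrib)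
  finally show ?thesis by (simp add: mono_edges_def P_def)
qed

lemma weight_ratio_all:
  assumes "simple_graph {..<n} E" "0 < c"
  shows "real (weight E a c {..<n} (\<lambda>_ _. 1) \<tau>) / real (weight_sum E a c {..<n} (\<lambda>_ _. 1)) =
    gibbs E (configs {..<n}) (a / c) \<tau>"
proof -
  have "real (weight_sum E a c {..<n} (\<lambda>_ _. 1)) = real c ^ card E * (\<Sum>\<sigma>\<in>configs {..<n}. (real a / real c) ^ mono_edges E \<sigma>)"
    unfolding weight_sum_def of_nat_sum weight_full[OF assms] by (simp add: sum_distrib_left)
  then show ?thesis unfolding weight_full[OF assms] gibbs_def using assms(2) by simp
qed

definition pinned :: "nat \<Rightarrow> nat \<Rightarrow> nat \<Rightarrow> (nat \<Rightarrow> nat) set" where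
  "pinned n u v = {\<tau> \<in> configs {..<n}. \<tau> u = 1 \<and> \<tau> v = 2}"

lemma weight_ratio_pinned:
  assumes gr: "simple_graph {..<n} E" and ac: "0 < a" "0 < c" and uv: "u < n" "v < n" "u \<noteq> v"
    and \<tau>: "\<tau> \<in> pinned n u v"
  defines "g \<equiv> split_fields E a c (split_fields E a c (\<lambda>_ _. 1) u (n + 1)) v 0"
  shows "real (weight E a c ({..<n} - {u} - {v}) g \<tau>) / real (weight_sum E a c ({..<n} - {u} - {v}) g) =
    gibbs E (pinned n u v) (a / c) \<tau>"
proof -
  let ?V = "{..<n}" and ?U = "{..<n} - {u} - {v}"
  let ?h = "fix_fields E a c (fix_fields E a c (\<lambda>_ _. 1) u 1) v 2"
  \<comment> \<open>The weight of a possible edge between \<open>u\<close> and \<open>v\<close>,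
    whose end states 1 and 2 differ: \<open>c\<close> if the edge exists and 1 otherwise. It is
    common to all pinned configurations and cancels.\<close>
  define k where "k = fix_fields E a c (\<lambda>_ _. 1) u 1 v 2"
  have k0: "0 < k" using ac by (simp add: k_def fix_fields_def)
  have gh: "g x t = ?h x t" if "x \<in> ?U" "t \<in> {1, 2}" for x t
    using that by (auto simp: g_def split_fields_def fix_fields_def)
  have w: "weight E a c ?V (\<lambda>_ _. 1) \<sigma> = k * weight E a c ?U g \<sigma>" if "\<sigma> \<in> pinned n u v" for \<sigma>
  proof -
    have \<sigma>: "\<sigma> u = 1" "\<sigma> v = 2" "\<sigma> \<in> configs ?V" using that by (auto simp: pinned_def)
    have "weight E a c ?V (\<lambda>_ _. 1) \<sigma> = weight E a c (?V - {u}) (fix_fields E a c (\<lambda>_ _. 1) u 1) \<sigma>"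
      using weight_step[where U = ?V and v = u and s = 1 and \<sigma> = \<sigma> and a = a and c = c and
          g = "\<lambda>_ _. 1", OF gr] uv \<sigma>(1) by simp
    also have "\<dots> = k * weight E a c ?U ?h \<sigma>"
      unfolding k_def
      by (rule weight_step[where V = ?V and U = "?V - {u}" and v = v and s = 2, OF gr]) (use uv \<sigma>(2) in auto)
    also have "weight E a c ?U ?h \<sigma> = weight E a c ?U g \<sigma>"
    proof (rule weight_cong)
      fix x assume "x \<in> ?U"
      then show "\<sigma> x \<in> {1, 2}" using configs_mem[OF \<sigma>(3), of x] by simp
    qed (simp_all only: gh)
    finally show ?thesis .
  qed
  have "(\<Sum>\<sigma>\<in>configs ?U. weight E a c ?U g \<sigma>) = (\<Sum>\<tau>\<in>pinned n u v. weight E a c ?U g \<tau>)"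
  proof (rule sum.reindex_bij_witness[of _ "\<lambda>\<tau>. restrict \<tau> ?U" "\<lambda>\<sigma>. \<sigma>(u := 1, v := 2)"])
    fix \<sigma> assume \<sigma>: "\<sigma> \<in> configs ?U"
    then show "restrict (\<sigma>(u := 1, v := 2)) ?U = \<sigma>"
      by (auto simp: configs_def PiE_def extensional_def restrict_def fun_eq_iff)
    show "\<sigma>(u := 1, v := 2) \<in> pinned n u v"
      using \<sigma> uv by (auto simp: pinned_def configs_def PiE_def extensional_def Pi_def)
    show "weight E a c ?U g (\<sigma>(u := 1, v := 2)) = weight E a c ?U g \<sigma>"
    proof (rule weight_cong)
      fix x assume "x \<in> ?U"
      then show "\<sigma> x \<in> {1, 2}" by (rule configs_mem[OF \<sigma>])
    qed auto
  next
    fix \<tau> assume \<tau>: "\<tau> \<in> pinned n u v"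
    then show "(restrict \<tau> ?U)(u := 1, v := 2) = \<tau>"
      by (auto simp: pinned_def configs_def PiE_def extensional_def restrict_def fun_eq_iff)
    show "restrict \<tau> ?U \<in> configs ?U"
      using \<tau> by (auto simp: pinned_def configs_def PiE_def Pi_def)
  qed
  then have Z: "real (weight_sum E a c ?U g) = (\<Sum>\<tau>\<in>pinned n u v. real (weight E a c ?U g \<tau>))"
    by (simp add: weight_sum_def flip: of_nat_sum)
  define q where "q = real c ^ card E"
  have q: "0 < q" using ac by (simp add: q_def)
  have r: "real (weight E a c ?U g \<sigma>) = q / k * (real a / real c) ^ mono_edges E \<sigma>"
    if "\<sigma> \<in> pinned n u v" for \<sigma>
  proof -
    have "real k * real (weight E a c ?U g \<sigma>) = q * (real a / real c) ^ mono_edges E \<sigma>"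
      using weight_full[OF gr ac(2), of a \<sigma>] w[OF that] by (simp add: q_def)
    then have "real (weight E a c ?U g \<sigma>) = q * (real a / real c) ^ mono_edges E \<sigma> / k"
      using k0 by (simp add: eq_divide_eq mult.commute)
    then show ?thesis by simp
  qed
  have "real (weight_sum E a c ?U g) = q / k * (\<Sum>\<sigma>\<in>pinned n u v. (real a / real c) ^ mono_edges E \<sigma>)"
    unfolding Z using r by (simp add: sum_distrib_left)
  then show ?thesis unfolding r[OF \<tau>] gibbs_def using q k0 by simp
qed

lemma pmf_ising_gibbs:
  assumes "0 < B" "\<tau> \<in> configs {..<n}"
  shows "pmf (ising {..<n} E B) \<tau> = gibbs E (configs {..<n}) B \<tau>"
  using pmf_ising[of "{..<n}" B E \<tau>] assms by (simp add: gibbs_def partition_fn_def)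

lemma pmf_ising_cond:
  assumes "0 < B" "u < n" "v < n" "u \<noteq> v"
  shows "pmf (ising_cond {..<n} E B u v) \<tau> = (if \<tau> \<in> pinned n u v then gibbs E (pinned n u v) B \<tau> else 0)"
proof -
  let ?V = "{..<n}" and ?A = "{\<sigma>. \<sigma> u = 1 \<and> \<sigma> v = 2}"
  have fin: "finite (configs ?V)" by (rule finite_configs) simp
  have ne: "set_pmf (ising ?V E B) \<inter> ?A \<noteq> {}"
    using assms by (intro ising_cond_nonempty) auto
  have "measure_pmf.prob (ising ?V E B) ?A = measure_pmf.prob (ising ?V E B) (?A \<inter> set_pmf (ising ?V E B))"
    by (simp add: measure_Int_set_pmf)
  also have "?A \<inter> set_pmf (ising ?V E B) = pinned n u v"
    using assms by (auto simp: set_pmf_ising pinned_def)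
  also have "measure_pmf.prob (ising ?V E B) (pinned n u v) = (\<Sum>\<tau>\<in>pinned n u v. pmf (ising ?V E B) \<tau>)"
    using fin by (intro measure_measure_pmf_finite) (auto simp: pinned_def)
  also have "\<dots> = (\<Sum>\<sigma>\<in>pinned n u v. B ^ mono_edges E \<sigma>) / partition_fn ?V E B"
    using assms by (simp add: pmf_ising pinned_def sum_divide_distrib)
  finally have m: "measure_pmf.prob (ising ?V E B) ?A =
    (\<Sum>\<sigma>\<in>pinned n u v. B ^ mono_edges E \<sigma>) / partition_fn ?V E B" .
  have Z: "0 < partition_fn ?V E B" using assms by (intro partition_fn_pos) auto
  show ?thesis unfolding ising_cond_def pmf_cond[OF ne] m
    using assms Z by (auto simp: pmf_ising gibbs_def pinned_def)
qed

section \<open>The program\<close>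

abbreviation (input) "bN \<equiv> 0 :: nat"
abbreviation (input) "bADJ \<equiv> 1 :: nat"
abbreviation (input) "bPIN \<equiv> 2 :: nat"
abbreviation (input) "bOUT \<equiv> 3 :: nat"
abbreviation (input) "bK \<equiv> 4 :: nat"
abbreviation (input) "bBE \<equiv> 5 :: nat"
abbreviation (input) "bPW \<equiv> 6 :: nat"
abbreviation (input) "bL \<equiv> 7 :: nat"
abbreviation (input) "bM \<equiv> 8 :: nat"
abbreviation (input) "bTHR \<equiv> 9 :: nat"
abbreviation (input) "bX \<equiv> 10 :: nat"
abbreviation (input) "bMARK \<equiv> 11 :: nat"
abbreviation (input) "bFN \<equiv> 12 :: nat"
abbreviation (input) "bFD \<equiv> 13 :: nat"
abbreviation (input) "bV \<equiv> 14 :: nat"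
abbreviation (input) "bW \<equiv> 15 :: nat"
abbreviation (input) "bNUM \<equiv> 16 :: nat"
abbreviation (input) "bDEN \<equiv> 17 :: nat"
abbreviation (input) "bI \<equiv> 18 :: nat"
abbreviation (input) "bU \<equiv> 19 :: nat"
abbreviation (input) "bJ \<equiv> 20 :: nat"
abbreviation (input) "bCOIN \<equiv> 21 :: nat"
abbreviation (input) "bBASE \<equiv> 22 :: nat"
abbreviation (input) "bLIM \<equiv> 23 :: nat"
abbreviation (input) "bP \<equiv> 24 :: nat"

declare One_nat_def [simp del]

section \<open>Arithmetic encodings of tests and selections\<close>

definition sc :: "nat \<Rightarrow> expr" where "sc b = Read b (Const 0)"
definition nz :: "expr \<Rightarrow> expr" where "nz e = Sub (Const 1) (Sub (Const 1) e)"
text \<open>Truncated subtraction turns tests into 0 or 1, and selection by arithmetic keeps loop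
  bodies free of branches, so that they remain straight-line code.\<close>

definition ite :: "expr \<Rightarrow> expr \<Rightarrow> expr \<Rightarrow> expr" where
  "ite e f g = Add (Mul (nz e) f) (Mul (Sub (Const 1) e) g)"
definition lt :: "expr \<Rightarrow> expr \<Rightarrow> expr" where "lt e f = nz (Sub f e)"
definition diff :: "expr \<Rightarrow> expr \<Rightarrow> expr" where "diff e f = Add (Sub e f) (Sub f e)"
definition incr :: "expr \<Rightarrow> expr" where "incr e = Add e (Const 1)"
definition cell :: "nat \<Rightarrow> expr \<Rightarrow> expr \<Rightarrow> expr" where
  "cell b e f = Read b (Add (Mul e (sc bN)) f)"

lemma eval_macros [simp]:
  "eval \<beta> s (sc b) = s b 0"
  "eval \<beta> s (nz e) = of_bool (eval \<beta> s e \<noteq> 0)"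
  "eval \<beta> s (ite e f g) = (if eval \<beta> s e \<noteq> 0 then eval \<beta> s f else eval \<beta> s g)"
  "eval \<beta> s (lt e f) = of_bool (eval \<beta> s e < eval \<beta> s f)"
  "eval \<beta> s (diff e f) = (eval \<beta> s e - eval \<beta> s f) + (eval \<beta> s f - eval \<beta> s e)"
  "eval \<beta> s (incr e) = eval \<beta> s e + 1"
  "eval \<beta> s (cell b e f) = s b (eval \<beta> s e * s bN 0 + eval \<beta> s f)"
  by (auto simp: sc_def nz_def ite_def lt_def diff_def incr_def cell_def)

lemma approx_free_macros [simp]:
  "approx_free (sc b)" "approx_free (nz e) \<longleftrightarrow> approx_free e"
  "approx_free (ite e f g) \<longleftrightarrow> approx_free e \<and> approx_free f \<and> approx_free g"
  "approx_free (lt e f) \<longleftrightarrow> approx_free e \<and> approx_free f"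
  "approx_free (diff e f) \<longleftrightarrow> approx_free e \<and> approx_free f"
  "approx_free (incr e) \<longleftrightarrow> approx_free e"
  "approx_free (cell b e f) \<longleftrightarrow> approx_free e \<and> approx_free f"
  by (auto simp: sc_def nz_def ite_def lt_def diff_def incr_def cell_def)

text \<open>Bank \<open>bV\<close> holds the path from the root of the recursion to the current vertex; the
  frame \<open>m\<close>, i.e. the remaining vertices and their fields after \<open>m\<close> removals, occupies the
  registers \<open>m * n + x\<close> of the banks \<open>bMARK\<close>, \<open>bFN\<close> and \<open>bFD\<close>.\<close>

definition com_push_body :: com where
  "com_push_body =
    Seq (Write bMARK (Add (Mul (incr (sc bM)) (sc bN)) (sc bX))
      (ite (diff (sc bX) (Read bV (sc bM))) (cell bMARK (sc bM) (sc bX)) (Const 1)))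
    (Seq (Write bFN (Add (Mul (incr (sc bM)) (sc bN)) (sc bX))
      (Mul (cell bFN (sc bM) (sc bX))
        (ite (cell bADJ (Read bV (sc bM)) (sc bX))
          (ite (lt (incr (sc bX)) (sc bTHR)) (sc bBE) (ite (lt (sc bTHR) (incr (sc bX))) (sc bPW) (Const 1)))
          (Const 1))))
    (Seq (Write bFD (Add (Mul (incr (sc bM)) (sc bN)) (sc bX))
      (Mul (cell bFD (sc bM) (sc bX))
        (ite (cell bADJ (Read bV (sc bM)) (sc bX))
          (ite (lt (incr (sc bX)) (sc bTHR)) (sc bPW) (ite (lt (sc bTHR) (incr (sc bX))) (sc bBE) (Const 1)))
          (Const 1))))
      (Write bX (Const 0) (incr (sc bX)))))"

text \<open>A removal builds a new frame and leaves the old one in place; going back to the graph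
  before the removal only takes a decrement of \<open>bM\<close>.\<close>

definition com_push :: com where
  "com_push = Seq (Write bX (Const 0) (Const 0))
    (Seq (While (Sub (sc bN) (sc bX)) com_push_body) (Write bM (Const 0) (incr (sc bM))))"

text \<open>The threshold register also transmits the vertex of the call, which is
  \<open>\<theta> - 1\<close>. The two products start with the fields of that vertex.\<close>

definition com_start :: com where
  "com_start = Seq (Write bV (sc bM) (Sub (sc bTHR) (Const 1)))
    (Seq (Write bW (sc bM) (Const 0))
    (Seq (Write bNUM (sc bM) (cell bFN (sc bM) (Read bV (sc bM))))
      (Write bDEN (sc bM) (cell bFD (sc bM) (Read bV (sc bM))))))"

definition can_advance :: expr where
  "can_advance = Mul (lt (Read bW (sc bM)) (sc bN)) (lt (sc bM) (sc bLIM))"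

definition com_next :: com where
  "com_next = Seq (Write bTHR (Const 0) (incr (Read bW (sc bM)))) (Write bW (sc bM) (sc bTHR))"

definition is_child :: expr where
  "is_child = Mul (cell bADJ (Read bV (sc bM)) (Sub (sc bTHR) (Const 1)))
     (Sub (Const 1) (cell bMARK (sc bM) (Sub (sc bTHR) (Const 1))))"

definition com_return :: com where
  "com_return = Seq (Write bM (Const 0) (Sub (sc bM) (Const 1)))
    (Seq (Write bNUM (sc bM) (Mul (Read bNUM (sc bM))
        (Add (Mul (sc bBE) (Read bNUM (incr (sc bM)))) (Mul (sc bPW) (Read bDEN (incr (sc bM)))))))
      (Write bDEN (sc bM) (Mul (Read bDEN (sc bM))
        (Add (Mul (sc bPW) (Read bNUM (incr (sc bM)))) (Mul (sc bBE) (Read bDEN (incr (sc bM))))))))"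

text \<open>The search shares the stack of frames with the vertices already fixed.
  \<open>bBASE\<close> marks the level of its root: above it there is always something to return
  from, at it the search stops when no candidate is left.\<close>

definition dfs_cond :: expr where
  "dfs_cond = Add (Sub (sc bM) (sc bBASE)) can_advance"

definition dfs_body :: com where
  "dfs_body = If can_advance (Seq com_next (If is_child (Seq com_push com_start) Skip)) com_return"

abbreviation (input) "dfs_loop \<equiv> While dfs_cond dfs_body"

lemmas program_defs = com_push_body_def com_push_def com_start_def can_advance_def com_next_def
  is_child_def com_return_def dfs_cond_def dfs_body_def

text \<open>A zero mark means that the vertex is present, so memory that is initially zero already
  describes the full vertex set at level 0.\<close>

definition frame :: "nat \<Rightarrow> mem \<Rightarrow> nat \<Rightarrow> nat set \<Rightarrow> (nat \<Rightarrow> nat \<Rightarrow> nat) \<Rightarrow> bool" where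
  "frame n s m U g \<longleftrightarrow> (\<forall>x<n. (s bMARK (m * n + x) = 0 \<longleftrightarrow> x \<in> U) \<and>
     s bFN (m * n + x) = g x 1 \<and> s bFD (m * n + x) = g x 2)"

text \<open>What a call at level \<open>m\<close> leaves intact. Frames and path are preserved up to
  \<open>m\<close> inclusive, but the neighbour counters and partial products only strictly below
  \<open>m\<close>, because those of level \<open>m\<close> carry its progress and its
  result.\<close>

definition same :: "nat \<Rightarrow> nat \<Rightarrow> mem \<Rightarrow> mem \<Rightarrow> bool" where
  "same n m s s' \<longleftrightarrow>
     (\<forall>b. b \<notin> {bM, bTHR, bX, bMARK, bFN, bFD, bV, bW, bNUM, bDEN} \<longrightarrow> s' b = s b) \<and>
     (\<forall>b\<in>{bMARK, bFN, bFD}. \<forall>j<(m + 1) * n. s' b j = s b j) \<and>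
     (\<forall>j\<le>m. s' bV j = s bV j) \<and>
     (\<forall>b\<in>{bW, bNUM, bDEN}. \<forall>j<m. s' b j = s b j)"

lemma same_refl: "same n m s s"
  by (simp add: same_def)

lemma same_trans: "same n m s s' \<Longrightarrow> same n m s' s'' \<Longrightarrow> same n m s s''"
  unfolding same_def by auto

lemma frame_same:
  assumes "frame n s m' U g" "same n m s s'" "m' \<le> m"
  shows "frame n s' m' U g"
proof -
  have "m' * n + x < (m + 1) * n" if "x < n" for x
  proof -
    have "m' * n + x < (m' + 1) * n" using that by (simp add: add_mult_distrib)
    also have "\<dots> \<le> (m + 1) * n" using assms(3) by (intro mult_le_mono) auto
    finally show ?thesis .
  qed
  then show ?thesis using assms unfolding frame_def same_def by auto
qed

text \<open>Here \<open>a\<close> is any rounding with denominator \<open>c\<close>; its link to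
  \<open>\<beta>\<close> enters only in \<open>run\<close>. In \<open>Wbig\<close>, the first
  bracket exceeds the length of every field, \<open>2 * \<Delta> + 2\<close> is the growth of
  lengths per level of the recursion, and the remaining summands make room for counters.\<close>

locale machine =
  fixes \<beta> :: real and W n :: nat and E :: "nat set set" and a c l K \<Delta> :: nat
  assumes gr: "simple_graph {..<n} E" and deg: "max_degree_le {..<n} E \<Delta>"
    and a: "0 < a" and ac: "a \<le> c" and cK: "c = 2 ^ K"
    and Wbig: "(K * (n + l) + K + 1) * (2 * \<Delta> + 2) ^ l + n + l + K + 3 \<le> W"
begin

definition consts_ok :: "mem \<Rightarrow> bool" where
  "consts_ok s \<longleftrightarrow> s bN 0 = n \<and> s bBE 0 = a \<and> s bPW 0 = c \<and> s bL 0 = l \<and> s bK 0 = K \<and>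
     (\<forall>x<n. \<forall>y<n. s bADJ (x * n + y) = of_bool ({x, y} \<in> E))"

text \<open>Each of the \<open>m\<close> removals multiplies a field by at most
  \<open>c = 2 ^ K\<close>.\<close>

definition fields_le :: "nat \<Rightarrow> (nat \<Rightarrow> nat \<Rightarrow> nat) \<Rightarrow> bool" where
  "fields_le m g \<longleftrightarrow> (\<forall>x t. 0 < g x t \<and> g x t \<le> 2 ^ (K * m))"

section \<open>Word length sufficing for all intermediate values\<close>

lemma W1: "1 \<le> W" using Wbig by simp

lemma small: "x \<le> n + l + K + 2 \<Longrightarrow> x < 2 ^ W"
proof -
  assume "x \<le> n + l + K + 2"
  then have "x < W" using Wbig by simp
  also have "W < 2 ^ W" by (rule less_exp)
  finally show ?thesis .
qed

lemma consts_same: "consts_ok s \<Longrightarrow> same n m s s' \<Longrightarrow> consts_ok s'"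
  unfolding consts_ok_def same_def by auto

lemma c0: "0 < c" using a ac by simp

lemma fields_le_split_fields:
  assumes "fields_le m g"
  shows "fields_le (Suc m) (split_fields E a c g v \<theta>)"
proof -
  have *: "g x t * k \<le> 2 ^ (K * Suc m)" if "k \<le> c" for x t k
  proof -
    have "g x t \<le> 2 ^ (K * m)" using assms unfolding fields_le_def by blast
    then have "g x t * k \<le> 2 ^ (K * m) * c" using that by (rule mult_le_mono)
    then show ?thesis by (simp add: cK power_add mult.commute)
  qed
  have "0 < split_fields E a c g v \<theta> x t" for x t
    using assms a c0 by (intro split_fields_pos) (auto simp: fields_le_def)
  then show ?thesis
    using *[of a] *[of c] *[of 1] ac c0 by (auto simp: fields_le_def split_fields_def)
qed

text \<open>Stated for a subset \<open>S\<close> of the neighbours, since the machine also stores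
  the partial products. With \<open>H\<close> for the first bracket of the exponent and
  \<open>X = (2 * \<Delta> + 2) ^ d\<close>, one level needs
  \<open>H + (K + 1 + H * X) * \<Delta>\<close> bits: the field, and at most \<open>\<Delta>\<close>
  sums of two products. This is below \<open>H * (2 * \<Delta> + 2) * X\<close>.\<close>

lemma approx_marg_part_le:
  assumes "fields_le m g" "m + Suc d \<le> n + l" "U \<subseteq> {..<n}" "v < n"
    "S \<subseteq> {w \<in> U - {v}. {v, w} \<in> E}"
    "\<And>w t. w \<in> S \<Longrightarrow> f w t \<le> 2 ^ ((K * (n + l) + K + 1) * (2 * \<Delta> + 2) ^ d)"
  shows "g v t * (\<Prod>w\<in>S. (if t = 1 then a else c) * f w 1 + (if t = 1 then c else a) * f w 2)
    \<le> 2 ^ ((K * (n + l) + K + 1) * (2 * \<Delta> + 2) ^ Suc d)"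
proof -
  let ?H = "K * (n + l) + K + 1" and ?X = "(2 * \<Delta> + 2) ^ d"
  have "card S \<le> card {w \<in> U - {v}. {v, w} \<in> E}"
    using assms(3,5) by (intro card_mono) (auto intro: finite_subset)
  then have cS: "card S \<le> \<Delta>" using card_neighbours_le[OF gr deg assms(3,4)] by simp
  have f: "(if t = 1 then a else c) * f w 1 + (if t = 1 then c else a) * f w 2 \<le> 2 ^ (K + 1 + ?H * ?X)"
    if "w \<in> S" for w
  proof -
    have "(if t = 1 then a else c) * f w 1 + (if t = 1 then c else a) * f w 2 \<le>
      c * 2 ^ (?H * ?X) + c * 2 ^ (?H * ?X)"
      using ac by (intro add_mono mult_le_mono assms(6) that) auto
    also have "\<dots> = 2 ^ (K + 1 + ?H * ?X)" by (simp add: cK power_add)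
    finally show ?thesis .
  qed
  have "g v t \<le> 2 ^ (K * m)" using assms(1) by (simp add: fields_le_def)
  also have "\<dots> \<le> 2 ^ ?H"
  proof (rule power_increasing)
    have "K * m \<le> K * (n + l)" using assms(2) by (intro mult_le_mono) auto
    then show "K * m \<le> ?H" by linarith
  qed simp
  finally have g: "g v t \<le> 2 ^ ?H" .
  have "(\<Prod>w\<in>S. (if t = 1 then a else c) * f w 1 + (if t = 1 then c else a) * f w 2) \<le>
    (\<Prod>w\<in>S. 2 ^ (K + 1 + ?H * ?X))" using f by (intro prod_mono) auto
  also have "\<dots> = 2 ^ ((K + 1 + ?H * ?X) * card S)" by (simp only: prod_constant power_mult)
  also have "\<dots> \<le> 2 ^ ((K + 1 + ?H * ?X) * \<Delta>)" using cS by (intro power_increasing mult_le_mono) auto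
  finally have "g v t * (\<Prod>w\<in>S. (if t = 1 then a else c) * f w 1 + (if t = 1 then c else a) * f w 2)
    \<le> 2 ^ ?H * 2 ^ ((K + 1 + ?H * ?X) * \<Delta>)" using g by (intro mult_le_mono)
  also have "\<dots> = 2 ^ (?H + (K + 1 + ?H * ?X) * \<Delta>)" by (simp only: power_add)
  also have "\<dots> \<le> 2 ^ (?H * (2 * \<Delta> + 2) ^ Suc d)"
  proof (rule power_increasing)
    have X: "1 \<le> ?X" by simp
    have "?H + (K + 1 + ?H * ?X) * \<Delta> \<le> ?H + (?H + ?H * ?X) * \<Delta>"
      by (intro add_mono mult_le_mono) auto
    also have "\<dots> = ?H * (1 + \<Delta> + ?X * \<Delta>)" by (simp only: algebra_simps)
    also have "\<dots> \<le> ?H * ((2 * \<Delta> + 2) * ?X)"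
    proof (rule mult_le_mono2)
      have "(1 + \<Delta>) * 1 \<le> (1 + \<Delta>) * ?X" using X by (intro mult_le_mono2)
      then show "1 + \<Delta> + ?X * \<Delta> \<le> (2 * \<Delta> + 2) * ?X" by (simp add: algebra_simps)
    qed
    finally show "?H + (K + 1 + ?H * ?X) * \<Delta> \<le> ?H * (2 * \<Delta> + 2) ^ Suc d" by simp
  qed simp
  finally show ?thesis .
qed

lemma approx_marg_le:
  assumes "fields_le m g" "m + d \<le> n + l" "U \<subseteq> {..<n}" "v < n"
  shows "approx_marg E a c d U g v t \<le> 2 ^ ((K * (n + l) + K + 1) * (2 * \<Delta> + 2) ^ d)"
  using assms
proof (induction d arbitrary: m U g v t)
  case 0
  have "g v t \<le> 2 ^ (K * m)" using 0 by (simp add: fields_le_def)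
  also have "\<dots> \<le> 2 ^ (K * (n + l) + K + 1)"
  proof (rule power_increasing)
    have "K * m \<le> K * (n + l)" using 0 by (intro mult_le_mono) auto
    then show "K * m \<le> K * (n + l) + K + 1" by linarith
  qed simp
  finally show ?case by simp
next
  case (Suc d)
  show ?case unfolding approx_marg.simps
  proof (rule approx_marg_part_le[OF Suc.prems(1-4) subset_refl])
    fix w t assume "w \<in> {w \<in> U - {v}. {v, w} \<in> E}"
    then show "approx_marg E a c d (U - {v}) (split_fields E a c g v (w + 1)) w t
        \<le> 2 ^ ((K * (n + l) + K + 1) * (2 * \<Delta> + 2) ^ d)"
      using Suc.prems by (intro Suc.IH[of "Suc m"] fields_le_split_fields) auto
  qed
qed

lemma pow_less_W:
  fixes x :: nat
  assumes "d \<le> l" "x \<le> 2 ^ ((K * (n + l) + K + 1) * (2 * \<Delta> + 2) ^ d)"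
  shows "x < 2 ^ W"
proof -
  have "(K * (n + l) + K + 1) * (2 * \<Delta> + 2) ^ d \<le> (K * (n + l) + K + 1) * (2 * \<Delta> + 2) ^ l"
    using assms(1) by (intro mult_le_mono2 power_increasing) auto
  also have "\<dots> < W" using Wbig by linarith
  finally have "(2::nat) ^ ((K * (n + l) + K + 1) * (2 * \<Delta> + 2) ^ d) < 2 ^ W"
    by (intro power_strict_increasing) auto
  then show ?thesis using assms(2) by linarith
qed

lemma fields_less_W:
  assumes "fields_le m g" "m \<le> n + l"
  shows "g x t < 2 ^ W"
proof -
  have "g x t \<le> 2 ^ (K * m)" using assms by (simp add: fields_le_def)
  also have "\<dots> \<le> 2 ^ ((K * (n + l) + K + 1) * (2 * \<Delta> + 2) ^ 0)"
  proof (rule power_increasing)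
    have "K * m \<le> K * (n + l)" using assms by (intro mult_le_mono) auto
    then show "K * m \<le> (K * (n + l) + K + 1) * (2 * \<Delta> + 2) ^ 0"
      unfolding power_0 mult_1_right by linarith
  qed simp
  finally show ?thesis by (rule pow_less_W[rotated]) simp
qed

definition push_post :: "nat \<Rightarrow> nat \<Rightarrow> nat set \<Rightarrow> (nat \<Rightarrow> nat \<Rightarrow> nat) \<Rightarrow> mem \<Rightarrow> mem \<Rightarrow> bool" where
  "push_post m v U g s s' \<longleftrightarrow> frame n s' (m + 1) U g \<and> s' bM 0 = m + 1 \<and>
     (\<forall>b. b \<notin> {bM, bX, bMARK, bFN, bFD} \<longrightarrow> s' b = s b) \<and>
     (\<forall>b\<in>{bMARK, bFN, bFD}. \<forall>j<(m + 1) * n. s' b j = s b j)"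

lemma wp_push:
  assumes "consts_ok s" "mem_bdd W s" "frame n s m U g" "s bM 0 = m" "s bV m = v" "v < n"
    "s bTHR 0 = \<theta>" "fields_le m g" "m + 1 \<le> n + l"
  shows "wp \<beta> W com_push [] (8 * n + 10)
    (push_post m v (U - {v}) (split_fields E a c g v \<theta>) s) s"
proof -
  let ?g = "split_fields E a c g v \<theta>"
  define J where "J i s' \<longleftrightarrow> s' bX 0 = i \<and> mem_bdd W s' \<and>
      (\<forall>b. b \<notin> {bX, bMARK, bFN, bFD} \<longrightarrow> s' b = s b) \<and>
      (\<forall>b\<in>{bMARK, bFN, bFD}. \<forall>j<(m + 1) * n. s' b j = s b j) \<and>
      (\<forall>x<i. (s' bMARK ((m + 1) * n + x) = 0 \<longleftrightarrow> x \<in> U - {v}) \<and>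
        s' bFN ((m + 1) * n + x) = ?g x 1 \<and> s' bFD ((m + 1) * n + x) = ?g x 2)" for i s'
  have gW: "?g x t < 2 ^ W" for x t
    using fields_less_W[OF fields_le_split_fields[OF assms(8)]] assms(9) by simp
  have body: "eval \<beta> s' (Sub (sc bN) (sc bX)) \<noteq> 0 \<and> wp \<beta> W com_push_body [] 7 (J (Suc i)) s'"
    if i: "i < n" and J: "J i s'" for i s'
  proof
    have s': "s' bX 0 = i" "s' bN = s bN" "s' bV = s bV" "s' bM = s bM" "s' bADJ = s bADJ"
      "s' bBE = s bBE" "s' bPW = s bPW" "s' bTHR = s bTHR" using J unfolding J_def by auto
    have s: "s bN 0 = n" "s bBE 0 = a" "s bPW 0 = c" "s bADJ (v * n + i) = of_bool ({v, i} \<in> E)"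
      using assms(1,6) i unfolding consts_ok_def by auto
    \<comment> \<open>The loop writes only at or beyond \<open>(m + 1) * n\<close>, so the frame
      being copied is still the original one.\<close>
    have old: "s' b (m * n + i) = s b (m * n + i)" if "b \<in> {bMARK, bFN, bFD}" for b
    proof -
      have "m * n + i < (m + 1) * n" using i by (simp add: add_mult_distrib)
      then show ?thesis using J that unfolding J_def by blast
    qed
    have fr: "s bMARK (m * n + i) = 0 \<longleftrightarrow> i \<in> U" "s bFN (m * n + i) = g i 1" "s bFD (m * n + i) = g i 2"
      using assms(3) i unfolding frame_def by auto
    show "eval \<beta> s' (Sub (sc bN) (sc bX)) \<noteq> 0" using s s' i by simp
    define mk where "mk = (if i \<noteq> v then s bMARK (m * n + i) else 1)"
    have straight_run: "straight_run \<beta> com_push_body s' = upd (upd (upd (upd s' bMARK ((m + 1) * n + i) mk)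
       bFN ((m + 1) * n + i) (?g i 1)) bFD ((m + 1) * n + i) (?g i 2)) bX 0 (i + 1)"
      by (simp add: com_push_body_def s s' assms old fr split_fields_def mk_def upd_def)
    have mkW: "mk < 2 ^ W" using assms(2) small[of 1] by (auto simp: mk_def mem_bdd_def)
    have bd: "straight_bdd \<beta> W com_push_body s'"
      using gW[of i 1] gW[of i 2] mkW small[of "i + 1"] i
      by (simp add: com_push_body_def s s' assms old fr split_fields_def mk_def upd_def split: if_splits)
    have "mem_bdd W (straight_run \<beta> com_push_body s')"
      unfolding straight_run using J gW mkW small[of "i + 1"] i by (auto intro!: mem_bdd_upd simp: J_def)
    then have "J (Suc i) (straight_run \<beta> com_push_body s')"
      using J unfolding J_def unfolding straight_run upd_def
      by (auto simp: less_Suc_eq mk_def fr)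
    then show "wp \<beta> W com_push_body [] 7 (J (Suc i)) s'"
      by (intro wp_straight bd) (simp_all add: com_push_body_def)
  qed
  have loop: "wp \<beta> W (While (Sub (sc bN) (sc bX)) com_push_body) [] (1 + n * (1 + 7)) (J n) (upd s bX 0 0)"
  proof (rule wp_While_count[where I = J and m = n])
    show "eval \<beta> s' (Sub (sc bN) (sc bX)) \<noteq> 0 \<and> wp \<beta> W com_push_body [] 7 (J (Suc i)) s'"
      if "i < n" "J i s'" for i s' using body[OF that] .
    show "eval \<beta> s' (Sub (sc bN) (sc bX)) = 0" if "J n s'" for s'
      using that assms(1) by (auto simp: J_def consts_ok_def)
    have "mem_bdd W (upd s bX 0 0)" by (rule mem_bdd_upd[OF assms(2)]) simp
    then show "J 0 (upd s bX 0 0)" by (simp add: J_def upd_def)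
  qed
  have fin: "wp \<beta> W (Write bM (Const 0) (incr (sc bM))) [] 1 (push_post m v (U - {v}) ?g s) s'"
    if J: "J n s'" for s'
  proof (rule wp_straight)
    have s': "s' bM = s bM" using J unfolding J_def by auto
    show "straight_bdd \<beta> W (Write bM (Const 0) (incr (sc bM))) s'"
      using small[of "m + 1"] assms(9) by (simp add: s' assms(4))
    show "push_post m v (U - {v}) ?g s (straight_run \<beta> (Write bM (Const 0) (incr (sc bM))) s')"
      using J unfolding J_def push_post_def frame_def by (auto simp: s' assms(4) upd_def)
  qed simp_all
  have "wp \<beta> W (Seq (While (Sub (sc bN) (sc bX)) com_push_body) (Write bM (Const 0) (incr (sc bM)))) []
      (8 * n + 3) (push_post m v (U - {v}) ?g s) (upd s bX 0 0)"
    by (rule wp_Seq[OF wp_mono[OF loop order_refl fin]]) auto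
  then have "wp \<beta> W (Write bX (Const 0) (Const 0)) [] 1
      (wp \<beta> W (Seq (While (Sub (sc bN) (sc bX)) com_push_body) (Write bM (Const 0) (incr (sc bM)))) []
        (8 * n + 3) (push_post m v (U - {v}) ?g s)) s"
    by - (rule wp_straight; simp)
  then show ?thesis unfolding com_push_def by (rule wp_Seq) simp
qed

end

section \<open>Correctness of the iterative search\<close>

lemma same_le: "same n (m + 1) s s' \<Longrightarrow> same n m s s'"
  unfolding same_def by (auto simp: add_mult_distrib)

context machine
begin

text \<open>\<open>reach k s s'\<close>: the recursion loop gets from \<open>s\<close> to \<open>s'\<close> in at most \<open>k\<close> steps.\<close>

definition reach :: "nat \<Rightarrow> mem \<Rightarrow> mem \<Rightarrow> bool" where
  "reach k s s' \<longleftrightarrow> (\<forall>bs j Q. wp \<beta> W dfs_loop bs j Q s' \<longrightarrow>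
     wp \<beta> W dfs_loop bs (j + k) Q s)"

lemma reach_refl: "reach 0 s s"
  by (simp add: reach_def)

lemma reach_trans: "reach k s s' \<Longrightarrow> reach k' s' s'' \<Longrightarrow> reach (k + k') s s''"
  unfolding reach_def by (metis add.assoc add.commute)

lemma reach_mono: "reach k s s' \<Longrightarrow> k \<le> k' \<Longrightarrow> reach k' s s'"
  unfolding reach_def by (meson add_le_mono le_refl wp_mono)

lemma reach_step:
  assumes "eval \<beta> s dfs_cond \<noteq> 0" "wp \<beta> W dfs_body [] k P s" "mem_bdd W s" "k + 1 \<le> k'"
  shows "\<exists>s'. reach k' s s' \<and> mem_bdd W s' \<and> P s'"
proof -
  from wp_mono_bdd[OF assms(2) le_refl assms(3) W1, of "\<lambda>s'. mem_bdd W s' \<and> P s'"]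
  have "wp \<beta> W dfs_body [] k (\<lambda>s'. mem_bdd W s' \<and> P s') s" by blast
  then obtain j s' where j: "j \<le> k" "mem_bdd W s'" "P s'"
    "\<forall>r. bexec \<beta> W dfs_body (s, [] @ r) j (s', r)" unfolding wp_def by blast
  have "wp \<beta> W dfs_loop bs (i + k') Q s"
    if "wp \<beta> W dfs_loop bs i Q s'" for bs i Q
  proof -
    have "wp \<beta> W dfs_body [] k (wp \<beta> W dfs_loop bs i Q) s"
      using j that unfolding wp_def[of _ _ dfs_body] by blast
    from wp_WhileTrueI[OF assms(1) this] have "wp \<beta> W dfs_loop bs (1 + k + i) Q s"
      by simp
    then show ?thesis by (rule wp_mono) (use assms(4) in auto)
  qed
  then show ?thesis using j unfolding reach_def by blast
qed

definition active :: "mem \<Rightarrow> nat \<Rightarrow> nat \<Rightarrow> nat \<Rightarrow> nat \<Rightarrow> nat \<Rightarrow> bool" where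
  "active s m v w p q \<longleftrightarrow> s bM 0 = m \<and> s bV m = v \<and> s bW m = w \<and> s bNUM m = p \<and> s bDEN m = q"

definition iter_cost :: nat where "iter_cost = 8 * n + 40"

text \<open>A level makes one pass per candidate vertex, \<open>n\<close> in all; each of the at
  most \<open>\<Delta>\<close> true neighbours adds its subtree and the pass that returns from
  it.\<close>

fun dfs_steps :: "nat \<Rightarrow> nat" where
  "dfs_steps 0 = 0"
| "dfs_steps (Suc d) = n * iter_cost + \<Delta> * (dfs_steps d + iter_cost)"

lemma wp_start:
  assumes "consts_ok s" "mem_bdd W s" "frame n s m U g" "s bM 0 = m" "s bTHR 0 = k + 1" "k < n"
  shows "wp \<beta> W com_start [] 7 (\<lambda>s'. active s' m k 0 (g k 1) (g k 2) \<and>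
    (\<forall>b. b \<notin> {bV, bW, bNUM, bDEN} \<longrightarrow> s' b = s b) \<and>
    (\<forall>b\<in>{bV, bW, bNUM, bDEN}. \<forall>j. j \<noteq> m \<longrightarrow> s' b j = s b j)) s"
proof (rule wp_straight)
  have s: "s bN 0 = n" using assms(1) by (simp add: consts_ok_def)
  have fr: "s bFN (m * n + k) = g k 1" "s bFD (m * n + k) = g k 2"
    using assms(3,6) unfolding frame_def by auto
  have "s bFN (m * n + k) < 2 ^ W" "s bFD (m * n + k) < 2 ^ W"
    using assms(2) unfolding mem_bdd_def by auto
  then have g: "g k 1 < 2 ^ W" "g k 2 < 2 ^ W" by (simp_all add: fr)
  show "straight_bdd \<beta> W com_start s"
    using g small[of k] assms(6) by (simp add: com_start_def upd_def assms(4,5) s fr)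
  show "active (straight_run \<beta> com_start s) m k 0 (g k 1) (g k 2) \<and>
    (\<forall>b. b \<notin> {bV, bW, bNUM, bDEN} \<longrightarrow> straight_run \<beta> com_start s b = s b) \<and>
    (\<forall>b\<in>{bV, bW, bNUM, bDEN}. \<forall>j. j \<noteq> m \<longrightarrow> straight_run \<beta> com_start s b j = s b j)"
    by (simp add: com_start_def upd_def assms(4,5) s fr active_def)
qed (simp_all add: com_start_def)

lemma dfs_advance:
  assumes "consts_ok s" "mem_bdd W s" "frame n s m U g" "U \<subseteq> {..<n}" "v \<in> U"
    "active s m v k p q" "k < n" "m < s bLIM 0" "m + 1 \<le> n + l" "fields_le m g"
  shows "\<exists>s'. reach iter_cost s s' \<and> mem_bdd W s' \<and> same n m s s' \<and>
    s' bW m = k + 1 \<and> s' bNUM m = p \<and> s' bDEN m = q \<and>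
    (if k \<in> U - {v} \<and> {v, k} \<in> E then
       frame n s' (m + 1) (U - {v}) (split_fields E a c g v (k + 1)) \<and>
       active s' (m + 1) k 0 (split_fields E a c g v (k + 1) k 1) (split_fields E a c g v (k + 1) k 2)
     else s' bM 0 = m)" (is "\<exists>s'. reach iter_cost s s' \<and> mem_bdd W s' \<and> ?P s'")
proof (rule reach_step)
  have act: "s bM 0 = m" "s bV m = v" "s bW m = k" "s bNUM m = p" "s bDEN m = q"
    using assms(6) by (auto simp: active_def)
  have N: "s bN 0 = n" "v < n" using assms(1,4,5) by (auto simp: consts_ok_def)
  have adj: "s bADJ (v * n + k) = of_bool ({v, k} \<in> E)"
    using assms(1,7) N(2) by (auto simp: consts_ok_def)
  have mark: "s bMARK (m * n + k) = 0 \<longleftrightarrow> k \<in> U" using assms(3,7) by (auto simp: frame_def)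
  have adv: "eval \<beta> s can_advance \<noteq> 0"
    using assms(7,8) act N by (simp add: can_advance_def)
  then show "eval \<beta> s dfs_cond \<noteq> 0" by (simp add: dfs_cond_def)
  define s2 where "s2 = upd (upd s bTHR 0 (k + 1)) bW m (k + 1)"
  have s2: "straight_run \<beta> com_next s = s2" by (simp add: com_next_def s2_def upd_def act)
  have s2b: "mem_bdd W s2" unfolding s2_def
    using small[of "k + 1"] assms(2,7) by (intro mem_bdd_upd) auto
  have s2c: "consts_ok s2" using assms(1) by (simp add: consts_ok_def s2_def upd_def)
  have s2f: "frame n s2 m U g" using assms(3) by (simp add: frame_def s2_def upd_def)
  have s2r: "s2 bM 0 = m" "s2 bV m = v" "s2 bTHR 0 = k + 1" by (simp_all add: s2_def upd_def act)
  \<comment> \<open>The frame at level \<open>m\<close> still contains \<open>v\<close>; that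
    \<open>v\<close> is not its own child follows from the absence of loops.\<close>
  have child: "eval \<beta> s2 is_child \<noteq> 0 \<longleftrightarrow> k \<in> U - {v} \<and> {v, k} \<in> E"
    using simple_graph_irrefl[OF gr, of v] mark
    by (auto simp: is_child_def s2_def upd_def act N adj)
  have inner: "wp \<beta> W (If is_child (Seq com_push com_start) Skip) [] (8 * n + 20) ?P s2"
  proof (rule wp_mono[OF wp_IfI[where k = "8 * n + 19"]])
    assume nz: "eval \<beta> s2 is_child \<noteq> 0"
    let ?U = "U - {v}" and ?g = "split_fields E a c g v (k + 1)"
    have push: "wp \<beta> W com_push [] (8 * n + 10) (push_post m v ?U ?g s2) s2"
      using wp_push[OF s2c s2b s2f s2r(1,2) N(2) s2r(3) assms(10,9)] .
    have start: "wp \<beta> W com_start [] 7 ?P s3" if p: "push_post m v ?U ?g s2 s3" and b: "mem_bdd W s3" for s3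
    proof (rule wp_mono[OF wp_start])
      show "consts_ok s3" using s2c p unfolding push_post_def consts_ok_def by auto
      show "frame n s3 (m + 1) ?U ?g" "s3 bM 0 = m + 1" "s3 bTHR 0 = k + 1"
        using p s2r(3) unfolding push_post_def by auto
    next
      fix s' assume s': "active s' (m + 1) k 0 (?g k 1) (?g k 2) \<and>
        (\<forall>b. b \<notin> {bV, bW, bNUM, bDEN} \<longrightarrow> s' b = s3 b) \<and>
        (\<forall>b\<in>{bV, bW, bNUM, bDEN}. \<forall>j. j \<noteq> m + 1 \<longrightarrow> s' b j = s3 b j)"
      have o1: "s' b j = s2 b j" if "b \<in> {bV, bW, bNUM, bDEN}" "j \<noteq> m + 1" for b j
        using that s' p unfolding push_post_def by auto
      have o2: "s' b = s2 b" if "b \<notin> {bM, bX, bMARK, bFN, bFD, bV, bW, bNUM, bDEN}" for b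
        using that s' p unfolding push_post_def by auto
      have o3: "s' b j = s2 b j" if "b \<in> {bMARK, bFN, bFD}" "j < (m + 1) * n" for b j
        using that s' p unfolding push_post_def by auto
      have o4: "s' b = s3 b" if "b \<in> {bMARK, bFN, bFD}" for b
        using that s' by auto
      have "same n m s2 s'" unfolding same_def using o1 o2 o3 by auto
      moreover have "same n m s s2" unfolding same_def s2_def upd_def by auto
      ultimately have "same n m s s'" by (rule same_trans[rotated])
      moreover have "frame n s' (m + 1) ?U ?g"
        using p o4 unfolding push_post_def frame_def by auto
      moreover have "s' bW m = k + 1" "s' bNUM m = p" "s' bDEN m = q"
        using o1[of bW m] o1[of bNUM m] o1[of bDEN m] act by (simp_all add: s2_def upd_def)
      ultimately show "?P s'" using s' child nz by simp
    qed (use b assms(7) in auto)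
    show "wp \<beta> W (Seq com_push com_start) [] (8 * n + 19) ?P s2"
      by (rule wp_Seq[OF wp_mono_bdd[OF push order_refl s2b W1 start]]) auto
  next
    assume z: "eval \<beta> s2 is_child = 0"
    have "?P s2" using z child act by (auto simp: same_def s2_def upd_def)
    then show "wp \<beta> W Skip [] (8 * n + 19) ?P s2" by (intro wp_straight) auto
  qed auto
  have "wp \<beta> W (Seq com_next (If is_child (Seq com_push com_start) Skip)) [] (8 * n + 30) ?P s"
  proof (rule wp_Seq[where k = 3])
    show "wp \<beta> W com_next [] 3 (wp \<beta> W (If is_child (Seq com_push com_start) Skip) [] (8 * n + 20) ?P) s"
      by (rule wp_straight)
         (use small[of "k + 1"] assms(7) inner in \<open>simp_all only: s2, simp_all add: com_next_def act upd_def\<close>)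
  qed simp
  then have "wp \<beta> W dfs_body [] (1 + (8 * n + 30)) ?P s"
    unfolding dfs_body_def by (rule wp_IfI) (use adv in blast)
  then show "wp \<beta> W dfs_body [] (8 * n + 31) ?P s" by (rule wp_mono) auto
qed (use assms(2) in \<open>auto simp: iter_cost_def\<close>)

text \<open>The condition on \<open>bW\<close> and \<open>bLIM\<close> makes
  \<open>can_advance\<close> false: the call at level \<open>m + 1\<close> has tried all candidates
  or sits at the depth limit, so the pass takes the returning branch and merges its pair into that
  of level \<open>m\<close>.\<close>

lemma dfs_return:
  assumes "consts_ok s" "mem_bdd W s" "s bM 0 = m + 1" "s bBASE 0 \<le> m"
    "s bW (m + 1) = n \<or> s bLIM 0 = m + 1"
    "s bNUM m * (a * s bNUM (m + 1) + c * s bDEN (m + 1)) < 2 ^ W"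
    "s bDEN m * (c * s bNUM (m + 1) + a * s bDEN (m + 1)) < 2 ^ W" "m \<le> n + l"
  shows "\<exists>s'. reach iter_cost s s' \<and> mem_bdd W s' \<and> same n m s s' \<and>
    active s' m (s bV m) (s bW m) (s bNUM m * (a * s bNUM (m + 1) + c * s bDEN (m + 1)))
      (s bDEN m * (c * s bNUM (m + 1) + a * s bDEN (m + 1)))"
    (is "\<exists>s'. reach iter_cost s s' \<and> mem_bdd W s' \<and> ?P s'")
proof (rule reach_step)
  have N: "s bN 0 = n" "s bBE 0 = a" "s bPW 0 = c" using assms(1) by (auto simp: consts_ok_def)
  show "eval \<beta> s dfs_cond \<noteq> 0" using assms(3,4) by (simp add: dfs_cond_def)
  have adv: "eval \<beta> s can_advance = 0" using assms(3,5) N by (auto simp: can_advance_def)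
  have "wp \<beta> W com_return [] 5 ?P s"
  proof (rule wp_straight)
    show "straight_bdd \<beta> W com_return s"
      using assms(6-8) small[of m] by (simp add: com_return_def upd_def assms(3) N)
    show "?P (straight_run \<beta> com_return s)"
      by (simp add: com_return_def upd_def assms(3) N active_def same_def)
  qed (simp_all add: com_return_def)
  then have "wp \<beta> W dfs_body [] (1 + 5) ?P s"
    unfolding dfs_body_def by (rule wp_IfI[rotated]) (use adv in blast)
  then show "wp \<beta> W dfs_body [] 6 ?P s" by (rule wp_mono) auto
qed (use assms(2) in \<open>auto simp: iter_cost_def\<close>)

text \<open>One recursive call is a stretch of passes of the single loop. The limit
  \<open>m + d\<close> stays constant while \<open>m\<close> rises and \<open>d\<close> falls. A
  call ends because its candidates are exhausted or, for \<open>d = 0\<close>, because of the limit;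
  in the latter case the fields written at the start are already the result.\<close>

lemma dfs:
  assumes "consts_ok s" "mem_bdd W s" "frame n s m U g" "U \<subseteq> {..<n}" "v \<in> U"
    "active s m v 0 (g v 1) (g v 2)" "s bBASE 0 \<le> m" "s bLIM 0 = m + d" "m + d \<le> n + l" "d \<le> l"
    "fields_le m g"
  shows "\<exists>s'. reach (dfs_steps d) s s' \<and> mem_bdd W s' \<and> same n m s s' \<and> s' bM 0 = m \<and>
    (s' bW m = n \<or> d = 0) \<and> s' bNUM m = approx_marg E a c d U g v 1 \<and> s' bDEN m = approx_marg E a c d U g v 2"
  using assms
proof (induction d arbitrary: s m U g v)
  case 0
  then show ?case
    by (intro exI[of _ s]) (auto simp: reach_refl same_refl active_def)
next
  case (Suc d s m U g v)
  note IH = Suc.IH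
  define f where "f w t = approx_marg E a c d (U - {v}) (split_fields E a c g v (w + 1)) w t" for w t
  define F where "F S t = g v t * (\<Prod>w\<in>S. (if t = 1 then a else c) * f w 1 +
     (if t = 1 then c else a) * f w 2)" for S t
  let ?C = "\<lambda>k. {w \<in> U - {v}. {v, w} \<in> E \<and> w < k}"
  have v: "v < n" using Suc.prems by auto
  have finU: "finite U" using Suc.prems(4) by (auto intro: finite_subset)
  have FW: "F S t < 2 ^ W" if "S \<subseteq> {w \<in> U - {v}. {v, w} \<in> E}" for S t
    unfolding F_def
  proof (rule pow_less_W)
    show "Suc d \<le> l" using Suc.prems by simp
    show "g v t * (\<Prod>w\<in>S. (if t = 1 then a else c) * f w 1 + (if t = 1 then c else a) * f w 2)
      \<le> 2 ^ ((K * (n + l) + K + 1) * (2 * \<Delta> + 2) ^ Suc d)"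
    proof (rule approx_marg_part_le[OF Suc.prems(11,9,4) v that])
      fix w t assume "w \<in> S"
      then show "f w t \<le> 2 ^ ((K * (n + l) + K + 1) * (2 * \<Delta> + 2) ^ d)"
        unfolding f_def using that Suc.prems
        by (intro approx_marg_le[of "Suc m"] fields_le_split_fields) auto
    qed
  qed
  \<comment> \<open>Inner induction over the candidates: after \<open>k\<close> of them the
    accumulators hold the product over the children below \<open>k\<close>.\<close>
  have main: "\<exists>s'. reach (k * iter_cost + card (?C k) * (dfs_steps d + iter_cost)) s s' \<and>
      mem_bdd W s' \<and> same n m s s' \<and> active s' m v k (F (?C k) 1) (F (?C k) 2)" if "k \<le> n" for k
    using that
  proof (induction k)
    case 0
    have "?C 0 = {}" by simp
    then show ?case using Suc.prems(2,6)
      by (intro exI[of _ s]) (simp add: reach_refl same_refl F_def)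
  next
    case (Suc k)
    then obtain s1 where s1: "reach (k * iter_cost + card (?C k) * (dfs_steps d + iter_cost)) s s1"
      "mem_bdd W s1" "same n m s s1" "active s1 m v k (F (?C k) 1) (F (?C k) 2)" by auto
    have c1: "consts_ok s1" using consts_same[OF \<open>consts_ok s\<close> s1(3)] .
    have f1: "frame n s1 m U g" using frame_same[OF \<open>frame n s m U g\<close> s1(3)] by simp
    have b1: "s1 bBASE = s bBASE" "s1 bLIM = s bLIM" using s1(3) unfolding same_def by auto
    have "\<exists>s'. reach iter_cost s1 s' \<and> mem_bdd W s' \<and> same n m s1 s' \<and>
      s' bW m = k + 1 \<and> s' bNUM m = F (?C k) 1 \<and> s' bDEN m = F (?C k) 2 \<and>
      (if k \<in> U - {v} \<and> {v, k} \<in> E then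
         frame n s' (m + 1) (U - {v}) (split_fields E a c g v (k + 1)) \<and>
         active s' (m + 1) k 0 (split_fields E a c g v (k + 1) k 1) (split_fields E a c g v (k + 1) k 2)
       else s' bM 0 = m)"
      using Suc.prems \<open>s bLIM 0 = m + Suc d\<close> \<open>m + Suc d \<le> n + l\<close> b1
      by (intro dfs_advance[OF c1 s1(2) f1 \<open>U \<subseteq> {..<n}\<close> \<open>v \<in> U\<close> s1(4) _ _ _ \<open>fields_le m g\<close>]) auto
    then obtain s2 where s2: "reach iter_cost s1 s2" "mem_bdd W s2" "same n m s1 s2"
      "s2 bW m = k + 1" "s2 bNUM m = F (?C k) 1" "s2 bDEN m = F (?C k) 2"
      "if k \<in> U - {v} \<and> {v, k} \<in> E then
         frame n s2 (m + 1) (U - {v}) (split_fields E a c g v (k + 1)) \<and>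
         active s2 (m + 1) k 0 (split_fields E a c g v (k + 1) k 1) (split_fields E a c g v (k + 1) k 2)
       else s2 bM 0 = m" by blast
    have ss2: "same n m s s2" using same_trans[OF s1(3) s2(3)] .
    have V: "s bV m = v" using \<open>active s m v 0 (g v 1) (g v 2)\<close> by (simp add: active_def)
    have V2: "s2 bV m = v" using ss2 V unfolding same_def by simp
    show ?case
    proof (cases "k \<in> U - {v} \<and> {v, k} \<in> E")
      case False
      then have C: "?C (Suc k) = ?C k" by (auto simp: less_Suc_eq)
      have "reach (k * iter_cost + card (?C k) * (dfs_steps d + iter_cost) + iter_cost) s s2"
        by (rule reach_trans[OF s1(1) s2(1)])
      then have "reach (Suc k * iter_cost + card (?C k) * (dfs_steps d + iter_cost)) s s2"
        by (rule reach_mono) simp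
      moreover have "active s2 m v (Suc k) (F (?C k) 1) (F (?C k) 2)"
        using False s2(4-7) V2 by (simp add: active_def)
      ultimately show ?thesis unfolding C using s2(2) ss2 by blast
    next
      case True
      let ?g = "split_fields E a c g v (k + 1)"
      have f2: "frame n s2 (m + 1) (U - {v}) ?g" "active s2 (m + 1) k 0 (?g k 1) (?g k 2)"
        using s2(7) True by auto
      have c2: "consts_ok s2" using consts_same[OF \<open>consts_ok s\<close> ss2] .
      have b2: "s2 bBASE = s bBASE" "s2 bLIM = s bLIM" using ss2 unfolding same_def by auto
      have "\<exists>s'. reach (dfs_steps d) s2 s' \<and> mem_bdd W s' \<and> same n (m + 1) s2 s' \<and> s' bM 0 = m + 1 \<and>
        (s' bW (m + 1) = n \<or> d = 0) \<and> s' bNUM (m + 1) = approx_marg E a c d (U - {v}) ?g k 1 \<and>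
        s' bDEN (m + 1) = approx_marg E a c d (U - {v}) ?g k 2"
      proof (rule IH[OF c2 s2(2) f2(1) _ _ f2(2)])
        show "fields_le (m + 1) ?g" 
          unfolding Suc_eq_plus1[symmetric] by (rule fields_le_split_fields[OF \<open>fields_le m g\<close>])
      qed (use True Suc.prems b2 \<open>U \<subseteq> {..<n}\<close> \<open>s bLIM 0 = m + Suc d\<close> \<open>s bBASE 0 \<le> m\<close>
            \<open>m + Suc d \<le> n + l\<close> \<open>Suc d \<le> l\<close> in auto)
      then obtain s3 where s3: "reach (dfs_steps d) s2 s3" "mem_bdd W s3" "same n (m + 1) s2 s3"
        "s3 bM 0 = m + 1" "s3 bW (m + 1) = n \<or> d = 0"
        "s3 bNUM (m + 1) = f k 1" "s3 bDEN (m + 1) = f k 2" unfolding f_def by blast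
      have ss3: "same n m s s3" using same_trans[OF ss2 same_le[OF s3(3)]] .
      have c3: "consts_ok s3" using consts_same[OF \<open>consts_ok s\<close> ss3] .
      have b3: "s3 bBASE = s bBASE" "s3 bLIM = s bLIM" using ss3 unfolding same_def by auto
      have r3: "s3 bV m = v" "s3 bW m = k + 1" "s3 bNUM m = F (?C k) 1" "s3 bDEN m = F (?C k) 2"
        using s3(3) s2(4-6) V2 unfolding same_def by auto
      have C: "?C (Suc k) = insert k (?C k)" using True by (auto simp: less_Suc_eq)
      have cC: "card (?C (Suc k)) = Suc (card (?C k))"
        unfolding C using finU by (intro card_insert_disjoint) auto
      have Fk: "F (?C (Suc k)) 1 = s3 bNUM m * (a * s3 bNUM (m + 1) + c * s3 bDEN (m + 1))"
        "F (?C (Suc k)) 2 = s3 bDEN m * (c * s3 bNUM (m + 1) + a * s3 bDEN (m + 1))"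
        unfolding C F_def r3 s3(6,7) using finU by (simp_all add: ac_simps)
      have "\<exists>s'. reach iter_cost s3 s' \<and> mem_bdd W s' \<and> same n m s3 s' \<and>
        active s' m (s3 bV m) (s3 bW m) (F (?C (Suc k)) 1) (F (?C (Suc k)) 2)"
        unfolding Fk
      proof (rule dfs_return[OF c3 s3(2,4)])
        show "s3 bW (m + 1) = n \<or> s3 bLIM 0 = m + 1"
          using s3(5) b3 \<open>s bLIM 0 = m + Suc d\<close> by auto
        show "s3 bNUM m * (a * s3 bNUM (m + 1) + c * s3 bDEN (m + 1)) < 2 ^ W"
          "s3 bDEN m * (c * s3 bNUM (m + 1) + a * s3 bDEN (m + 1)) < 2 ^ W"
          unfolding Fk[symmetric] by (auto intro!: FW)
      qed (use b3 \<open>s bBASE 0 \<le> m\<close> \<open>m + Suc d \<le> n + l\<close> in auto)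
      then obtain s4 where s4: "reach iter_cost s3 s4" "mem_bdd W s4" "same n m s3 s4"
        "active s4 m v (k + 1) (F (?C (Suc k)) 1) (F (?C (Suc k)) 2)" unfolding r3 by blast
      have "reach (k * iter_cost + card (?C k) * (dfs_steps d + iter_cost) + iter_cost + dfs_steps d + iter_cost) s s4"
        by (rule reach_trans[OF reach_trans[OF reach_trans[OF s1(1) s2(1)] s3(1)] s4(1)])
      then have "reach (Suc k * iter_cost + card (?C (Suc k)) * (dfs_steps d + iter_cost)) s s4"
        unfolding cC by (rule reach_mono) simp
      then show ?thesis
        using s4(2) s4(4)[unfolded Suc_eq_plus1[symmetric]] same_trans[OF ss3 s4(3)] by blast
    qed
  qed
  have C: "?C n = {w \<in> U - {v}. {v, w} \<in> E}" using Suc.prems(4) by auto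
  obtain s' where s': "reach (n * iter_cost + card (?C n) * (dfs_steps d + iter_cost)) s s'"
    "mem_bdd W s'" "same n m s s'" "active s' m v n (F (?C n) 1) (F (?C n) 2)" using main[of n] by auto
  have "card (?C n) \<le> \<Delta>" unfolding C using card_neighbours_le[OF gr deg Suc.prems(4) v] .
  then have "reach (dfs_steps (Suc d)) s s'"
    by (intro reach_mono[OF s'(1)]) (simp add: add_mono mult_le_mono)
  moreover have "F (?C n) t = approx_marg E a c (Suc d) U g v t" for t
    unfolding C F_def f_def by simp
  ultimately show ?case using s' by (auto simp: active_def)
qed

lemma dfs_steps_le: "dfs_steps d \<le> (n + \<Delta>) * iter_cost * (2 * \<Delta> + 2) ^ d"
proof (induction d)
  case (Suc d)
  let ?A = "(n + \<Delta>) * iter_cost" and ?X = "(2 * \<Delta> + 2) ^ d"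
  have "dfs_steps (Suc d) = ?A + \<Delta> * dfs_steps d" by (simp add: algebra_simps)
  also have "\<dots> \<le> ?A * ?X + \<Delta> * (?A * ?X)" using Suc by (intro add_mono mult_le_mono2) auto
  also have "\<dots> \<le> (2 * \<Delta> + 2) * (?A * ?X)" by (simp add: algebra_simps)
  finally show ?case by (simp add: mult.left_commute)
qed simp

end

section \<open>The outer program: flips, decisions, pinning and set-up\<close>

definition com_flip_body :: com where
  "com_flip_body = Seq (Flip bCOIN (Const 0))
     (Seq (Write bU (Const 0) (Add (Mul (Const 2) (sc bU)) (sc bCOIN))) (Write bJ (Const 0) (incr (sc bJ))))"

definition com_flips :: com where
  "com_flips = Seq (Seq (Write bU (Const 0) (Const 0)) (Write bJ (Const 0) (Const 0)))
     (While (Sub (sc bK) (sc bJ)) com_flip_body)"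

definition com_root :: com where
  "com_root = Seq (Write bBASE (Const 0) (sc bM)) (Write bLIM (Const 0) (Add (sc bM) (sc bL)))"

text \<open>The product \<open>(n + 1) * (2 - s)\<close> encodes the thresholds \<open>n + 1\<close>
  for state 1 and 0 for state 2, so that the following \<open>com_push\<close> fixes the vertex
  instead of splitting it.\<close>

definition com_decide :: com where
  "com_decide = Seq (Write bOUT (sc bI)
       (ite (lt (Mul (sc bU) (Add (Read bNUM (sc bM)) (Read bDEN (sc bM))))
          (Mul (Read bNUM (sc bM)) (sc bPW))) (Const 1) (Const 2)))
     (Write bTHR (Const 0) (Mul (incr (sc bN)) (Sub (Const 2) (Read bOUT (sc bI)))))"

abbreviation (input) "com_draw_tail \<equiv> Seq com_flips (Seq com_decide com_push)"

abbreviation (input) "com_search_tail \<equiv> Seq dfs_loop com_draw_tail"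

definition com_sample :: com where
  "com_sample = Seq (Write bTHR (Const 0) (incr (sc bI))) (Seq com_start (Seq com_root
     com_search_tail))"

definition com_main_body :: com where
  "com_main_body = Seq (If (cell bMARK (sc bM) (sc bI)) Skip com_sample) (Write bI (Const 0) (incr (sc bI)))"

definition com_main :: com where
  "com_main = While (Sub (sc bN) (sc bI)) com_main_body"

definition com_pin :: "expr \<Rightarrow> nat \<Rightarrow> com" where
  "com_pin e st = Seq (Seq (Write bV (sc bM) e) (Seq (Write bOUT e (Const st))
     (Write bTHR (Const 0) (Mul (incr (sc bN)) (Const (2 - st)))))) com_push"

definition com_pins :: com where
  "com_pins = If (Read bPIN (Const 0))
     (Seq (com_pin (Read bPIN (Const 1)) 1) (com_pin (Read bPIN (Const 2)) 2)) Skip"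

definition com_power_body :: com where
  "com_power_body = Seq (Write bPW (Const 0) (Mul (Const 2) (sc bPW))) (Write bJ (Const 0) (incr (sc bJ)))"

text \<open>Doubling \<open>bP\<close> until it exceeds \<open>n\<close> takes as many passes as
  \<open>n\<close> has binary digits, and each pass adds \<open>C1\<close> to the depth.\<close>

definition com_depth_body :: "nat \<Rightarrow> com" where
  "com_depth_body C1 = Seq (Write bP (Const 0) (Mul (Const 2) (sc bP)))
     (Write bL (Const 0) (Add (sc bL) (Const C1)))"

definition com_fields_body :: com where
  "com_fields_body = Seq (Write bFN (sc bX) (Const 1)) (Seq (Write bFD (sc bX) (Const 1))
     (Write bX (Const 0) (incr (sc bX))))"

abbreviation (input) "com_fields_tail C2 \<equiv>
  Seq (Write bL (Const 0) (ite (Sub (sc bN) (Const C2)) (sc bL) (sc bN)))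
    (While (Sub (sc bN) (sc bX)) com_fields_body)"

definition com_setup :: "nat \<Rightarrow> nat \<Rightarrow> com" where
  "com_setup C1 C2 = Seq (Write bPW (Const 0) (Const 1))
     (Seq (While (Sub (sc bK) (sc bJ)) com_power_body)
     (Seq (Write bP (Const 0) (Const 1))
     (Seq (While (Sub (incr (sc bN)) (sc bP)) (com_depth_body C1))
     (com_fields_tail C2))))"

lemma floorlog_props:
  assumes "1 \<le> (n::nat)"
  shows "2 ^ (floorlog 2 n - 1) \<le> n" "n < 2 ^ floorlog 2 n" "1 \<le> floorlog 2 n" "floorlog 2 n \<le> n"
proof -
  show "2 ^ (floorlog 2 n - 1) \<le> n" "n < 2 ^ floorlog 2 n" "1 \<le> floorlog 2 n"
    using floorlog_bounds[of n 2] assms by (auto simp: floorlog_def)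
  show "floorlog 2 n \<le> n" by (rule floorlog2_le) (rule less_exp)
qed

lemma wp_straightI:
  assumes "straight_run \<beta> c s = s'" "straight_bdd \<beta> W c s" "Q s'" "straight c" "straight_steps c \<le> k"
  shows "wp \<beta> W c [] k Q s"
  using wp_straight[of c \<beta> W s Q k] assms by simp

lemma wp_Flip:
  assumes "Q (upd s b (eval \<beta> s e) (of_bool x))"
  shows "wp \<beta> W (Flip b e) [x] 1 Q s"
  unfolding wp_def using assms by (auto intro!: exI[of _ 1] bexec.Flip)

lemma wp_SeqR:
  assumes "wp \<beta> W c bs k (wp \<beta> W d [] k' Q) s" "1 + k + k' \<le> l"
  shows "wp \<beta> W (Seq c d) bs l Q s"
  using wp_mono[OF wp_SeqI[OF assms(1)] assms(2)] by auto

lemma sample_run_append: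
  assumes "length bs = K * card U" "finite U" "U \<subseteq> set xs"
  shows "sample_run E a c n l K xs U g (bs @ r) out = sample_run E a c n l K xs U g bs out"
  using assms
proof (induction xs arbitrary: U g bs out)
  case (Cons x xs)
  show ?case
  proof (cases "x \<in> U")
    case True
    have "card U = Suc (card (U - {x}))" using card.remove[OF Cons.prems(2) True] .
    then have l: "length bs = K + K * card (U - {x})" using Cons.prems(1) by simp
    have U: "U - {x} \<subseteq> set xs" "finite (U - {x})" using Cons.prems by auto
    have IH: "sample_run E a c n l K xs (U - {x}) g' (drop K bs @ r) out' =
        sample_run E a c n l K xs (U - {x}) g' (drop K bs) out'" for g' out'
      by (rule Cons.IH[OF _ U(2,1)]) (simp add: l)
    have td: "take K (bs @ r) = take K bs" "drop K (bs @ r) = drop K bs @ r" using l by simp_all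
    show ?thesis by (simp only: sample_run.simps True if_True Let_def td IH)
  next
    case False
    then have "U \<subseteq> set xs" using Cons.prems by auto
    then show ?thesis using False Cons.IH[OF Cons.prems(1,2)] by simp
  qed
qed simp

section \<open>Correctness of the outer program\<close>

context machine
begin

lemma wp_flips:
  assumes "length bs = K" "s bK 0 = K"
  shows "wp \<beta> W com_flips bs (8 * K + 10)
    (\<lambda>s'. s' bU 0 = bits_value bs \<and> (\<forall>b. b \<notin> {bU, bJ, bCOIN} \<longrightarrow> s' b = s b)) s"
proof -
  let ?Q = "\<lambda>s'. s' bU 0 = bits_value bs \<and> (\<forall>b. b \<notin> {bU, bJ, bCOIN} \<longrightarrow> s' b = s b)"
  have K: "2 ^ K \<le> (2 :: nat) ^ W" using Wbig by (intro power_increasing) auto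
  \<comment> \<open>Generalised over the flips \<open>ps\<close> already read. The body consumes a
    flip in each pass, which \<open>wp_While_count\<close> does not cover, hence a separate
    induction over the flips to come.\<close>
  have loop: "wp \<beta> W (While (Sub (sc bK) (sc bJ)) com_flip_body) rs (1 + 8 * length rs) ?Q s'"
    if "bs = ps @ rs" "s' bU 0 = bits_value ps" "s' bJ 0 = length ps"
      "\<forall>b. b \<notin> {bU, bJ, bCOIN} \<longrightarrow> s' b = s b" for ps rs s'
    using that
  proof (induction rs arbitrary: ps s')
    case Nil
    have "s' bK = s bK" using Nil(4) by simp
    then show ?case using Nil assms by (intro wp_WhileFalseI) auto
  next
    case (Cons x rs)
    have k: "s' bK = s bK" using Cons.prems(4) by simp
    have len: "length ps < K" using Cons.prems(1) assms(1) by simp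
    define s1 where "s1 = upd s' bCOIN 0 (of_bool x)"
    define s2 where "s2 = upd (upd s1 bU 0 (bits_value (ps @ [x]))) bJ 0 (length ps + 1)"
    let ?R = "Seq (Write bU (Const 0) (Add (Mul (Const 2) (sc bU)) (sc bCOIN))) (Write bJ (Const 0) (incr (sc bJ)))"
    have "bits_value (ps @ [x]) < 2 ^ length (ps @ [x])" by (rule bits_value_less)
    also have "\<dots> \<le> 2 ^ K" using len by (intro power_increasing) auto
    finally have bv: "2 * bits_value ps + of_bool x < 2 ^ W" using K unfolding bits_value_snoc by linarith
    have s1r: "s1 bU 0 = bits_value ps" "s1 bJ 0 = length ps" "s1 bCOIN 0 = of_bool x"
      using Cons.prems by (simp_all add: s1_def upd_def)
    have "wp \<beta> W (While (Sub (sc bK) (sc bJ)) com_flip_body) rs (1 + 8 * length rs) ?Q s2"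
      by (rule Cons.IH[of "ps @ [x]"]) (use Cons.prems in \<open>auto simp: s2_def s1_def upd_def\<close>)
    moreover have "straight_run \<beta> ?R s1 = s2" by (simp add: s1r s2_def upd_def)
    ultimately have "wp \<beta> W ?R [] 3 (wp \<beta> W (While (Sub (sc bK) (sc bJ)) com_flip_body) rs (1 + 8 * length rs) ?Q) s1"
      using bv small[of "length ps + 1"] len s1r by (intro wp_straight) (simp_all add: upd_def)
    then have "wp \<beta> W (Flip bCOIN (Const 0)) [x] 1
        (wp \<beta> W ?R [] 3 (wp \<beta> W (While (Sub (sc bK) (sc bJ)) com_flip_body) rs (1 + 8 * length rs) ?Q)) s'"
      by (intro wp_Flip) (simp only: s1_def eval.simps)
    then have "wp \<beta> W com_flip_body [x] 5 (wp \<beta> W (While (Sub (sc bK) (sc bJ)) com_flip_body) rs (1 + 8 * length rs) ?Q) s'"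
      unfolding com_flip_body_def by (rule wp_SeqR) simp
    then have "wp \<beta> W (While (Sub (sc bK) (sc bJ)) com_flip_body) ([x] @ rs) (1 + 5 + (1 + 8 * length rs)) ?Q s'"
      using Cons.prems(3) len assms(2) k by (intro wp_WhileTrueI) simp_all
    then have "wp \<beta> W (While (Sub (sc bK) (sc bJ)) com_flip_body) (x # rs) (1 + 5 + (1 + 8 * length rs)) ?Q s'"
      unfolding append_Cons append_Nil .
    then show ?case by (rule wp_mono) simp_all
  qed
  have "wp \<beta> W (While (Sub (sc bK) (sc bJ)) com_flip_body) bs (1 + 8 * length bs) ?Q
      (upd (upd s bU 0 0) bJ 0 0)"
    by (rule loop[of "[]"]) (auto simp: upd_def)
  then have "wp \<beta> W (Seq (Write bU (Const 0) (Const 0)) (Write bJ (Const 0) (Const 0))) [] 3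
     (wp \<beta> W (While (Sub (sc bK) (sc bJ)) com_flip_body) bs (1 + 8 * length bs) ?Q) s"
    by - (rule wp_straight; simp)
  then show ?thesis unfolding com_flips_def by (rule wp_Seq) (use assms in auto)
qed

definition sample_cost :: nat where
  "sample_cost = dfs_steps l + 8 * n + 8 * K + 60"

text \<open>The state between two samplings. Every vertex fixed so far has pushed one frame for
  good, so the level and the remaining vertices add up to \<open>n\<close>; while a vertex remains,
  this leaves enough room above \<open>m\<close> for a search of depth \<open>l\<close>.\<close>

definition ready :: "nat \<Rightarrow> nat set \<Rightarrow> (nat \<Rightarrow> nat \<Rightarrow> nat) \<Rightarrow> mem \<Rightarrow> bool" where
  "ready m U g s \<longleftrightarrow> consts_ok s \<and> mem_bdd W s \<and> frame n s m U g \<and> s bM 0 = m \<and> fields_le m g \<and>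
     U \<subseteq> {..<n} \<and> m + card U = n"

lemma wp_push_ready:
  assumes "ready m U g s" "s bV m = v" "v \<in> U" "s bTHR 0 = \<theta>"
  shows "wp \<beta> W com_push [] (8 * n + 10) (\<lambda>s'. ready (m + 1) (U - {v}) (split_fields E a c g v \<theta>) s' \<and>
    (\<forall>b. b \<notin> {bM, bX, bMARK, bFN, bFD} \<longrightarrow> s' b = s b)) s"
proof -
  have r: "consts_ok s" "mem_bdd W s" "frame n s m U g" "s bM 0 = m" "fields_le m g"
    "U \<subseteq> {..<n}" "m + card U = n" using assms(1) unfolding ready_def by auto
  have fin: "finite U" using r(6) by (rule finite_subset) simp
  have card: "card U = Suc (card (U - {v}))" using card.remove[OF fin assms(3)] .
  then have mn: "m < n" "m + 1 + card (U - {v}) = n" using r(7) by linarith+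
  have v: "v < n" using assms(3) r(6) by auto
  have "wp \<beta> W com_push [] (8 * n + 10) (push_post m v (U - {v}) (split_fields E a c g v \<theta>) s) s"
    by (rule wp_push[OF r(1-4) assms(2) v assms(4) r(5)]) (use mn(1) in simp)
  then show ?thesis
  proof (rule wp_mono_bdd[OF _ order_refl r(2) W1])
    fix s' assume p: "push_post m v (U - {v}) (split_fields E a c g v \<theta>) s s'" and b: "mem_bdd W s'"
    have "consts_ok s'" using p r(1) unfolding push_post_def consts_ok_def by auto
    moreover have "fields_le (m + 1) (split_fields E a c g v \<theta>)"
      using fields_le_split_fields[OF r(5), of v \<theta>] by (simp only: Suc_eq_plus1)
    ultimately show "ready (m + 1) (U - {v}) (split_fields E a c g v \<theta>) s' \<and>
      (\<forall>b. b \<notin> {bM, bX, bMARK, bFN, bFD} \<longrightarrow> s' b = s b)"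
      using p b r(6) mn(2) unfolding push_post_def ready_def by blast
  qed
qed

lemma wp_sample:
  assumes "ready m U g s" "s bI 0 = i" "i \<in> U" "length bs = K"
    and st: "st = decide c (approx_marg E a c l U g i 1) (approx_marg E a c l U g i 2) (bits_value bs)"
  shows "wp \<beta> W com_sample bs sample_cost (\<lambda>s'.
     ready (m + 1) (U - {i}) (split_fields E a c g i (if st = 1 then n + 1 else 0)) s' \<and>
     s' bOUT = (s bOUT)(i := st) \<and> s' bI = s bI) s"
    (is "wp _ _ _ _ _ ?Q s")
proof -
  have r: "consts_ok s" "mem_bdd W s" "frame n s m U g" "s bM 0 = m" "fields_le m g"
    "U \<subseteq> {..<n}" "m + card U = n" using assms(1) unfolding ready_def by auto
  have i: "i < n" using assms(3) r(6) by auto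
  have fin: "finite U" using r(6) by (rule finite_subset) simp
  have "0 < card U" using assms(3) fin by (auto simp: card_gt_0_iff)
  then have m: "m < n" using r(7) by simp
  have N: "s bN 0 = n" "s bL 0 = l" "s bK 0 = K" "s bPW 0 = c" using r(1) by (auto simp: consts_ok_def)
  let ?\<theta> = "if st = 1 then n + 1 else 0"
  have st12: "st = 1 \<or> st = 2" by (simp add: st decide_def)
  \<comment> \<open>The commands are treated from the last to the first, each result serving as the
    postcondition of the command before it.\<close>
  have push: "wp \<beta> W com_push [] (8 * n + 10) ?Q s5"
    if "ready m U g s5" "s5 bV m = i" "s5 bTHR 0 = ?\<theta>" "s5 bOUT = (s bOUT)(i := st)" "s5 bI = s bI" for s5
    by (rule wp_mono[OF wp_push_ready[OF that(1,2) assms(3) that(3)]]) (use that in auto)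
  have dec: "wp \<beta> W (Seq com_decide com_push) [] (8 * n + 14) ?Q s4"
    if s4: "ready m U g s4" "s4 bV m = i" "s4 bNUM m = approx_marg E a c l U g i 1" "s4 bDEN m = approx_marg E a c l U g i 2"
      "s4 bU 0 = bits_value bs" "s4 bOUT = s bOUT" "s4 bI = s bI" for s4
  proof -
    have r4: "consts_ok s4" "mem_bdd W s4" "frame n s4 m U g" "s4 bM 0 = m"
      using s4(1) unfolding ready_def by auto
    have N4: "s4 bN 0 = n" "s4 bPW 0 = c" using r4(1) by (auto simp: consts_ok_def)
    define s5 where "s5 = upd (upd s4 bOUT i st) bTHR 0 ?\<theta>"
    have straight_run: "straight_run \<beta> com_decide s4 = s5"
      using st12 by (auto simp: com_decide_def s5_def upd_def r4 N4 s4 assms(2) st decide_def)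
    have "mem_bdd W s5" unfolding s5_def
      using small[of 1] small[of 2] small[of "n + 1"] r4(2) st12 by (intro mem_bdd_upd) auto
    then have r5: "ready m U g s5" using s4(1)
      by (simp add: ready_def consts_ok_def frame_def s5_def upd_def)
    have q: "wp \<beta> W com_push [] (8 * n + 10) ?Q s5"
      by (rule push[OF r5]) (use s4 in \<open>auto simp: s5_def upd_def\<close>)
    have bd: "straight_bdd \<beta> W com_decide s4"
      using small[of 1] small[of 2] small[of "n + 1"]
      by (auto simp: com_decide_def upd_def r4 N4 s4 assms(2))
    have "wp \<beta> W com_decide [] 3 (wp \<beta> W com_push [] (8 * n + 10) ?Q) s4"
      by (rule wp_straightI[where Q = "wp \<beta> W com_push [] (8 * n + 10) ?Q", OF straight_run bd q])
        (simp_all add: com_decide_def)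
    then show ?thesis by (rule wp_Seq) simp
  qed
  have flips: "wp \<beta> W com_draw_tail bs (8 * n + 8 * K + 25) ?Q s3"
    if s3: "ready m U g s3" "s3 bV m = i" "s3 bNUM m = approx_marg E a c l U g i 1" "s3 bDEN m = approx_marg E a c l U g i 2"
      "s3 bOUT = s bOUT" "s3 bI = s bI" for s3
  proof -
    have r3: "consts_ok s3" "mem_bdd W s3" using s3(1) unfolding ready_def by auto
    have K3: "s3 bK 0 = K" using r3 by (simp add: consts_ok_def)
    have "wp \<beta> W com_flips bs (8 * K + 10) (wp \<beta> W (Seq com_decide com_push) [] (8 * n + 14) ?Q) s3"
    proof (rule wp_mono_bdd[OF wp_flips[where s = s3] order_refl r3(2) W1])
      fix s4 assume s4: "s4 bU 0 = bits_value bs \<and> (\<forall>b. b \<notin> {bU, bJ, bCOIN} \<longrightarrow> s4 b = s3 b)" "mem_bdd W s4"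
      have "ready m U g s4" using s3(1) s4 by (simp add: ready_def consts_ok_def frame_def)
      then show "wp \<beta> W (Seq com_decide com_push) [] (8 * n + 14) ?Q s4"
        by (rule dec) (use s3 s4 in auto)
    qed (use assms(4) K3 in auto)
    then show ?thesis by (rule wp_SeqR) simp
  qed
  have loop: "wp \<beta> W com_search_tail bs
      (dfs_steps l + 8 * n + 8 * K + 27) ?Q s2"
    if s2: "ready m U g s2" "active s2 m i 0 (g i 1) (g i 2)" "s2 bBASE 0 = m" "s2 bLIM 0 = m + l"
      "s2 bOUT = s bOUT" "s2 bI = s bI" for s2
  proof -
    have r2: "consts_ok s2" "mem_bdd W s2" "frame n s2 m U g"
      using s2(1) unfolding ready_def by auto
    obtain s3 where s3: "reach (dfs_steps l) s2 s3" "mem_bdd W s3" "same n m s2 s3" "s3 bM 0 = m"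
      "s3 bW m = n \<or> l = 0" "s3 bNUM m = approx_marg E a c l U g i 1" "s3 bDEN m = approx_marg E a c l U g i 2"
      using dfs[OF r2 r(6) assms(3) s2(2) _ s2(4) _ order_refl r(5)] s2(3) m by auto
    have c3: "consts_ok s3" using consts_same[OF r2(1) s3(3)] .
    have f3: "frame n s3 m U g" using frame_same[OF r2(3) s3(3)] by simp
    have b3: "s3 bBASE = s2 bBASE" "s3 bLIM = s2 bLIM" "s3 bOUT = s2 bOUT" "s3 bI = s2 bI" "s3 bV m = s2 bV m"
      using s3(3) unfolding same_def by auto
    have "ready m U g s3" using c3 f3 s3 r unfolding ready_def by simp
    then have fl: "wp \<beta> W com_draw_tail bs (8 * n + 8 * K + 25) ?Q s3"
      by (rule flips) (use b3 s2 s3 in \<open>auto simp: active_def\<close>)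
    have "eval \<beta> s3 dfs_cond = 0"
      using s3(4,5) b3 s2(3,4) c3 by (auto simp: dfs_cond_def can_advance_def consts_ok_def)
    from wp_WhileFalseI[where Q = "wp \<beta> W com_draw_tail bs (8 * n + 8 * K + 25) ?Q",
        OF this fl order_refl]
    have "wp \<beta> W dfs_loop [] (1 + dfs_steps l)
      (wp \<beta> W com_draw_tail bs (8 * n + 8 * K + 25) ?Q) s2"
      using s3(1) unfolding reach_def by blast
    then show ?thesis by (rule wp_Seq) simp
  qed
  have root: "wp \<beta> W (Seq com_root com_search_tail) bs
      (dfs_steps l + 8 * n + 8 * K + 31) ?Q s1"
    if s1: "ready m U g s1" "active s1 m i 0 (g i 1) (g i 2)" "s1 bOUT = s bOUT" "s1 bI = s bI" for s1
  proof -
    have r1: "consts_ok s1" "mem_bdd W s1" "s1 bM 0 = m" using s1(1) unfolding ready_def by auto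
    have N1: "s1 bL 0 = l" using r1(1) by (auto simp: consts_ok_def)
    define s2 where "s2 = upd (upd s1 bBASE 0 m) bLIM 0 (m + l)"
    have straight_run: "straight_run \<beta> com_root s1 = s2" by (simp add: com_root_def s2_def upd_def r1 N1)
    have b: "mem_bdd W s2" unfolding s2_def
      using small[of m] small[of "m + l"] m r1 by (intro mem_bdd_upd) auto
    have "ready m U g s2" using s1(1) b by (simp add: ready_def consts_ok_def frame_def s2_def upd_def)
    then have q: "wp \<beta> W com_search_tail bs
      (dfs_steps l + 8 * n + 8 * K + 27) ?Q s2"
      by (rule loop) (use s1 in \<open>auto simp: active_def s2_def upd_def\<close>)
    have bd: "straight_bdd \<beta> W com_root s1"
      using small[of m] small[of "m + l"] m by (simp add: com_root_def upd_def r1 N1)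
    have "wp \<beta> W com_root [] 3 (wp \<beta> W com_search_tail bs
      (dfs_steps l + 8 * n + 8 * K + 27) ?Q) s1"
      by (rule wp_straightI[where Q = "wp \<beta> W com_search_tail bs (dfs_steps l + 8 * n + 8 * K + 27) ?Q", OF straight_run bd q])
        (simp_all add: com_root_def)
    then show ?thesis by (rule wp_Seq) simp
  qed
  let ?rest = "Seq com_root com_search_tail"
  define s0 where "s0 = upd s bTHR 0 (i + 1)"
  have b0: "mem_bdd W s0" unfolding s0_def using small[of "i + 1"] i r by (intro mem_bdd_upd) auto
  have r0: "ready m U g s0" using r b0 by (simp add: ready_def consts_ok_def frame_def s0_def upd_def)
  have "wp \<beta> W com_start [] 7 (wp \<beta> W ?rest bs (dfs_steps l + 8 * n + 8 * K + 31) ?Q) s0"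
  proof (rule wp_mono_bdd[OF wp_start order_refl b0 W1])
    fix s1 assume s1: "active s1 m i 0 (g i 1) (g i 2) \<and>
      (\<forall>b. b \<notin> {bV, bW, bNUM, bDEN} \<longrightarrow> s1 b = s0 b) \<and>
      (\<forall>b\<in>{bV, bW, bNUM, bDEN}. \<forall>j. j \<noteq> m \<longrightarrow> s1 b j = s0 b j)" and b1: "mem_bdd W s1"
    have "ready m U g s1" using r0 s1 b1 by (simp add: ready_def consts_ok_def frame_def)
    then show "wp \<beta> W ?rest bs (dfs_steps l + 8 * n + 8 * K + 31) ?Q s1"
      by (rule root) (use s1 in \<open>auto simp: s0_def upd_def\<close>)
  qed (use r0 b0 i in \<open>auto simp: ready_def, auto simp: s0_def upd_def\<close>)
  then have "wp \<beta> W (Seq com_start ?rest) bs (dfs_steps l + 8 * n + 8 * K + 39) ?Q s0"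
    by (rule wp_Seq) simp
  then have "wp \<beta> W (Write bTHR (Const 0) (incr (sc bI))) [] 1
      (wp \<beta> W (Seq com_start ?rest) bs (dfs_steps l + 8 * n + 8 * K + 39) ?Q) s"
    using small[of "i + 1"] i by - (rule wp_straight; simp add: assms(2) s0_def)
  then show ?thesis unfolding com_sample_def by (rule wp_Seq) (simp add: sample_cost_def)
qed

lemma wp_main:
  assumes "ready m U g s" "s bI 0 = i" "i \<le> n" "U \<subseteq> {i..<n}" "length bs = K * card U"
  shows "wp \<beta> W com_main bs (1 + (n - i) * (sample_cost + 10))
    (\<lambda>s'. s' bOUT = sample_run E a c n l K [i..<n] U g bs (s bOUT)) s"
  using assms
proof (induction "n - i" arbitrary: i m U g s bs)
  case 0
  have i: "i = n" using 0(1,4) by simp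
  have U: "U = {}" using 0(5) i by simp
  have N: "s bN 0 = n" using 0(2) unfolding ready_def consts_ok_def by blast
  have bs: "bs = []" using 0(6) U by simp
  show ?case unfolding com_main_def bs by (rule wp_WhileFalseI) (simp_all add: N 0(3) i U)
next
  case (Suc k)
  note IH = Suc.hyps(1)
  have i: "i < n" using Suc.hyps(2) by simp
  have r: "consts_ok s" "mem_bdd W s" "frame n s m U g" "s bM 0 = m"
    "U \<subseteq> {..<n}" "m + card U = n" using Suc.prems(1) unfolding ready_def by auto
  have N: "s bN 0 = n" using r by (auto simp: consts_ok_def)
  have mark: "s bMARK (m * n + i) = 0 \<longleftrightarrow> i \<in> U" using r(3) i by (auto simp: frame_def)
  have fin: "finite U" using r(5) by (rule finite_subset) simp
  have upt: "[i..<n] = i # [Suc i..<n]" using i by (simp add: upt_conv_Cons)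
  let ?Q = "\<lambda>s'. s' bOUT = sample_run E a c n l K [i..<n] U g bs (s bOUT)"
  define k1 where "k1 = 1 + (n - (i + 1)) * (sample_cost + 10)"
  have inc: "wp \<beta> W (Write bI (Const 0) (incr (sc bI))) [] 1 (wp \<beta> W com_main bs2 k1 ?Q) s1"
    if s1: "ready m' U' g' s1" "s1 bI 0 = i" "U' \<subseteq> {i + 1..<n}" "length bs2 = K * card U'"
      "sample_run E a c n l K [Suc i..<n] U' g' bs2 (s1 bOUT) = sample_run E a c n l K [i..<n] U g bs (s bOUT)"
    for m' U' g' s1 bs2
  proof -
    define s2 where "s2 = upd s1 bI 0 (i + 1)"
    have b: "mem_bdd W s2" unfolding s2_def using s1(1) small[of "i + 1"] i
      by (intro mem_bdd_upd) (auto simp: ready_def)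
    have "ready m' U' g' s2" using s1(1) b by (simp add: ready_def consts_ok_def frame_def s2_def upd_def)
    then have r2: "ready m' U' g' s2" .
    have I2: "s2 bI 0 = i + 1" by (simp add: s2_def upd_def)
    have k: "k = n - (i + 1)" using Suc.hyps(2) by simp
    have "wp \<beta> W com_main bs2 k1 (\<lambda>s'. s' bOUT = sample_run E a c n l K [i + 1..<n] U' g' bs2 (s2 bOUT)) s2"
      unfolding k1_def by (rule IH[OF k r2 I2 _ s1(3,4)]) (use i in simp)
    moreover have "s2 bOUT = s1 bOUT" by (simp add: s2_def upd_def)
    ultimately have "wp \<beta> W com_main bs2 k1 ?Q s2"
      using s1(5) unfolding Suc_eq_plus1 by simp
    then show ?thesis using small[of "i + 1"] i
      by - (rule wp_straight; simp add: s1(2) s2_def)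
  qed
  \<comment> \<open>\<open>bs1\<close> is the share of vertex \<open>i\<close>: no flips if it has
    already been removed, and the next \<open>K\<close> flips otherwise.\<close>
  obtain bs1 bs2 where bs: "bs = bs1 @ bs2" "wp \<beta> W (If (cell bMARK (sc bM) (sc bI)) Skip com_sample) bs1
      (1 + sample_cost) (wp \<beta> W (Write bI (Const 0) (incr (sc bI))) [] 1 (wp \<beta> W com_main bs2 k1 ?Q)) s"
  proof (cases "i \<in> U")
    case False
    have U: "U \<subseteq> {i + 1..<n}"
    proof
      fix x assume "x \<in> U"
      then have "x \<in> {i..<n}" "x \<noteq> i" using Suc.prems(4) False by auto
      then show "x \<in> {i + 1..<n}" by auto
    qed
    have "wp \<beta> W (Write bI (Const 0) (incr (sc bI))) [] 1 (wp \<beta> W com_main bs k1 ?Q) s"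
      by (rule inc[OF Suc.prems(1,2) U Suc.prems(5)]) (simp add: upt False)
    then have "wp \<beta> W Skip [] 1 (wp \<beta> W (Write bI (Const 0) (incr (sc bI))) [] 1 (wp \<beta> W com_main bs k1 ?Q)) s"
      by - (rule wp_straight; simp)
    then have "wp \<beta> W Skip [] sample_cost (wp \<beta> W (Write bI (Const 0) (incr (sc bI))) [] 1 (wp \<beta> W com_main bs k1 ?Q)) s"
      by (rule wp_mono) (simp_all add: sample_cost_def)
    then have "wp \<beta> W (If (cell bMARK (sc bM) (sc bI)) Skip com_sample) []
      (1 + sample_cost) (wp \<beta> W (Write bI (Const 0) (incr (sc bI))) [] 1 (wp \<beta> W com_main bs k1 ?Q)) s"
      using mark False by (intro wp_IfI) (simp_all add: r N Suc.prems(2))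
    then show ?thesis by (intro that[of "[]" bs]) simp_all
  next
    case True
    have card: "card U = Suc (card (U - {i}))" using card.remove[OF fin True] .
    define st where "st = decide c (approx_marg E a c l U g i 1) (approx_marg E a c l U g i 2) (bits_value (take K bs))"
    let ?g = "split_fields E a c g i (if st = 1 then n + 1 else 0)"
    have U: "U - {i} \<subseteq> {i + 1..<n}"
    proof
      fix x assume "x \<in> U - {i}"
      then have "x \<in> {i..<n}" "x \<noteq> i" using Suc.prems(4) by auto
      then show "x \<in> {i + 1..<n}" by auto
    qed
    have len: "length (take K bs) = K" "length (drop K bs) = K * card (U - {i})"
      using Suc.prems(5) unfolding card by simp_all
    have "wp \<beta> W com_sample (take K bs) sample_cost
      (wp \<beta> W (Write bI (Const 0) (incr (sc bI))) [] 1 (wp \<beta> W com_main (drop K bs) k1 ?Q)) s"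
    proof (rule wp_mono[OF wp_sample[OF Suc.prems(1,2) True len(1) st_def] order_refl])
      fix s1 assume s1: "ready (m + 1) (U - {i}) ?g s1 \<and> s1 bOUT = (s bOUT)(i := st) \<and> s1 bI = s bI"
      show "wp \<beta> W (Write bI (Const 0) (incr (sc bI))) [] 1 (wp \<beta> W com_main (drop K bs) k1 ?Q) s1"
      proof (rule inc[OF _ _ U len(2)])
        show "sample_run E a c n l K [Suc i..<n] (U - {i}) ?g (drop K bs) (s1 bOUT) =
          sample_run E a c n l K [i..<n] U g bs (s bOUT)"
          unfolding upt sample_run.simps using True s1 by (simp add: Let_def st_def del: fun_upd_apply)
      qed (use s1 Suc.prems(2) in auto)
    qed
    then have "wp \<beta> W (If (cell bMARK (sc bM) (sc bI)) Skip com_sample) (take K bs)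
      (1 + sample_cost) (wp \<beta> W (Write bI (Const 0) (incr (sc bI))) [] 1 (wp \<beta> W com_main (drop K bs) k1 ?Q)) s"
      using mark True by (intro wp_IfI) (simp_all add: r N Suc.prems(2))
    then show ?thesis by (intro that[of "take K bs" "drop K bs"]) simp_all
  qed
  have "wp \<beta> W com_main_body bs1 (sample_cost + 4) (wp \<beta> W com_main bs2 k1 ?Q) s"
    unfolding com_main_body_def by (rule wp_SeqR[OF bs(2)]) simp
  then have "wp \<beta> W com_main (bs1 @ bs2) (1 + (sample_cost + 4) + k1) ?Q s"
    unfolding com_main_def using i by (intro wp_WhileTrueI) (simp_all add: N Suc.prems(2))
  then show ?case unfolding bs(1)[symmetric]
  proof (rule wp_mono)
    have "n - i = Suc (n - (i + 1))" using i by simp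
    then show "1 + (sample_cost + 4) + k1 \<le> 1 + (n - i) * (sample_cost + 10)" by (simp add: k1_def)
  qed
qed

text \<open>The expression \<open>e\<close> is evaluated again after \<open>bV\<close> has been
  overwritten, hence the hypothesis that its value is determined by \<open>bPIN\<close>.\<close>

lemma wp_pin:
  assumes "ready m U g s" "eval \<beta> s e = x" "x \<in> U" "st \<in> {1, 2}"
    "\<And>s'. s' bPIN = s bPIN \<Longrightarrow> eval \<beta> s' e = x"
  shows "wp \<beta> W (com_pin e st) [] (8 * n + 20) (\<lambda>s'.
     ready (m + 1) (U - {x}) (split_fields E a c g x (if st = 1 then n + 1 else 0)) s' \<and>
     s' bOUT = (s bOUT)(x := st) \<and> s' bI = s bI \<and> s' bPIN = s bPIN) s"
    (is "wp _ _ _ _ _ ?Q s")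
proof -
  have r: "consts_ok s" "mem_bdd W s" "frame n s m U g" "s bM 0 = m" "fields_le m g"
    "U \<subseteq> {..<n}" "m + card U = n" using assms(1) unfolding ready_def by auto
  have x: "x < n" using assms(3) r(6) by auto
  have N: "s bN 0 = n" using r by (auto simp: consts_ok_def)
  let ?\<theta> = "if st = 1 then n + 1 else 0"
  let ?c = "Seq (Write bV (sc bM) e) (Seq (Write bOUT e (Const st))
     (Write bTHR (Const 0) (Mul (incr (sc bN)) (Const (2 - st)))))"
  define s1 where "s1 = upd (upd (upd s bV m x) bOUT x st) bTHR 0 ?\<theta>"
  have e: "eval \<beta> (s(bV := (s bV)(m := x))) e = x" by (rule assms(5)) simp
  have straight_run: "straight_run \<beta> ?c s = s1" using assms(4) by (auto simp: s1_def assms(2) r e N upd_def)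
  have bd: "straight_bdd \<beta> W ?c s" using small[of x] small[of st] small[of "n + 1"] x assms(4)
    by (auto simp: assms(2) r e N upd_def)
  have b: "mem_bdd W s1" unfolding s1_def
    using small[of x] small[of st] small[of "n + 1"] x assms(4) r(2) by (intro mem_bdd_upd) auto
  have "ready m U g s1" using assms(1) b by (simp add: ready_def consts_ok_def frame_def s1_def upd_def)
  from wp_push_ready[OF this _ assms(3), of ?\<theta>]
  have "wp \<beta> W com_push [] (8 * n + 10) (\<lambda>s'. ready (m + 1) (U - {x}) (split_fields E a c g x ?\<theta>) s' \<and>
    (\<forall>b. b \<notin> {bM, bX, bMARK, bFN, bFD} \<longrightarrow> s' b = s1 b)) s1"
    by (simp add: s1_def upd_def)
  then have q: "wp \<beta> W com_push [] (8 * n + 10) ?Q s1"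
    by (rule wp_mono) (auto simp: s1_def upd_def)
  have "wp \<beta> W ?c [] 5 (wp \<beta> W com_push [] (8 * n + 10) ?Q) s"
    by (rule wp_straightI[where Q = "wp \<beta> W com_push [] (8 * n + 10) ?Q", OF straight_run bd q]) simp_all
  then show ?thesis unfolding com_pin_def by (rule wp_Seq) simp
qed

lemma wp_setup:
  assumes s: "s bN 0 = n" "s bK 0 = K" "s bBE 0 = a" "mem_bdd W s" "\<And>b i. 6 \<le> b \<Longrightarrow> s b i = 0"
    "\<And>x y. x < n \<Longrightarrow> y < n \<Longrightarrow> s bADJ (x * n + y) = of_bool ({x, y} \<in> E)"
    and l: "l = (if n \<le> C2 then n else C1 * floorlog 2 n)" and C1: "C1 * n + 2 * n + C1 < 2 ^ W" and n: "1 \<le> n"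
  shows "wp \<beta> W (com_setup C1 C2) [] (20 * n + 10 * K + 30) (\<lambda>s'. ready 0 {..<n} (\<lambda>_ _. 1) s' \<and>
    s' bI 0 = 0 \<and> s' bOUT = s bOUT \<and> s' bPIN = s bPIN) s"
    (is "wp _ _ _ _ _ ?Q s")
proof -
  have K: "2 ^ K < (2 :: nat) ^ W" using Wbig by (intro power_strict_increasing) auto
  let ?f = "floorlog 2 n"
  note f = floorlog_props(1-3)[OF n] and fn = floorlog_props(4)[OF n]
  have i_f: "2 ^ i \<le> n" if "i < ?f" for i
    by (rule order_trans[OF power_increasing f(1)]) (use that in auto)
  define s1 where "s1 = s(bPW := (s bPW)(0 := 2 ^ K), bJ := (s bJ)(0 := K))"
  define s2 where "s2 = s1(bP := (s1 bP)(0 := 2 ^ ?f), bL := (s1 bL)(0 := C1 * ?f))"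
  define s3 where "s3 = upd s2 bL 0 l"
  have s1_0: "s1 bP 0 = 0" "s1 bL 0 = 0" "s1 bN = s bN" using s(5) by (simp_all add: s1_def)
  have s2_0: "s2 bX 0 = 0" "s2 bN = s bN" "s2 bL 0 = C1 * ?f" using s(5) by (simp_all add: s2_def s1_def)
  have fin: "wp \<beta> W (While (Sub (sc bN) (sc bX)) com_fields_body) [] (1 + n * (1 + 5)) ?Q s3" if b3: "mem_bdd W s3"
  proof -
    define J where "J i s' \<longleftrightarrow> mem_bdd W s' \<and> s' bX 0 = i \<and>
      (\<forall>b. b \<notin> {bX, bFN, bFD} \<longrightarrow> s' b = s3 b) \<and>
      (\<forall>x<i. s' bFN x = 1 \<and> s' bFD x = 1)" for i s'
    have "wp \<beta> W (While (Sub (sc bN) (sc bX)) com_fields_body) [] (1 + n * (1 + 5)) (J n) s3"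
    proof (rule wp_While_count)
      show "J 0 s3" using b3 s(5) by (simp add: J_def s3_def s2_def s1_def upd_def)
      show "eval \<beta> s' (Sub (sc bN) (sc bX)) = 0" if "J n s'" for s'
        using that s(1) by (auto simp: J_def s3_def s2_def s1_def upd_def)
      fix i s' assume i: "i < n" and J: "J i s'"
      have s': "s' bX 0 = i" "s' bN = s bN" using J by (auto simp: J_def s3_def s2_def s1_def upd_def)
      define s4 where "s4 = upd (upd (upd s' bFN i 1) bFD i 1) bX 0 (i + 1)"
      have straight_run: "straight_run \<beta> com_fields_body s' = s4" by (simp add: com_fields_body_def s4_def s' upd_def)
      have b4: "mem_bdd W s4" unfolding s4_def using J small[of 1] small[of "i + 1"] i
        by (intro mem_bdd_upd) (auto simp: J_def)
      have J4: "J (Suc i) s4" using J b4 unfolding J_def s4_def upd_def by (auto simp: less_Suc_eq)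
      have bd: "straight_bdd \<beta> W com_fields_body s'"
        using small[of 1] small[of "i + 1"] i by (simp add: com_fields_body_def s' upd_def)
      have "wp \<beta> W com_fields_body [] 5 (J (Suc i)) s'"
        by (rule wp_straightI[where Q = "J (Suc i)", OF straight_run bd J4]) (simp_all add: com_fields_body_def)
      then show "eval \<beta> s' (Sub (sc bN) (sc bX)) \<noteq> 0 \<and> wp \<beta> W com_fields_body [] 5 (J (Suc i)) s'"
        using i s' s(1) by simp
    qed
    then show ?thesis
    proof (rule wp_mono[OF _ order_refl])
      fix s' assume J: "J n s'"
      have o: "s' b = s3 b" if "b \<notin> {bX, bFN, bFD}" for b using J that unfolding J_def by blast
      have "consts_ok s'" unfolding consts_ok_def
        using s by (simp add: o s3_def s2_def s1_def upd_def cK)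
      moreover have "frame n s' 0 {..<n} (\<lambda>_ _. 1)"
        using J s(5) by (auto simp: frame_def J_def s3_def s2_def s1_def upd_def)
      moreover have "s' bM 0 = 0" "s' bI 0 = 0" "s' bOUT = s bOUT" "s' bPIN = s bPIN"
        using s(5) by (simp_all add: o s3_def s2_def s1_def upd_def)
      ultimately show "?Q s'" using J by (simp add: ready_def J_def fields_le_def)
    qed
  qed
  have lW: "l < 2 ^ W" using small[of l] by simp
  have cL: "wp \<beta> W (com_fields_tail C2) [] (6 * n + 4) ?Q s2" if b2: "mem_bdd W s2"
  proof -
    have b3: "mem_bdd W s3" unfolding s3_def using b2 lW by (rule mem_bdd_upd)
    have "eval \<beta> s2 (ite (Sub (sc bN) (Const C2)) (sc bL) (sc bN)) = l"
      using s(1) s2_0 l by auto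
    then have "wp \<beta> W (Write bL (Const 0) (ite (Sub (sc bN) (Const C2)) (sc bL) (sc bN))) [] 1
      (wp \<beta> W (While (Sub (sc bN) (sc bX)) com_fields_body) [] (1 + n * (1 + 5)) ?Q) s2"
      using fin[OF b3] lW by (intro wp_straight[where c = "Write _ _ _"]) (simp_all add: s3_def del: eval_macros)
    then show ?thesis by (rule wp_Seq) simp
  qed
  have dep: "wp \<beta> W (Seq (While (Sub (incr (sc bN)) (sc bP)) (com_depth_body C1))
      (com_fields_tail C2)) [] (10 * n + 6) ?Q (upd s1 bP 0 1)" if b1: "mem_bdd W s1"
  proof -
    define J where "J i s' \<longleftrightarrow> mem_bdd W s' \<and> s' = s1(bP := (s1 bP)(0 := 2 ^ i), bL := (s1 bL)(0 := C1 * i))" for i s'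
    have "wp \<beta> W (While (Sub (incr (sc bN)) (sc bP)) (com_depth_body C1)) [] (1 + ?f * (1 + 3)) (J ?f) (upd s1 bP 0 1)"
    proof (rule wp_While_count)
      have "mem_bdd W (upd s1 bP 0 1)" using b1 small[of 1] by (intro mem_bdd_upd) auto
      moreover have "(s1 bL)(0 := 0) = s1 bL" using s1_0 by (simp add: fun_upd_idem)
      then have "upd s1 bP 0 1 = s1(bP := (s1 bP)(0 := 2 ^ 0), bL := (s1 bL)(0 := C1 * 0))"
        by (simp add: upd_def fun_eq_iff)
      ultimately show "J 0 (upd s1 bP 0 1)" by (simp add: J_def)
      show "eval \<beta> s' (Sub (incr (sc bN)) (sc bP)) = 0" if "J ?f s'" for s'
        using that f s(1) s1_0 by (auto simp: J_def)
      fix i s' assume i: "i < ?f" and J: "J i s'"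
      have s': "s' = s1(bP := (s1 bP)(0 := 2 ^ i), bL := (s1 bL)(0 := C1 * i))" "mem_bdd W s'"
        using J by (auto simp: J_def)
      define s4 where "s4 = s1(bP := (s1 bP)(0 := 2 ^ Suc i), bL := (s1 bL)(0 := C1 * Suc i))"
      have straight_run: "straight_run \<beta> (com_depth_body C1) s' = s4"
        by (simp add: com_depth_body_def s4_def s' upd_def fun_eq_iff)
      have "C1 * i \<le> C1 * n" using i fn by (intro mult_le_mono2) simp
      \<comment> \<open>\<open>bP\<close> reaches at most \<open>2 * n\<close> and \<open>bL\<close>
        at most \<open>C1 * n + C1\<close>; this is the origin of the summands in the bound on
        \<open>2 ^ W\<close>.\<close>
      then have v: "2 * 2 ^ i < (2::nat) ^ W" "C1 * i + C1 < 2 ^ W" using i_f[OF i] C1 by linarith+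
      have bd: "straight_bdd \<beta> W (com_depth_body C1) s'"
        using v by (simp add: com_depth_body_def s' upd_def)
      have "mem_bdd W (straight_run \<beta> (com_depth_body C1) s')"
        using bexec_mem_bdd[OF bexec_straight[OF _ bd, of "[]"]] s'(2) W1 by (simp add: com_depth_body_def)
      then have J4: "J (Suc i) s4" unfolding J_def straight_run by (simp add: s4_def)
      have "wp \<beta> W (com_depth_body C1) [] 3 (J (Suc i)) s'"
        by (rule wp_straightI[where Q = "J (Suc i)", OF straight_run bd J4]) (simp_all add: com_depth_body_def)
      moreover have "2 ^ i < n + 1" using i_f[OF i] by linarith
      ultimately show "eval \<beta> s' (Sub (incr (sc bN)) (sc bP)) \<noteq> 0 \<and> wp \<beta> W (com_depth_body C1) [] 3 (J (Suc i)) s'"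
        using s(1) by (simp add: s' s1_0)
    qed
    then have "wp \<beta> W (While (Sub (incr (sc bN)) (sc bP)) (com_depth_body C1)) [] (1 + ?f * (1 + 3))
      (wp \<beta> W (com_fields_tail C2) [] (6 * n + 4) ?Q) (upd s1 bP 0 1)"
      by (rule wp_mono[OF _ order_refl]) (use cL in \<open>auto simp: J_def s2_def\<close>)
    then show ?thesis by (rule wp_Seq) (use fn in simp)
  qed
  define R where "R = Seq (While (Sub (incr (sc bN)) (sc bP)) (com_depth_body C1))
      (com_fields_tail C2)"
  have pw: "wp \<beta> W (Seq (While (Sub (sc bK) (sc bJ)) com_power_body) (Seq (Write bP (Const 0) (Const 1)) R)) []
     (10 * n + 4 * K + 10) ?Q (upd s bPW 0 1)"
  proof -
    define J where "J i s' \<longleftrightarrow> mem_bdd W s' \<and> s' = s(bPW := (s bPW)(0 := 2 ^ i), bJ := (s bJ)(0 := i))" for i s'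
    have "wp \<beta> W (While (Sub (sc bK) (sc bJ)) com_power_body) [] (1 + K * (1 + 3)) (J K) (upd s bPW 0 1)"
    proof (rule wp_While_count)
      have "mem_bdd W (upd s bPW 0 1)" using s(4) small[of 1] by (intro mem_bdd_upd) auto
      moreover have "(s bJ)(0 := 0) = s bJ" using s(5) by (simp add: fun_upd_idem)
      then have "upd s bPW 0 1 = s(bPW := (s bPW)(0 := 2 ^ 0), bJ := (s bJ)(0 := 0))"
        by (simp add: upd_def fun_eq_iff)
      ultimately show "J 0 (upd s bPW 0 1)" by (simp add: J_def)
      show "eval \<beta> s' (Sub (sc bK) (sc bJ)) = 0" if "J K s'" for s'
        using that s(2) by (auto simp: J_def)
      fix i s' assume i: "i < K" and J: "J i s'"
      have s': "s' = s(bPW := (s bPW)(0 := 2 ^ i), bJ := (s bJ)(0 := i))" "mem_bdd W s'"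
        using J by (auto simp: J_def)
      define s4 where "s4 = s(bPW := (s bPW)(0 := 2 ^ Suc i), bJ := (s bJ)(0 := Suc i))"
      have straight_run: "straight_run \<beta> com_power_body s' = s4"
        by (simp add: com_power_body_def s4_def s' upd_def fun_eq_iff)
      have "(2::nat) ^ Suc i \<le> 2 ^ K" using i by (intro power_increasing) auto
      then have v: "2 * 2 ^ i < (2::nat) ^ W" using K unfolding power_Suc by linarith
      have bd: "straight_bdd \<beta> W com_power_body s'"
        using v small[of "i + 1"] i by (simp add: com_power_body_def s' upd_def)
      have "mem_bdd W (straight_run \<beta> com_power_body s')"
        using bexec_mem_bdd[OF bexec_straight[OF _ bd, of "[]"]] s'(2) W1 by (simp add: com_power_body_def)
      then have J4: "J (Suc i) s4" unfolding J_def straight_run by (simp add: s4_def)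
      have "wp \<beta> W com_power_body [] 3 (J (Suc i)) s'"
        by (rule wp_straightI[where Q = "J (Suc i)", OF straight_run bd J4]) (simp_all add: com_power_body_def)
      then show "eval \<beta> s' (Sub (sc bK) (sc bJ)) \<noteq> 0 \<and> wp \<beta> W com_power_body [] 3 (J (Suc i)) s'"
        using s(2) i by (simp add: s')
    qed
    then have "wp \<beta> W (While (Sub (sc bK) (sc bJ)) com_power_body) [] (1 + K * (1 + 3))
      (wp \<beta> W (Seq (Write bP (Const 0) (Const 1)) R) [] (10 * n + 8) ?Q) (upd s bPW 0 1)"
    proof (rule wp_mono[OF _ order_refl])
      fix s' assume "J K s'"
      then have s': "s' = s1" "mem_bdd W s1" by (auto simp: J_def s1_def)
      have "wp \<beta> W (Write bP (Const 0) (Const 1)) [] 1 (wp \<beta> W R [] (10 * n + 6) ?Q) s1"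
        using dep[OF s'(2)] small[of 1] by - (rule wp_straight; simp add: R_def)
      then show "wp \<beta> W (Seq (Write bP (Const 0) (Const 1)) R) [] (10 * n + 8) ?Q s'"
        unfolding s' by (rule wp_Seq) simp
    qed
    then show ?thesis by (rule wp_Seq) simp
  qed
  then have "wp \<beta> W (Write bPW (Const 0) (Const 1)) [] 1
     (wp \<beta> W (Seq (While (Sub (sc bK) (sc bJ)) com_power_body) (Seq (Write bP (Const 0) (Const 1)) R)) []
     (10 * n + 4 * K + 10) ?Q) s"
    using small[of 1] by - (rule wp_straight; simp)
  then show ?thesis unfolding com_setup_def R_def[symmetric] by (rule wp_Seq) simp
qed

end

section \<open>The complete sampler and its runs\<close>

definition start_set :: "nat \<Rightarrow> (nat \<times> nat) option \<Rightarrow> nat set" where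
  "start_set n q = (case q of None \<Rightarrow> {..<n} | Some (u, v) \<Rightarrow> {..<n} - {u} - {v})"

definition start_fields :: "nat set set \<Rightarrow> nat \<Rightarrow> nat \<Rightarrow> nat \<Rightarrow> (nat \<times> nat) option \<Rightarrow> (nat \<Rightarrow> nat \<Rightarrow> nat)" where
  "start_fields E a c n q = (case q of None \<Rightarrow> (\<lambda>_ _. 1)
     | Some (u, v) \<Rightarrow> split_fields E a c (split_fields E a c (\<lambda>_ _. 1) u (n + 1)) v 0)"

definition start_out :: "(nat \<times> nat) option \<Rightarrow> nat \<Rightarrow> nat" where
  "start_out q = (case q of None \<Rightarrow> (\<lambda>_. 0) | Some (u, v) \<Rightarrow> (\<lambda>_. 0)(u := 1, v := 2))"

definition query_ok :: "nat \<Rightarrow> (nat \<times> nat) option \<Rightarrow> bool" where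
  "query_ok n q \<longleftrightarrow> (case q of None \<Rightarrow> True | Some (u, v) \<Rightarrow> u < n \<and> v < n \<and> u \<noteq> v)"

definition com_rest :: "nat \<Rightarrow> nat \<Rightarrow> com" where
  "com_rest C1 C2 = Seq (com_setup C1 C2) (Seq com_pins com_main)"

text \<open>The increment rounds the parameter up: \<open>a\<close> is positive even if the floor
  vanishes, and \<open>B \<le> a / c\<close> gives a contraction rate at most that of
  \<open>B\<close>. This is the only use of \<open>Approx\<close>.\<close>

definition ising_sampler :: "nat \<Rightarrow> nat \<Rightarrow> nat \<Rightarrow> com" where
  "ising_sampler C1 C2 C3 = Seq (Write bK (Const 0) (Mul (Const C3) (sc bN)))
     (Seq (Write bBE (Const 0) (incr (Approx (sc bK)))) (com_rest C1 C2))"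

lemma com_approx_free_rest: "com_approx_free (com_rest C1 C2)"
  by (simp add: com_rest_def com_setup_def com_pins_def com_main_def com_power_body_def
    com_depth_body_def com_fields_body_def com_pin_def com_main_body_def com_sample_def com_decide_def
    com_root_def com_flips_def com_flip_body_def program_defs)

context machine
begin

lemma wp_pins:
  assumes s: "ready 0 {..<n} (\<lambda>_ _. 1) s" "s bI 0 = 0" "s bOUT = (\<lambda>_. 0)" "s bPIN = input n E q bPIN"
    and q: "query_ok n q"
  shows "wp \<beta> W com_pins [] (16 * n + 60) (\<lambda>s'. s' bI 0 = 0 \<and> s' bOUT = start_out q \<and>
    (\<exists>m. ready m (start_set n q) (start_fields E a c n q) s')) s"
    (is "wp _ _ _ _ _ ?Q s")
proof (cases q)
  case None
  have Q: "?Q s" using s unfolding None start_set_def start_fields_def start_out_def by auto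
  have "wp \<beta> W Skip [] 1 ?Q s" by (rule wp_straight) (use Q in simp_all)
  then have "wp \<beta> W Skip [] (16 * n + 59) ?Q s" by (rule wp_mono) auto
  then have "wp \<beta> W com_pins [] (1 + (16 * n + 59)) ?Q s"
    unfolding com_pins_def by (intro wp_IfI) (simp_all add: s(4) None input_def)
  then show ?thesis by (rule wp_mono) auto
next
  case (Some uv)
  then obtain u v where uv: "q = Some (u, v)" by (cases uv) auto
  have n: "u < n" "v < n" "u \<noteq> v" using q by (simp_all add: query_ok_def uv)
  have pin: "s bPIN 0 = 1" "s bPIN 1 = u" "s bPIN 2 = v" by (simp_all add: s(4) uv input_def)
  let ?U = "{..<n} - {u}" and ?g = "split_fields E a c (\<lambda>_ _. 1) u (n + 1)"
  have 2: "wp \<beta> W (com_pin (Read bPIN (Const 2)) 2) [] (8 * n + 20) ?Q s1"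
    if s1: "ready (0 + 1) ?U ?g s1" "s1 bOUT = (s bOUT)(u := 1)" "s1 bI = s bI" "s1 bPIN = s bPIN" for s1
  proof (rule wp_mono[OF wp_pin[where x = v, OF s1(1)] order_refl])
    fix s2 assume s2: "ready (0 + 1 + 1) (?U - {v}) (split_fields E a c ?g v (if (2::nat) = 1 then n + 1 else 0)) s2 \<and>
      s2 bOUT = (s1 bOUT)(v := 2) \<and> s2 bI = s1 bI \<and> s2 bPIN = s1 bPIN"
    have "\<exists>m. ready m (start_set n q) (start_fields E a c n q) s2"
      using s2 by (auto simp: start_set_def start_fields_def uv)
    then show "?Q s2" using s2 s1 s by (simp add: start_out_def uv)
  qed (use n s1(4) pin in auto)
  have "wp \<beta> W (com_pin (Read bPIN (Const 1)) 1) [] (8 * n + 20)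
    (wp \<beta> W (com_pin (Read bPIN (Const 2)) 2) [] (8 * n + 20) ?Q) s"
    by (rule wp_mono[OF wp_pin[where x = u, OF s(1)] order_refl 2]) (use n pin in auto)
  then have "wp \<beta> W (Seq (com_pin (Read bPIN (Const 1)) 1) (com_pin (Read bPIN (Const 2)) 2)) []
      (16 * n + 59) ?Q s" by (rule wp_Seq) simp
  then have "wp \<beta> W com_pins [] (1 + (16 * n + 59)) ?Q s"
    unfolding com_pins_def using pin(1) by (intro wp_IfI) simp_all
  then show ?thesis by (rule wp_mono) auto
qed

definition total_steps :: nat where
  "total_steps = 36 * n + 10 * K + 100 + n * (sample_cost + 10)"

lemma start_set_subset: "start_set n q \<subseteq> {..<n}"
  by (auto simp: start_set_def split: option.splits)

lemma wp_rest:
  assumes s: "s bN 0 = n" "s bK 0 = K" "s bBE 0 = a" "mem_bdd W s" "\<And>b i. 6 \<le> b \<Longrightarrow> s b i = 0"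
    "s bADJ = input n E q bADJ" "s bOUT = (\<lambda>_. 0)" "s bPIN = input n E q bPIN"
    and l: "l = (if n \<le> C2 then n else C1 * floorlog 2 n)" and C1: "C1 * n + 2 * n + C1 < 2 ^ W" and n: "1 \<le> n"
    and q: "query_ok n q" and bs: "length bs = K * card (start_set n q)"
  shows "wp \<beta> W (com_rest C1 C2) bs total_steps
    (\<lambda>s'. s' bOUT = sample_run E a c n l K [0..<n] (start_set n q) (start_fields E a c n q) bs (start_out q)) s"
    (is "wp _ _ _ _ _ ?Q s")
proof -
  have adj: "s bADJ (x * n + y) = of_bool ({x, y} \<in> E)" if "x < n" "y < n" for x y
  proof -
    have "x * n + y < (x + 1) * n" using that by (simp add: add_mult_distrib)
    also have "\<dots> \<le> n * n" using that by (intro mult_le_mono1) simp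
    finally show ?thesis using that by (simp add: s(6) input_def)
  qed
  have main: "wp \<beta> W com_main bs (1 + (n - 0) * (sample_cost + 10)) ?Q s2"
    if s2: "s2 bI 0 = 0" "s2 bOUT = start_out q" "ready m (start_set n q) (start_fields E a c n q) s2" for s2 m
  proof -
    have U: "start_set n q \<subseteq> {0..<n}" using start_set_subset[of q] by auto
    show ?thesis using wp_main[OF s2(3,1) _ U bs] s2(2) by simp
  qed
  have pins: "wp \<beta> W (Seq com_pins com_main) bs (16 * n + 62 + n * (sample_cost + 10)) ?Q s1"
    if s1: "ready 0 {..<n} (\<lambda>_ _. 1) s1" "s1 bI 0 = 0" "s1 bOUT = s bOUT" "s1 bPIN = s bPIN" for s1
  proof -
    have o: "s1 bOUT = (\<lambda>_. 0)" and p: "s1 bPIN = input n E q bPIN" using s1(3,4) s(7,8) by auto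
    have "wp \<beta> W com_pins [] (16 * n + 60) (wp \<beta> W com_main bs (1 + (n - 0) * (sample_cost + 10)) ?Q) s1"
      by (rule wp_mono[OF wp_pins[OF s1(1,2) o p q] order_refl]) (use main in blast)
    then show ?thesis by (rule wp_Seq) simp
  qed
  have "wp \<beta> W (com_setup C1 C2) [] (20 * n + 10 * K + 30)
    (wp \<beta> W (Seq com_pins com_main) bs (16 * n + 62 + n * (sample_cost + 10)) ?Q) s"
    by (rule wp_mono[OF wp_setup[OF s(1-5) adj l C1 n] order_refl]) (use pins in blast)+
  then show ?thesis unfolding com_rest_def by (rule wp_Seq) (simp add: total_steps_def)
qed

definition total_time :: "nat \<Rightarrow> nat \<Rightarrow> nat \<Rightarrow> nat" where
  "total_time C1 C2 C3 = (2 * C3 + 40) * W + total_steps * com_cost (com_rest C1 C2) * W"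

text \<open>\<open>Approx\<close> lies outside the step-counting bounds, so the two commands that
  compute \<open>K\<close> and \<open>a\<close> are run in \<open>exec\<close> and costed by hand;
  the request for digits costs \<open>K \<le> W\<close> plus lengths. Everything after them goes
  through \<open>bexec_exec\<close>.\<close>

lemma run:
  assumes a_eq: "a = nat \<lfloor>\<beta> * 2 ^ K\<rfloor> + 1" and K: "K = C3 * n"
    and l: "l = (if n \<le> C2 then n else C1 * floorlog 2 n)" and C1: "C1 * n + 2 * n + C1 < 2 ^ W" and n: "1 \<le> n"
    and q: "query_ok n q" and rs: "K * card (start_set n q) \<le> length rs"
  shows "\<exists>t s' r'. exec \<beta> (ising_sampler C1 C2 C3) (input n E q, rs) t (s', r') \<and> t \<le> total_time C1 C2 C3 \<and>
    s' bOUT = sample_run E a c n l K [0..<n] (start_set n q) (start_fields E a c n q) rs (start_out q)"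
proof -
  let ?s = "input n E q"
  have v: "x < 2 ^ W" if "x \<le> n" for x using small[of x] that by simp
  have b: "mem_bdd W ?s"
    using q v small[of 1] by (auto simp: mem_bdd_def input_def query_ok_def split: option.splits)
  define s1 where "s1 = upd ?s bK 0 K"
  have b1: "mem_bdd W s1" unfolding s1_def using b small[of K] by (intro mem_bdd_upd) auto
  define s2 where "s2 = upd s1 bBE 0 a"
  have "c < 2 ^ W" unfolding cK using Wbig by (intro power_strict_increasing) auto
  then have aW: "a < 2 ^ W" using ac by simp
  have b2: "mem_bdd W s2" unfolding s2_def using b1 aW by (rule mem_bdd_upd)
  have N: "?s bN 0 = n" by (simp add: input_def)
  have k1: "s1 bK 0 = K" by (simp add: s1_def upd_def)
  define t1 where "t1 = 1 + cost \<beta> ?s (Const 0) + cost \<beta> ?s (Mul (Const C3) (sc bN))"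
  have "exec \<beta> (Write bK (Const 0) (Mul (Const C3) (sc bN))) (?s, rs) t1
    (upd ?s bK (eval \<beta> ?s (Const 0)) (eval \<beta> ?s (Mul (Const C3) (sc bN))), rs)"
    unfolding t1_def by (rule exec.Write)
  then have e1: "exec \<beta> (Write bK (Const 0) (Mul (Const C3) (sc bN))) (?s, rs) t1 (s1, rs)"
    by (simp add: s1_def N K)
  have c0: "cost \<beta> s' (Const 0) \<le> 2 * W" if "mem_bdd W s'" for s'
    using cost_bdd[of "Const 0" W s' \<beta>] that W1 by simp
  have t1: "t1 \<le> (2 * C3 + 14) * W"
  proof -
    have "cost \<beta> ?s (Mul (Const C3) (sc bN)) \<le> expr_cost (Mul (Const C3) (sc bN)) * W"
      using b W1 by (intro cost_bdd) auto
    also have "expr_cost (Mul (Const C3) (sc bN)) = 2 * C3 + 9" by (simp add: sc_def)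
    finally show ?thesis using c0[OF b] W1 unfolding t1_def by (simp add: add_mult_distrib)
  qed
  define t2 where "t2 = 1 + cost \<beta> s1 (Const 0) + cost \<beta> s1 (incr (Approx (sc bK)))"
  have "exec \<beta> (Write bBE (Const 0) (incr (Approx (sc bK)))) (s1, rs) t2
    (upd s1 bBE (eval \<beta> s1 (Const 0)) (eval \<beta> s1 (incr (Approx (sc bK)))), rs)"
    unfolding t2_def by (rule exec.Write)
  then have e2: "exec \<beta> (Write bBE (Const 0) (incr (Approx (sc bK)))) (s1, rs) t2 (s2, rs)"
    by (simp add: s2_def k1 a_eq)
  have t2: "t2 \<le> 20 * W"
  proof -
    have "floorlog 2 (nat \<lfloor>\<beta> * 2 ^ K\<rfloor> + 1) \<le> W" "floorlog 2 (nat \<lfloor>\<beta> * 2 ^ K\<rfloor>) \<le> W"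
      using aW unfolding a_eq by (intro floorlog2_le; linarith)+
    moreover have "cost \<beta> s1 (sc bK) \<le> 4 * W"
      using cost_bdd[of "sc bK" W s1 \<beta>] b1 W1 by (simp add: sc_def)
    moreover have "cost \<beta> s1 (Const 1) \<le> 3 * W"
      using cost_bdd[of "Const 1" W s1 \<beta>] b1 W1 by simp
    moreover have "K \<le> W" using Wbig by linarith
    ultimately show ?thesis using c0[OF b1] W1 unfolding t2_def incr_def by (simp add: k1)
  qed
  define bs where "bs = take (K * card (start_set n q)) rs"
  define r where "r = drop (K * card (start_set n q)) rs"
  have rs_eq: "rs = bs @ r" by (simp add: bs_def r_def)
  have bl: "length bs = K * card (start_set n q)" using rs by (simp add: bs_def)
  have "wp \<beta> W (com_rest C1 C2) bs total_steps
    (\<lambda>s'. s' bOUT = sample_run E a c n l K [0..<n] (start_set n q) (start_fields E a c n q) bs (start_out q)) s2"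
    by (rule wp_rest[OF _ _ _ b2 _ _ _ _ l C1 n q bl])
       (auto simp: s2_def s1_def upd_def input_def)
  then obtain k s' where k: "k \<le> total_steps"
    "s' bOUT = sample_run E a c n l K [0..<n] (start_set n q) (start_fields E a c n q) bs (start_out q)"
    "\<forall>r. bexec \<beta> W (com_rest C1 C2) (s2, bs @ r) k (s', r)" unfolding wp_def by blast
  then have "bexec \<beta> W (com_rest C1 C2) (s2, rs) k (s', r)" unfolding rs_eq by blast
  from bexec_exec[OF this _ W1 com_approx_free_rest] b2 obtain t3 where t3:
    "t3 \<le> k * com_cost (com_rest C1 C2) * W" "exec \<beta> (com_rest C1 C2) (s2, rs) t3 (s', r)" by auto
  have "exec \<beta> (ising_sampler C1 C2 C3) (?s, rs) (1 + t1 + (1 + t2 + t3)) (s', r)"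
    unfolding ising_sampler_def by (rule exec.Seq[OF e1 exec.Seq[OF e2 t3(2)]])
  moreover have "1 + t1 + (1 + t2 + t3) \<le> total_time C1 C2 C3"
  proof -
    have "t3 \<le> total_steps * com_cost (com_rest C1 C2) * W"
      using t3(1) mult_le_mono1[OF mult_le_mono1[OF k(1)]] by (rule order_trans)
    then show ?thesis using t1 t2 W1 unfolding total_time_def by (simp add: add_mult_distrib)
  qed
  moreover have "s' bOUT = sample_run E a c n l K [0..<n] (start_set n q) (start_fields E a c n q) rs (start_out q)"
    unfolding k(2) rs_eq
    using start_set_subset[of q] bl
    by (subst sample_run_append) (auto intro: finite_subset)
  ultimately show ?thesis by blast
qed

end

section \<open>Distribution and running time\<close>

definition start_configs :: "nat \<Rightarrow> (nat \<times> nat) option \<Rightarrow> (nat \<Rightarrow> nat) set" where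
  "start_configs n q = (case q of None \<Rightarrow> configs {..<n} | Some (u, v) \<Rightarrow> pinned n u v)"

text \<open>\<open>X\<close> stands for \<open>(2 * \<Delta> + 2) ^ l\<close>. It is an argument of
  its own because this power is the one factor whose polynomial growth needs a reason.\<close>

definition time_bound :: "nat \<Rightarrow> nat \<Rightarrow> nat \<Rightarrow> nat \<Rightarrow> nat \<Rightarrow> nat \<Rightarrow> nat \<Rightarrow> nat \<Rightarrow> nat \<Rightarrow> nat" where
  "time_bound C1 C2 C3 \<Delta> n l K W X = ((2 * C3 + 40) +
     (36 * n + 10 * K + 100 + n * ((n + \<Delta>) * (8 * n + 40) * X + 8 * n + 8 * K + 70)) * com_cost (com_rest C1 C2)) * W"

context machine
begin

lemma total_time_le: "total_time C1 C2 C3 \<le> time_bound C1 C2 C3 \<Delta> n l K W ((2 * \<Delta> + 2) ^ l)"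
proof -
  have sc: "sample_cost + 10 \<le> (n + \<Delta>) * (8 * n + 40) * (2 * \<Delta> + 2) ^ l + 8 * n + 8 * K + 70"
    using dfs_steps_le[of l] unfolding sample_cost_def iter_cost_def by linarith
  have "total_steps \<le> 36 * n + 10 * K + 100 +
      n * ((n + \<Delta>) * (8 * n + 40) * (2 * \<Delta> + 2) ^ l + 8 * n + 8 * K + 70)"
    unfolding total_steps_def by (rule add_left_mono[OF mult_le_mono2[OF sc]])
  then have "total_steps * com_cost (com_rest C1 C2) * W \<le> (36 * n + 10 * K + 100 +
      n * ((n + \<Delta>) * (8 * n + 40) * (2 * \<Delta> + 2) ^ l + 8 * n + 8 * K + 70)) * com_cost (com_rest C1 C2) * W"
    by (intro mult_le_mono1)
  then show ?thesis unfolding total_time_def time_bound_def by (simp only: add_mult_distrib[of "2 * C3 + 40"])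
qed

definition step_lower_ok :: "real \<Rightarrow> bool" where
  "step_lower_ok (\<epsilon> :: real) \<longleftrightarrow> (\<forall>U v g s j. U \<subseteq> {..<n} \<longrightarrow> v \<in> U \<longrightarrow> field_inv a c j g \<longrightarrow> j \<le> n \<longrightarrow> s \<in> {1, 2} \<longrightarrow>
      real (card {x. x < c \<and> decide c (approx_marg E a c l U g v 1) (approx_marg E a c l U g v 2) x = s}) \<ge>
      real c * (1 - \<epsilon>) * (marginal E a c U g v s / weight_sum E a c U g))"

lemma output_lower:
  fixes \<epsilon> :: real
  assumes a_eq: "a = nat \<lfloor>\<beta> * 2 ^ K\<rfloor> + 1" and K: "K = C3 * n"
    and l: "l = (if n \<le> C2 then n else C1 * floorlog 2 n)" and C1: "C1 * n + 2 * n + C1 < 2 ^ W" and n: "1 \<le> n"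
    and q: "query_ok n q" and T: "total_time C1 C2 C3 + K * n \<le> T"
    and step_ok: "step_lower_ok \<epsilon>"
    and \<epsilon>: "0 \<le> \<epsilon>" "\<epsilon> \<le> 1"
  defines "\<nu> \<equiv> output_pmf \<beta> (ising_sampler C1 C2 C3) n E q T"
  shows "halts_within \<beta> (ising_sampler C1 C2 C3) (input n E q) T"
    and "set_pmf \<nu> \<subseteq> start_configs n q"
    and "\<tau> \<in> start_configs n q \<Longrightarrow> (1 - n * \<epsilon>) * gibbs E (start_configs n q) (a / c) \<tau> \<le> pmf \<nu> \<tau>"
proof -
  have step: "real (card {x. x < c \<and> decide c (approx_marg E a c l U g v 1) (approx_marg E a c l U g v 2) x = s}) \<ge>
      real c * (1 - \<epsilon>) * (marginal E a c U g v s / weight_sum E a c U g)"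
    if "U \<subseteq> {..<n}" "v \<in> U" "field_inv a c j g" "j \<le> n" "s \<in> {1, 2}" for U v g s j
    using step_ok that unfolding step_lower_ok_def by blast
  let ?U = "start_set n q" and ?g = "start_fields E a c n q" and ?out = "start_out q"
  let ?F = "\<lambda>r. sample_run E a c n l K [0..<n] ?U ?g r ?out"
  let ?S = "{r :: bool list. length r = T}"
  have finU: "finite ?U" using start_set_subset[of q] by (rule finite_subset) simp
  have cU: "card ?U \<le> n" using card_mono[OF _ start_set_subset[of q]] by simp
  have KT: "K * card ?U \<le> T" using T mult_le_mono2[OF cU, of K] by linarith
  have ex: "\<exists>t s' r'. exec \<beta> (ising_sampler C1 C2 C3) (input n E q, r) t (s', r') \<and> t \<le> T \<and> s' bOUT = ?F r"
    if "length r = T" for r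
  proof -
    have "K * card ?U \<le> length r" using KT that by simp
    from run[OF a_eq K l C1 n q this] T show ?thesis by (meson add_leD1 order_trans)
  qed
  then show "halts_within \<beta> (ising_sampler C1 C2 C3) (input n E q) T"
    unfolding halts_within_def by blast
  have fm: "final_mem \<beta> (ising_sampler C1 C2 C3) (input n E q) r bOUT = ?F r" if r: "length r = T" for r
  proof -
    obtain t s' r' where e: "exec \<beta> (ising_sampler C1 C2 C3) (input n E q, r) t (s', r')" "s' bOUT = ?F r"
      using ex[OF r] by blast
    have "final_mem \<beta> (ising_sampler C1 C2 C3) (input n E q) r = s'"
      unfolding final_mem_def
    proof (rule the_equality)
      show "\<exists>t r'. exec \<beta> (ising_sampler C1 C2 C3) (input n E q, r) t (s', r')" using e by blast
    next
      fix s'' assume "\<exists>t r'. exec \<beta> (ising_sampler C1 C2 C3) (input n E q, r) t (s'', r')"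
      then show "s'' = s'" using exec_deterministic[OF e(1)] by blast
    qed
    then show ?thesis using e by simp
  qed
  have "replicate T True \<in> ?S" by simp
  then have finS: "finite ?S" "?S \<noteq> {}" using finite_bits[of T] by blast+
  have set: "set_pmf (pmf_of_set ?S) = ?S" using finS by (intro set_pmf_of_set)
  have sub: "?U \<subseteq> set [0..<n]" using start_set_subset[of q] by auto
  have rng: "?F r x \<in> {1, 2}" if "x \<in> ?U" for r x
    using sample_run_range[OF sub, of x E a c n l K ?g r ?out] that by blast
  have fix_out: "?F r x = ?out x" if "x \<notin> ?U" for r x
    using sample_run_range[OF sub, of x E a c n l K ?g r ?out] that by blast
  have conf: "restrict (?F r) {..<n} \<in> start_configs n q" for r
  proof (cases q)
    case None
    then have "?F r x \<in> {1, 2}" if "x < n" for x using that rng[of x r] by (simp add: start_set_def)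
    then show ?thesis unfolding None start_configs_def configs_def by auto
  next
    case (Some uv)
    then obtain u v where uv: "q = Some (u, v)" by (cases uv) auto
    have n: "u < n" "v < n" "u \<noteq> v" using q by (simp_all add: query_ok_def uv)
    have o: "?F r u = 1" "?F r v = 2" using fix_out[of u r] fix_out[of v r] n
      by (simp_all add: start_set_def start_out_def uv)
    have "?F r x \<in> {1, 2}" if "x < n" for x
    proof (cases "x = u \<or> x = v")
      case True
      then show ?thesis using o by auto
    next
      case False
      then show ?thesis using that by (intro rng) (simp add: start_set_def uv)
    qed
    then have "restrict (?F r) {..<n} \<in> pinned n u v"
      using o n by (auto simp: pinned_def configs_def)
    then show ?thesis by (simp add: start_configs_def uv)
  qed
  show "set_pmf \<nu> \<subseteq> start_configs n q"
    unfolding \<nu>_def output_pmf_def set_map_pmf set output_config_def using conf fm by auto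
  assume \<tau>: "\<tau> \<in> start_configs n q"
  then have \<tau>c: "\<tau> \<in> configs {..<n}"
    by (auto simp: start_configs_def pinned_def split: option.splits)
  \<comment> \<open>A configuration is \<open>undefined\<close> outside the vertex set, whereas the
    output bank holds 0 there; the sampler is compared with the latter version.\<close>
  define \<tau>' where "\<tau>' x = (if x < n then \<tau> x else 0)" for x
  have \<tau>': "restrict \<tau>' {..<n} = \<tau>"
    using \<tau>c by (auto simp: \<tau>'_def configs_def PiE_def extensional_def restrict_def fun_eq_iff)
  have \<tau>12: "\<tau> x \<in> {1, 2}" if "x \<in> ?U" for x
    using start_set_subset[of q] that by (intro configs_mem[OF \<tau>c]) auto
  \<comment> \<open>Pinning counts as two removals: the fields start with exponent 2, balanced by
    two vertices fewer in the start set.\<close>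
  have inv: "\<exists>j. field_inv a c j ?g \<and> j + card ?U \<le> n"
  proof (cases q)
    case None
    then show ?thesis by (intro exI[of _ 0]) (auto simp: field_inv_def start_fields_def start_set_def)
  next
    case (Some uv)
    then obtain u v where uv: "q = Some (u, v)" by (cases uv) auto
    have n: "u < n" "v < n" "u \<noteq> v" using q by (simp_all add: query_ok_def uv)
    have "field_inv a c (Suc (Suc 0)) ?g"
      unfolding start_fields_def uv option.case prod.case
      by (intro field_inv_split_fields a ac) (simp add: field_inv_def)
    moreover have "card ?U = n - 2" using n by (simp add: start_set_def uv card_Diff_singleton)
    ultimately show ?thesis using n by (intro exI[of _ "Suc (Suc 0)"]) auto
  qed
  then obtain j where j: "field_inv a c j ?g" "j + card ?U \<le> n" by blast
  have "real (card {bs. length bs = T \<and> ?F bs = \<tau>'}) \<ge>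
    2 ^ T * (1 - \<epsilon>) ^ card ?U * (weight E a c ?U ?g \<tau>' / weight_sum E a c ?U ?g)"
  proof (rule sample_run_lower[OF gr a ac cK step \<epsilon>(2) sub start_set_subset j])
    show "\<tau>' x \<in> {1, 2}" if "x \<in> ?U" for x
      using \<tau>12[OF that] start_set_subset[of q] that by (auto simp: \<tau>'_def)
    show "?out x = \<tau>' x" if "x \<notin> ?U" for x
      using that \<tau> q by (auto simp: \<tau>'_def start_set_def start_out_def start_configs_def pinned_def
          query_ok_def split: option.splits)
  qed (use KT in auto)
  moreover have "weight E a c ?U ?g \<tau>' = weight E a c ?U ?g \<tau>"
    by (rule weight_cong) (use \<tau>12 start_set_subset[of q] in \<open>auto simp: \<tau>'_def\<close>)
  moreover have "weight E a c ?U ?g \<tau> / weight_sum E a c ?U ?g = gibbs E (start_configs n q) (a / c) \<tau>"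
  proof (cases q)
    case None
    then show ?thesis using weight_ratio_all[OF gr c0]
      by (simp add: start_set_def start_fields_def start_configs_def)
  next
    case (Some uv)
    then obtain u v where uv: "q = Some (u, v)" by (cases uv) auto
    have n: "u < n" "v < n" "u \<noteq> v" using q by (simp_all add: query_ok_def uv)
    have "\<tau> \<in> pinned n u v" using \<tau> by (simp add: start_configs_def uv)
    from weight_ratio_pinned[OF gr a c0 n this] show ?thesis
      by (simp add: start_set_def start_fields_def start_configs_def uv)
  qed
  ultimately have low: "real (card {bs. length bs = T \<and> ?F bs = \<tau>'}) \<ge>
    2 ^ T * (1 - \<epsilon>) ^ card ?U * gibbs E (start_configs n q) (a / c) \<tau>" by simp
  have "pmf \<nu> \<tau> = measure_pmf.prob (pmf_of_set ?S)
      ((\<lambda>r. output_config n (final_mem \<beta> (ising_sampler C1 C2 C3) (input n E q) r)) -` {\<tau>})"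
    unfolding \<nu>_def output_pmf_def by (rule pmf_map)
  also have "\<dots> = real (card (?S \<inter> ((\<lambda>r. output_config n (final_mem \<beta> (ising_sampler C1 C2 C3) (input n E q) r)) -` {\<tau>}))) / 2 ^ T"
    using measure_pmf_of_set[OF finS(2,1)] card_bits[of T] by simp
  finally have p: "pmf \<nu> \<tau> = real (card (?S \<inter> ((\<lambda>r. output_config n (final_mem \<beta> (ising_sampler C1 C2 C3) (input n E q) r)) -` {\<tau>}))) / 2 ^ T" .
  have "card {bs. length bs = T \<and> ?F bs = \<tau>'} \<le>
    card (?S \<inter> ((\<lambda>r. output_config n (final_mem \<beta> (ising_sampler C1 C2 C3) (input n E q) r)) -` {\<tau>}))"
  proof (intro card_mono subsetI)
    fix r assume "r \<in> {bs. length bs = T \<and> ?F bs = \<tau>'}"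
    then have r: "length r = T" "?F r = \<tau>'" by auto
    have "output_config n (final_mem \<beta> (ising_sampler C1 C2 C3) (input n E q) r) = \<tau>"
      by (simp only: output_config_def fm[OF r(1)] r(2) \<tau>')
    then show "r \<in> ?S \<inter> ((\<lambda>r. output_config n (final_mem \<beta> (ising_sampler C1 C2 C3) (input n E q) r)) -` {\<tau>})"
      using r(1) by simp
  qed (use finS(1) in simp)
  then have "2 ^ T * (1 - \<epsilon>) ^ card ?U * gibbs E (start_configs n q) (a / c) \<tau> \<le> pmf \<nu> \<tau> * 2 ^ T"
    using low unfolding p by simp
  then have m: "(1 - \<epsilon>) ^ card ?U * gibbs E (start_configs n q) (a / c) \<tau> \<le> pmf \<nu> \<tau>"
    by (simp add: mult.assoc mult.commute[of _ "2 ^ T"])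
  have g0: "0 \<le> gibbs E (start_configs n q) (a / c) \<tau>"
    unfolding gibbs_def by (intro divide_nonneg_nonneg sum_nonneg) auto
  have "1 - n * \<epsilon> \<le> 1 + card ?U * (- \<epsilon>)" using cU \<epsilon>(1) by (simp add: mult_right_mono)
  also have "\<dots> \<le> (1 + (- \<epsilon>)) ^ card ?U" using \<epsilon>(2) by (intro Bernoulli_inequality) simp
  finally have "(1 - n * \<epsilon>) * gibbs E (start_configs n q) (a / c) \<tau> \<le>
    (1 - \<epsilon>) ^ card ?U * gibbs E (start_configs n q) (a / c) \<tau>"
    using g0 by (intro mult_right_mono) simp_all
  then show "(1 - n * \<epsilon>) * gibbs E (start_configs n q) (a / c) \<tau> \<le> pmf \<nu> \<tau>" using m by linarith
qed

end

section \<open>Polynomial bounds and the choice of constants\<close>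

definition poly_bdd :: "(nat \<Rightarrow> nat) \<Rightarrow> bool" where
  "poly_bdd f \<longleftrightarrow> (\<exists>p :: nat poly. \<forall>n\<ge>1. f n \<le> poly p n)"

lemma poly_bdd_const: "poly_bdd (\<lambda>_. k)"
  unfolding poly_bdd_def by (intro exI[of _ "[:k:]"]) simp

lemma poly_bdd_id: "poly_bdd (\<lambda>n. n)"
  unfolding poly_bdd_def by (intro exI[of _ "[:0, 1:]"]) simp

lemma poly_bdd_add: "poly_bdd f \<Longrightarrow> poly_bdd g \<Longrightarrow> poly_bdd (\<lambda>n. f n + g n)"
  unfolding poly_bdd_def by (metis add_mono poly_add)

lemma poly_bdd_mult: "poly_bdd f \<Longrightarrow> poly_bdd g \<Longrightarrow> poly_bdd (\<lambda>n. f n * g n)"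
  unfolding poly_bdd_def by (metis mult_le_mono poly_mult)

lemma poly_bdd_power: "poly_bdd f \<Longrightarrow> poly_bdd (\<lambda>n. f n ^ k)"
  by (induction k) (simp_all add: poly_bdd_const poly_bdd_mult)

lemma poly_bdd_mono: "poly_bdd f \<Longrightarrow> (\<And>n. 1 \<le> n \<Longrightarrow> g n \<le> f n) \<Longrightarrow> poly_bdd g"
  unfolding poly_bdd_def by (meson order_trans)

lemmas poly_bdd_intros = poly_bdd_add poly_bdd_mult poly_bdd_power poly_bdd_const poly_bdd_id

lemma poly_bdd_depth: "poly_bdd (\<lambda>n. if n \<le> C2 then n else C1 * floorlog 2 n)"
proof (rule poly_bdd_mono)
  show "poly_bdd (\<lambda>n. n + C1 * n)" by (intro poly_bdd_intros)
  show "(if n \<le> C2 then n else C1 * floorlog 2 n) \<le> n + C1 * n" if "1 \<le> n" for n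
  proof -
    have "C1 * floorlog 2 n \<le> C1 * n" by (rule mult_le_mono2[OF floorlog_props(4)[OF that]])
    moreover have "(if n \<le> C2 then n else C1 * floorlog 2 n) \<le> n + C1 * floorlog 2 n" by simp
    ultimately show ?thesis by linarith
  qed
qed

text \<open>The bound \<open>D \<le> 2 ^ D\<close> replaces a logarithm of \<open>D\<close> and
  turns \<open>D ^ (C1 * f)\<close> into \<open>(2 ^ f) ^ (D * C1)\<close>, where
  \<open>2 ^ f \<le> 2 * n\<close> for the number \<open>f\<close> of binary digits. The cases
  \<open>n \<le> C2\<close> contribute a constant.\<close>

lemma poly_bdd_power_depth: "poly_bdd (\<lambda>n. D ^ (if n \<le> C2 then n else C1 * floorlog 2 n))"
proof (rule poly_bdd_mono)
  show "poly_bdd (\<lambda>n. (D + 1) ^ C2 * (2 * n) ^ (D * C1))" by (intro poly_bdd_intros)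
  fix n :: nat assume n: "1 \<le> n"
  show "D ^ (if n \<le> C2 then n else C1 * floorlog 2 n) \<le> (D + 1) ^ C2 * (2 * n) ^ (D * C1)"
  proof (cases "n \<le> C2")
    case True
    have "D ^ n \<le> (D + 1) ^ n" by (intro power_mono) auto
    also have "\<dots> \<le> (D + 1) ^ C2" using True by (intro power_increasing) auto
    also have "\<dots> \<le> (D + 1) ^ C2 * (2 * n) ^ (D * C1)" using n by simp
    finally show ?thesis using True by simp
  next
    case False
    let ?f = "floorlog 2 n"
    have "(2::nat) ^ ?f = 2 * 2 ^ (?f - 1)" using floorlog_props(3)[OF n] by (cases ?f) auto
    also have "\<dots> \<le> 2 * n" using floorlog_props(1)[OF n] by simp
    finally have f: "(2::nat) ^ ?f \<le> 2 * n" .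
    have "D \<le> 2 ^ D" using less_exp[of D] by simp
    then have "D ^ (C1 * ?f) \<le> (2 ^ D) ^ (C1 * ?f)" by (rule power_mono) simp
    also have "\<dots> = (2 ^ ?f) ^ (D * C1)" by (simp add: power_mult[symmetric] ac_simps)
    also have "\<dots> \<le> (2 * n) ^ (D * C1)" using f by (rule power_mono) simp
    also have "\<dots> \<le> (D + 1) ^ C2 * (2 * n) ^ (D * C1)" by simp
    finally show ?thesis using False by simp
  qed
qed

text \<open>\<open>depth M n\<close> itself is not computable for arbitrary real \<open>M\<close>, so the program uses the depth
  \<open>C1 * floorlog 2 n\<close>. It exceeds \<open>depth M n\<close> by at most about \<open>2 log\<^sub>2 n\<close>; each extra level costs a
  factor \<open>\<Delta>\<close>, hence altogether a power of \<open>n\<close> that a large \<open>M\<close> absorbs. For \<open>n \<le> C2\<close> the depth \<open>n\<close>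
  makes the recursion exact.\<close>

lemma decay_bound:
  fixes \<kappa> b M B :: real and \<Delta> :: nat
  assumes \<kappa>: "0 < \<kappa>" "\<kappa> < 1" and b: "0 < b" "b * \<kappa> < 1" and B: "0 < B" and \<Delta>: "1 \<le> \<Delta>"
    and M: "(13 + 2 * ln \<Delta> / ln 2) / (- ln (b * \<kappa>)) < M"
    and C1: "C1 = nat \<lceil>M * ln 2\<rceil> + 1"
  shows "\<exists>C2\<ge>1. \<forall>n>C2. \<forall>w. 1 \<le> depth M n \<and> depth M n \<le> C1 * floorlog 2 n \<and>
    (w \<le> b ^ depth M n * real \<Delta> ^ (C1 * floorlog 2 n - (depth M n - 1)) \<longrightarrow>
     \<kappa> ^ (C1 * floorlog 2 n) * w * (n * (1 / B)) \<le> 1 / (2 * real n ^ 11))"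
proof -
  define \<gamma> where "\<gamma> = - ln (b * \<kappa>)"
  have \<gamma>: "0 < \<gamma>" using \<kappa> b by (simp add: \<gamma>_def ln_less_zero_iff)
  have ln2: "0 < ln (2::real)" by simp
  have l\<Delta>: "0 \<le> ln (real \<Delta>)" using \<Delta> by simp
  \<comment> \<open>Of the 13, eleven are the claimed power of \<open>n\<close>, one cancels the
    factor \<open>n\<close>, and one absorbs the constants once \<open>n > C2\<close>. The term
    \<open>2 * ln \<Delta> / ln 2\<close> pays for the levels beyond
    \<open>depth M n\<close>.\<close>
  have M\<gamma>: "13 + 2 * ln \<Delta> / ln 2 < M * \<gamma>"
    using M \<gamma> unfolding \<gamma>_def[symmetric] by (simp add: pos_divide_less_eq)
  have "0 < 13 + 2 * ln \<Delta> / ln 2" using l\<Delta> ln2 by (simp add: add_pos_nonneg)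
  then have "0 < M * \<gamma>" using M\<gamma> by linarith
  then have M0: "0 < M" using \<gamma> by (simp add: zero_less_mult_iff)
  \<comment> \<open>\<open>exp c0\<close> collects what the extra levels cost independently of
    \<open>n\<close>, and beyond \<open>C2\<close> the product \<open>n * B\<close> exceeds
    \<open>2 * exp c0\<close>.\<close>
  define c0 where "c0 = (M * ln 2 + 3) * ln (real \<Delta>)"
  define C2 where "C2 = nat \<lceil>2 * exp c0 / B\<rceil> + 1"
  have "1 \<le> depth M n \<and> depth M n \<le> C1 * floorlog 2 n \<and>
    (w \<le> b ^ depth M n * real \<Delta> ^ (C1 * floorlog 2 n - (depth M n - 1)) \<longrightarrow>
     \<kappa> ^ (C1 * floorlog 2 n) * w * (n * (1 / B)) \<le> 1 / (2 * real n ^ 11))"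
    if n: "C2 < n" for n w
  proof -
    define x where "x = ln (real n)"
    define f where "f = floorlog 2 n"
    define L where "L = depth M n"
    define l where "l = C1 * f"
    have n1: "1 < n" using n by (simp add: C2_def)
    have x: "0 < x" unfolding x_def using n1 by simp
    have L: "M * x \<le> L" "L \<le> M * x + 1" "1 \<le> L"
    proof -
      have p: "0 < M * x" using M0 x by simp
      then have c: "0 < \<lceil>M * x\<rceil>" by simp
      have r: "real L = of_int \<lceil>M * x\<rceil>" using c unfolding L_def depth_def x_def[symmetric] by simp
      show "M * x \<le> L" "L \<le> M * x + 1" unfolding r by linarith+
      have "0 < L" using c unfolding L_def depth_def x_def[symmetric] by (simp only: zero_less_nat_eq)
      then show "1 \<le> L" by simp
    qed
    have f1: "1 \<le> f" and fl: "2 ^ (f - 1) \<le> n" "n < 2 ^ f"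
      using floorlog_props[of n] n1 unfolding f_def by auto
    have fx: "x \<le> f * ln 2" "f * ln 2 \<le> x + ln 2"
    proof -
      have "real n \<le> 2 ^ f" using fl(2) by (metis less_imp_le of_nat_le_iff of_nat_numeral of_nat_power)
      then have "ln (real n) \<le> ln (2 ^ f)" using n1 by (intro ln_mono) auto
      then show "x \<le> f * ln 2" by (simp add: x_def ln_realpow)
      have "2 ^ (f - 1) \<le> real n" using fl(1) by (metis of_nat_le_iff of_nat_numeral of_nat_power)
      then have "ln (2 ^ (f - 1)) \<le> ln (real n)" using n1 by (intro ln_mono) auto
      then have "real (f - 1) * ln 2 \<le> x" by (simp add: x_def ln_realpow)
      then show "f * ln 2 \<le> x + ln 2" using f1 by (simp add: of_nat_diff algebra_simps)
    qed
    have C1r: "M * ln 2 + 1 \<le> C1" "C1 \<le> M * ln 2 + 2"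
    proof -
      have "0 \<le> M * ln 2" using M0 by simp
      then have "real C1 = of_int \<lceil>M * ln 2\<rceil> + 1" unfolding C1 by (simp add: of_nat_nat)
      then show "M * ln 2 + 1 \<le> C1" "C1 \<le> M * ln 2 + 2" by linarith+
    qed
    have lr: "real l = real C1 * real f" by (simp add: l_def)
    \<comment> \<open>The \<open>+ 1\<close> in \<open>C1\<close> adds \<open>f \<ge> 1\<close>
      levels and so covers the rounding up in \<open>depth\<close>.\<close>
    have "M * x \<le> M * (f * ln 2)" using fx(1) M0 by (intro mult_left_mono) auto
    moreover have "1 \<le> real f" using f1 by simp
    moreover have "(M * ln 2 + 1) * f = M * (f * ln 2) + f" by (simp add: algebra_simps)
    ultimately have "M * x + 1 \<le> (M * ln 2 + 1) * f" by linarith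
    also have "\<dots> \<le> real C1 * real f" using C1r(1) by (intro mult_right_mono) auto
    finally have l1: "M * x + 1 \<le> l" by (simp add: lr)
    then have Ll: "L \<le> l" using L(2) by linarith
    have "real C1 * real f \<le> (M * ln 2 + 2) * f" using C1r(2) by (intro mult_right_mono) auto
    also have "\<dots> = M * (real f * ln 2) + 2 * real f" by (simp add: algebra_simps)
    also have "\<dots> \<le> M * (x + ln 2) + 2 * (x / ln 2 + 1)"
    proof -
      have A: "M * (real f * ln 2) \<le> M * (x + ln 2)" using fx(2) M0 by (intro mult_left_mono) auto
      have "real f \<le> (x + ln 2) / ln 2" using fx(2) by (simp add: pos_le_divide_eq)
      then have "real f \<le> x / ln 2 + 1" by (simp add: add_divide_distrib)
      then have "2 * real f \<le> 2 * (x / ln 2 + 1)" by (intro mult_left_mono) auto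
      with A show ?thesis by (rule add_mono)
    qed
    finally have l2: "real l \<le> M * x + M * ln 2 + 2 * (x / ln 2) + 2" by (simp add: lr algebra_simps)
    \<comment> \<open>A path with \<open>L\<close> vertices has \<open>L - 1\<close> edges, so the
      growth hypothesis covers \<open>L - 1\<close> levels and \<open>e\<close> is the number of
      levels charged with \<open>\<Delta>\<close>.\<close>
    define e where "e = l - (L - 1)"
    have "real e = real l - real L + 1" unfolding e_def using Ll L(3) by (simp add: of_nat_diff)
    then have e: "real e \<le> 2 * (x / ln 2) + M * ln 2 + 3" using l2 L(1) by linarith
    have "\<kappa> ^ l * w * (n * (1 / B)) \<le> 1 / (2 * real n ^ 11)" if w: "w \<le> b ^ L * real \<Delta> ^ e"
    proof -
      have "\<kappa> ^ l * w \<le> \<kappa> ^ l * (b ^ L * real \<Delta> ^ e)" using w \<kappa> by (intro mult_left_mono) auto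
      also have "\<dots> \<le> \<kappa> ^ L * (b ^ L * real \<Delta> ^ e)"
        using \<kappa> b Ll by (intro mult_right_mono power_decreasing) auto
      also have "\<dots> = (b * \<kappa>) ^ L * real \<Delta> ^ e" by (simp add: power_mult_distrib)
      also have "(b * \<kappa>) ^ L = exp (- (L * \<gamma>))"
        unfolding \<gamma>_def using \<kappa> b by (simp add: exp_of_nat_mult)
      also have "real \<Delta> ^ e = exp (e * ln (real \<Delta>))" using \<Delta> by (simp add: exp_of_nat_mult)
      also have "exp (- (L * \<gamma>)) * exp (e * ln (real \<Delta>)) = exp (e * ln (real \<Delta>) - L * \<gamma>)"
        by (simp add: exp_diff exp_minus divide_inverse mult.commute)
      also have "\<dots> \<le> exp (c0 - 13 * x)"
      proof -
        have "e * ln (real \<Delta>) \<le> (2 * (x / ln 2) + M * ln 2 + 3) * ln (real \<Delta>)"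
          using e l\<Delta> by (rule mult_right_mono)
        also have "\<dots> = x * (2 * ln \<Delta> / ln 2) + c0" by (simp add: c0_def algebra_simps)
        finally have 1: "e * ln (real \<Delta>) \<le> x * (2 * ln \<Delta> / ln 2) + c0" .
        have "x * (13 + 2 * ln \<Delta> / ln 2) \<le> x * (M * \<gamma>)" using M\<gamma> x by (intro mult_left_mono) auto
        also have "\<dots> = (M * x) * \<gamma>" by simp
        also have "\<dots> \<le> L * \<gamma>" using L(1) \<gamma> by (intro mult_right_mono) auto
        finally have "x * 13 + x * (2 * ln \<Delta> / ln 2) \<le> L * \<gamma>" by (simp only: distrib_left)
        then show ?thesis using 1 by simp
      qed
      also have "\<dots> = exp c0 / real n ^ 13"
      proof -
        have "exp (13 * x) = exp x ^ 13" using exp_of_nat_mult[of 13 x] by simp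
        then show ?thesis using n1 by (simp add: exp_diff x_def)
      qed
      finally have k: "\<kappa> ^ l * w \<le> exp c0 / real n ^ 13" .
      have "2 * exp c0 / B \<le> real n" using n unfolding C2_def by linarith
      then have nb: "2 * exp c0 \<le> real n * B" using B by (simp add: pos_divide_le_eq)
      have "\<kappa> ^ l * w * (n * (1 / B)) \<le> exp c0 / real n ^ 13 * (n * (1 / B))"
        using k B by (intro mult_right_mono) auto
      also have "\<dots> = exp c0 / (B * real n ^ 12)"
        using n1 B by (simp add: power_numeral_reduce)
      also have "\<dots> \<le> 1 / (2 * real n ^ 11)"
      proof -
        have "exp c0 * (2 * real n ^ 11) \<le> 1 * (B * real n ^ 12)"
          using mult_right_mono[OF nb, of "real n ^ 11"] by (simp add: power_numeral_reduce algebra_simps)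
        then show ?thesis using n1 B by (subst frac_le_eq) (auto simp: divide_le_0_iff)
      qed
      finally show ?thesis .
    qed
    then show ?thesis using L(3) Ll unfolding L_def l_def f_def e_def by blast
  qed
  then show ?thesis by (intro exI[of _ C2]) (simp add: C2_def)
qed

text \<open>With \<open>n \<le> 2 ^ n\<close> and \<open>1 / B \<le> 2 ^ e\<close> everything
  becomes a power of 2. The two claims take at most \<open>(14 + 2 * e) * n\<close> and
  \<open>(14 + e) * n\<close> bits, so \<open>(20 + 3 * e) * n\<close> is generous.\<close>

lemma precision_bound:
  fixes B :: real and n e :: nat
  assumes "0 < B" "1 / B \<le> 2 ^ e" "1 \<le> n"
  shows "n * (2 * (1 / B) ^ (2 * n) / 2 ^ ((20 + 3 * e) * n)) \<le> 1 / (4 * real n ^ 10)"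
    and "real n * real n * (1 / 2 ^ ((20 + 3 * e) * n) / B) \<le> 1 / (4 * real n ^ 10)"
proof -
  let ?c = "2 ^ ((20 + 3 * e) * n) :: real"
  have n0: "0 < real n" using assms by simp
  have aux: "X / c \<le> 1 / Y" if "X * Y \<le> 1 * c" "0 < Y" "0 < c" for X Y c :: real
    using that by (simp add: divide_le_eq le_divide_eq)
  have p11: "real n ^ 11 = real n * real n ^ 10" by (simp add: power_Suc[symmetric] del: power_Suc)
  have p12: "real n ^ 12 = real n * real n ^ 11" by (simp add: power_Suc[symmetric] del: power_Suc)
  have n2: "real n \<le> 2 ^ n" using less_exp[of n] by (metis less_imp_le of_nat_le_iff of_nat_numeral of_nat_power)
  have np: "real n ^ k \<le> 2 ^ (n * k)" for k using power_mono[OF n2, of k] by (simp add: power_mult)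
  have Bp: "(1 / B) ^ k \<le> 2 ^ (e * k)" for k
    using power_mono[OF assms(2), of k] assms(1) by (simp add: power_mult)
  have en: "e \<le> e * n" using assms(3) by simp
  have "real n ^ 11 * (8 * (1 / B) ^ (2 * n)) \<le> 2 ^ (n * 11) * (8 * 2 ^ (e * (2 * n)))"
    using np[of 11] Bp[of "2 * n"] assms(1) by (intro mult_mono) auto
  also have "\<dots> = 2 ^ (n * 11 + (3 + e * (2 * n)))" unfolding power_add by simp
  also have "\<dots> \<le> ?c" using assms(3) by (intro power_increasing) (auto simp: algebra_simps)
  finally have 1: "real n ^ 11 * (8 * (1 / B) ^ (2 * n)) \<le> ?c" .
  have eq1: "(n * (2 * (1 / B) ^ (2 * n))) * (4 * real n ^ 10) = real n ^ 11 * (8 * (1 / B) ^ (2 * n))"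
    unfolding p11 by simp
  have "(n * (2 * (1 / B) ^ (2 * n))) * (4 * real n ^ 10) \<le> 1 * ?c"
    unfolding eq1 mult_1 by (rule 1)
  then have "n * (2 * (1 / B) ^ (2 * n)) / ?c \<le> 1 / (4 * real n ^ 10)"
    by (rule aux) (use n0 in simp_all)
  then show "n * (2 * (1 / B) ^ (2 * n) / ?c) \<le> 1 / (4 * real n ^ 10)" by simp
  have "real n ^ 12 * (4 * (1 / B) ^ 1) \<le> 2 ^ (n * 12) * (4 * 2 ^ (e * 1))"
    using np[of 12] Bp[of 1] assms(1) by (intro mult_mono) auto
  also have "\<dots> = 2 ^ (n * 12 + (2 + e))" unfolding power_add by simp
  also have "\<dots> \<le> ?c"
  proof (rule power_increasing)
    have "(20 + 3 * e) * n = 20 * n + 3 * (e * n)" by (simp add: algebra_simps)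
    then show "n * 12 + (2 + e) \<le> (20 + 3 * e) * n" using en assms(3) by linarith
  qed simp
  finally have 2: "real n ^ 12 * (4 * (1 / B)) \<le> ?c" by simp
  have eq2: "(real n * real n * (1 / B)) * (4 * real n ^ 10) = real n ^ 12 * (4 * (1 / B))"
    unfolding p12 p11 by simp
  have "(real n * real n * (1 / B)) * (4 * real n ^ 10) \<le> 1 * ?c"
    unfolding eq2 mult_1 by (rule 2)
  then have "real n * real n * (1 / B) / ?c \<le> 1 / (4 * real n ^ 10)"
    by (rule aux) (use n0 in simp_all)
  then show "real n * real n * (1 / ?c / B) \<le> 1 / (4 * real n ^ 10)"
    by (simp add: mult.commute)
qed

theorem theorem6p3:
  fixes B b :: real and \<Delta> :: nat
  assumes "0 < B" "B < 1" "0 < b" "b * ((1 - B) / (1 + B)) < 1" "3 \<le> \<Delta>"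
  shows "\<exists>M0::real. 0 < M0 \<and> (\<forall>M::real. M0 < M \<longrightarrow>
    (\<exists>(c :: com) (p :: nat poly). \<forall>(n :: nat) (E :: nat set set).
      1 \<le> n \<longrightarrow> simple_graph {..<n} E \<longrightarrow> max_degree_le {..<n} E \<Delta> \<longrightarrow>
      average_growth {..<n} E b (depth M n) \<longrightarrow>
        (let \<nu> = output_pmf B c n E None (poly p n) in
           halts_within B c (input n E None) (poly p n) \<and>
           set_pmf \<nu> \<subseteq> configs {..<n} \<and>
           tv_dist \<nu> (ising {..<n} E B) \<le> 1 / real n ^ 10) \<and>
        (\<forall>u<n. \<forall>v<n. u \<noteq> v \<longrightarrow>
          (let \<nu> = output_pmf B c n E (Some (u, v)) (poly p n) in
             halts_within B c (input n E (Some (u, v))) (poly p n) \<and>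
             set_pmf \<nu> \<subseteq> {\<tau> \<in> configs {..<n}. \<tau> u = 1 \<and> \<tau> v = 2} \<and>
             tv_dist \<nu> (ising_cond {..<n} E B u v) \<le> 1 / real n ^ 10))))"
proof -
  define \<kappa> where "\<kappa> = (1 - B) / (1 + B)"
  have \<kappa>: "0 < \<kappa>" "\<kappa> < 1" using assms by (simp_all add: \<kappa>_def)
  have b\<kappa>: "b * \<kappa> < 1" using assms by (simp add: \<kappa>_def)
  define M0 where "M0 = (13 + 2 * ln (real \<Delta>) / ln 2) / (- ln (b * \<kappa>))"
  have "0 < M0"
    unfolding M0_def using assms \<kappa> b\<kappa> by (intro divide_pos_pos add_pos_nonneg) (auto simp: ln_less_zero_iff)
  moreover have "\<exists>(c :: com) (p :: nat poly). \<forall>(n :: nat) (E :: nat set set).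
      1 \<le> n \<longrightarrow> simple_graph {..<n} E \<longrightarrow> max_degree_le {..<n} E \<Delta> \<longrightarrow>
      average_growth {..<n} E b (depth M n) \<longrightarrow>
        (let \<nu> = output_pmf B c n E None (poly p n) in
           halts_within B c (input n E None) (poly p n) \<and>
           set_pmf \<nu> \<subseteq> configs {..<n} \<and>
           tv_dist \<nu> (ising {..<n} E B) \<le> 1 / real n ^ 10) \<and>
        (\<forall>u<n. \<forall>v<n. u \<noteq> v \<longrightarrow>
          (let \<nu> = output_pmf B c n E (Some (u, v)) (poly p n) in
             halts_within B c (input n E (Some (u, v))) (poly p n) \<and>
             set_pmf \<nu> \<subseteq> {\<tau> \<in> configs {..<n}. \<tau> u = 1 \<and> \<tau> v = 2} \<and>
             tv_dist \<nu> (ising_cond {..<n} E B u v) \<le> 1 / real n ^ 10))" if M: "M0 < M" for M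
  proof -
    define C1 where "C1 = nat \<lceil>M * ln 2\<rceil> + 1"
    obtain C2 where C2: "1 \<le> C2" "\<And>n w. C2 < n \<Longrightarrow> 1 \<le> depth M n \<and> depth M n \<le> C1 * floorlog 2 n \<and>
      (w \<le> b ^ depth M n * real \<Delta> ^ (C1 * floorlog 2 n - (depth M n - 1)) \<longrightarrow>
       \<kappa> ^ (C1 * floorlog 2 n) * w * (n * (1 / B)) \<le> 1 / (2 * real n ^ 11))"
      using decay_bound[OF \<kappa> assms(3) b\<kappa> assms(1) _ M[unfolded M0_def] C1_def] assms(5) by auto
    obtain e where e: "1 / B \<le> 2 ^ e" using real_arch_pow[of 2 "1 / B"] by (auto intro: less_imp_le)
    define C3 where "C3 = 20 + 3 * e"
    define l where "l n = (if n \<le> C2 then n else C1 * floorlog 2 n)" for n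
    define K where "K n = C3 * n" for n
    define X where "X n = (2 * \<Delta> + 2) ^ l n" for n
    \<comment> \<open>The demand of \<open>machine\<close>, plus a last bracket for the counters of
      the set-up.\<close>
    define W where "W n = (K n * (n + l n) + K n + 1) * X n + n + l n + K n + 3 + (C1 * n + 2 * n + C1)" for n
    define T where "T n = time_bound C1 C2 C3 \<Delta> n (l n) (K n) (W n) (X n) + K n * n" for n
    have pl: "poly_bdd l" using poly_bdd_depth[of C2 C1] by (simp add: l_def[abs_def])
    have pX: "poly_bdd X"
      using poly_bdd_power_depth[of "2 * \<Delta> + 2" C2 C1] by (simp add: X_def[abs_def] l_def)
    have pK: "poly_bdd K" unfolding K_def[abs_def] by (intro poly_bdd_intros)
    have pW: "poly_bdd W" unfolding W_def[abs_def] by (intro poly_bdd_intros pl pX pK)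
    have "poly_bdd T" unfolding T_def[abs_def] time_bound_def
      by (intro poly_bdd_intros pl pX pK pW)
    then obtain p :: "nat poly" where p: "\<And>n. 1 \<le> n \<Longrightarrow> T n \<le> poly p n"
      unfolding poly_bdd_def by blast
    define S where "S = ising_sampler C1 C2 C3"
    \<comment> \<open>One statement for both tasks: the query is absent or a pair, and
      \<open>start_configs\<close> is the support of the corresponding target.\<close>
    have main: "halts_within B S (input n E q) (poly p n) \<and>
      set_pmf (output_pmf B S n E q (poly p n)) \<subseteq> start_configs n q \<and>
      (\<forall>\<tau>\<in>start_configs n q. (1 - 1 / real n ^ 10) * gibbs E (start_configs n q) B \<tau> \<le>
         pmf (output_pmf B S n E q (poly p n)) \<tau>)"
      if n: "1 \<le> n" and gr: "simple_graph {..<n} E" and deg: "max_degree_le {..<n} E \<Delta>"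
        and ag: "average_growth {..<n} E b (depth M n)" and q: "query_ok n q" for n E q
    proof -
      define c where "c = (2::nat) ^ K n"
      define a where "a = nat \<lfloor>B * 2 ^ K n\<rfloor> + 1"
      have c0: "0 < real c" by (simp add: c_def)
      have cr: "real c = 2 ^ K n" by (simp add: c_def)
      have fl: "0 \<le> \<lfloor>B * real c\<rfloor>" using assms(1) c0 by simp
      have ar: "real a = of_int \<lfloor>B * real c\<rfloor> + 1" using fl unfolding a_def cr by simp
      have a0: "0 < a" by (simp add: a_def)
      have aB: "B * real c \<le> real a" "real a \<le> B * real c + 1" unfolding ar by linarith+
      have ac: "a \<le> c"
      proof -
        have "B * real c < 1 * real c" using assms(2) c0 by (intro mult_strict_right_mono)
        then have "\<lfloor>B * real c\<rfloor> < int c" by linarith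
        then show ?thesis using fl unfolding a_def cr[symmetric] by linarith
      qed
      interpret machine B "W n" n E a c "l n" "K n" \<Delta>
        by unfold_locales (use gr deg a0 ac in \<open>simp_all add: c_def W_def X_def\<close>)
      have Bac: "B \<le> a / c" "a / c - B \<le> 1 / c"
      proof -
        show "B \<le> a / c" using aB(1) c0 by (simp add: pos_le_divide_eq)
        have "real a \<le> (B + 1 / c) * c" using aB(2) c0 by (simp add: distrib_right)
        then have "a / c \<le> B + 1 / c" using c0 by (simp add: pos_divide_le_eq)
        then show "a / c - B \<le> 1 / c" by simp
      qed
      have caB: "real c / real a \<le> 1 / B"
        using aB(1) a0 c0 assms(1) by (simp add: field_simps)
      have \<kappa>c: "(real c - real a) / (real c + real a) \<le> \<kappa>"
      proof -
        have "(real c - real a) * (1 + B) \<le> (1 - B) * (real c + real a)"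
          using aB(1) by (simp add: algebra_simps)
        then show ?thesis unfolding \<kappa>_def using c0 a0 assms(1) by (simp add: divide_simps mult.commute)
      qed
      have lnB: "0 \<le> ln (real c / real a)" "ln (real c / real a) \<le> 1 / B"
      proof -
        show "0 \<le> ln (real c / real a)" using ac a0 by simp
        have "ln (real c / real a) \<le> real c / real a" using a0 c0 by (intro ln_bound) simp
        then show "ln (real c / real a) \<le> 1 / B" using caB by linarith
      qed
      \<comment> \<open>Error budget: over all vertices the truncation takes half of
        \<open>1 / n ^ 10\<close> and the rounding of the decisions a quarter; the last quarter is
        left for replacing \<open>B\<close> by \<open>a / c\<close>.\<close>
      define \<delta> where "\<delta> = 1 / (2 * real n ^ 11)"
      define \<eta> where "\<eta> = 2 * (1 / B) ^ (2 * n) / c"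
      have n0: "0 < real n" using n by simp
      have decay: "\<kappa> ^ l n * walks E (l n) U v * (n * ln (c / a)) \<le> \<delta>"
        if U: "U \<subseteq> {..<n}" "v \<in> U" for U v
      proof (cases "n \<le> C2")
        case True
        have "card U \<le> n" using card_mono[OF _ U(1)] by simp
        then have "walks E (l n) U v = 0"
          using U True by (intro walks_eq_0) (auto simp: l_def intro: finite_subset)
        then show ?thesis by (simp add: \<delta>_def)
      next
        case False
        then have nC: "C2 < n" by simp
        let ?L = "depth M n"
        have l: "l n = C1 * floorlog 2 n" using False by (simp add: l_def)
        have L: "1 \<le> ?L" "?L \<le> l n" using C2(2)[OF nC] unfolding l by auto
        have "real (walks E (?L - 1) U v) \<le> real (card (paths_from {..<n} E v (Suc (?L - 1))))"
          using U by (intro of_nat_mono walks_le_paths) auto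
        also have "\<dots> = real (card (paths_from {..<n} E v ?L))" using L by simp
        also have "\<dots> \<le> b ^ ?L" using ag U unfolding average_growth_def by (auto intro: less_imp_le)
        finally have w1: "real (walks E (?L - 1) U v) \<le> b ^ ?L" .
        have "l n = (?L - 1) + (l n - (?L - 1))" using L by simp
        then have "walks E (l n) U v \<le> walks E (?L - 1) U v * \<Delta> ^ (l n - (?L - 1))"
          using walks_add[OF gr deg U, of "?L - 1" "l n - (?L - 1)"] by simp
        then have "real (walks E (l n) U v) \<le> real (walks E (?L - 1) U v * \<Delta> ^ (l n - (?L - 1)))"
          by (rule of_nat_mono)
        also have "\<dots> \<le> b ^ ?L * real \<Delta> ^ (l n - (?L - 1))"
          using w1 by (simp add: mult_right_mono)
        finally have w: "real (walks E (l n) U v) \<le> b ^ ?L * real \<Delta> ^ (l n - (?L - 1))" .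
        have "\<kappa> ^ l n * walks E (l n) U v * (n * ln (c / a)) \<le> \<kappa> ^ l n * walks E (l n) U v * (n * (1 / B))"
          using lnB \<kappa> by (intro mult_left_mono) auto
        also have "\<dots> \<le> \<delta>" using C2(2)[OF nC] w unfolding l \<delta>_def by blast
        finally show ?thesis .
      qed
      have prec: "n * \<eta> \<le> 1 / (4 * real n ^ 10)" "real n * real n * (1 / c / B) \<le> 1 / (4 * real n ^ 10)"
        using precision_bound[OF assms(1) e n] unfolding \<eta>_def cr K_def C3_def by auto
      have \<eta>0: "0 \<le> \<eta>" using assms(1) c0 by (simp add: \<eta>_def)
      have n10: "1 \<le> real n ^ 10" using n by simp
      have n\<delta>: "n * \<delta> = 1 / (2 * real n ^ 10)"
      proof -
        have "real n ^ 11 = real n * real n ^ 10" by (simp add: power_Suc[symmetric] del: power_Suc)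
        then show ?thesis using n0 by (simp add: \<delta>_def)
      qed
      have \<epsilon>n: "n * (\<delta> + \<eta>) \<le> 3 / (4 * real n ^ 10)" using prec(1) n\<delta> by (simp add: distrib_left)
      have q34: "3 / (4 * real n ^ 10) \<le> 1" using n10 by (simp add: divide_le_eq)
      have \<epsilon>0: "0 \<le> \<delta> + \<eta>" using \<eta>0 by (simp add: \<delta>_def)
      have \<epsilon>1: "\<delta> + \<eta> \<le> 1"
      proof -
        have "1 * (\<delta> + \<eta>) \<le> n * (\<delta> + \<eta>)" using n \<epsilon>0 by (intro mult_right_mono) auto
        from order_trans[OF order_trans[OF this \<epsilon>n] q34] show ?thesis by simp
      qed
      have \<eta>c: "2 * (real c / real a) ^ (2 * n) \<le> \<eta> * c"
      proof -
        have "(real c / real a) ^ (2 * n) \<le> (1 / B) ^ (2 * n)" using caB by (intro power_mono) auto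
        then show ?thesis using c0 by (simp add: \<eta>_def)
      qed
      have \<eta>1: "\<eta> \<le> 1"
      proof -
        have "0 \<le> \<delta>" by (simp add: \<delta>_def)
        then show ?thesis using \<epsilon>1 by linarith
      qed
      have step: "real (card {x. x < c \<and> decide c (approx_marg E a c (l n) U g v 1) (approx_marg E a c (l n) U g v 2) x = s}) \<ge>
          c * (1 - (\<delta> + \<eta>)) * (marginal E a c U g v s / weight_sum E a c U g)"
        if "U \<subseteq> {..<n}" "v \<in> U" "field_inv a c j g" "j \<le> n" "s \<in> {1, 2}" for U v g s j
        using step_lower[OF gr a0 ac \<kappa>c that(1-4) decay[OF that(1,2)] \<eta>c \<eta>1 that(5)] .
      then have step_ok: "step_lower_ok (\<delta> + \<eta>)" unfolding step_lower_ok_def by blast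
      have C1W: "C1 * n + 2 * n + C1 < 2 ^ W n"
      proof -
        have "C1 * n + 2 * n + C1 \<le> W n" unfolding W_def by (rule le_add2)
        then show ?thesis using less_exp[of "W n"] by linarith
      qed
      have T: "total_time C1 C2 C3 + K n * n \<le> poly p n"
      proof -
        have "total_time C1 C2 C3 + K n * n \<le> T n" unfolding T_def X_def using total_time_le by simp
        then show ?thesis using p[OF n] by linarith
      qed
      note out = output_lower[OF a_def K_def[of n] l_def[of n] C1W n q T step_ok \<epsilon>0 \<epsilon>1, folded S_def]
      have "(1 - 1 / real n ^ 10) * gibbs E (start_configs n q) B \<tau> \<le>
         pmf (output_pmf B S n E q (poly p n)) \<tau>" if \<tau>: "\<tau> \<in> start_configs n q" for \<tau>
      proof -
        let ?C = "start_configs n q"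
        have fin: "finite ?C" using finite_configs[of "{..<n}"]
          by (auto simp: start_configs_def pinned_def split: option.splits)
        have g0: "0 \<le> gibbs E ?C B \<tau>"
          unfolding gibbs_def using assms(1) by (intro divide_nonneg_nonneg sum_nonneg) auto
        have ce: "real (card E) * ((a / c - B) / B) \<le> 1 / (4 * real n ^ 10)"
        proof -
          have "real (card E) \<le> real n * real n" using card_edges_le[OF gr] by (metis of_nat_le_iff of_nat_mult)
          moreover have "(a / c - B) / B \<le> 1 / c / B" using Bac(2) assms(1) by (intro divide_right_mono) auto
          ultimately have "real (card E) * ((a / c - B) / B) \<le> real n * real n * (1 / c / B)"
            using Bac(1) assms(1) by (intro mult_mono) auto
          then show ?thesis using prec(2) by linarith
        qed
        have 1: "1 - n * (\<delta> + \<eta>) \<ge> 0" using order_trans[OF \<epsilon>n q34] by simp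
        have "1 - 1 / real n ^ 10 \<le> (1 - n * (\<delta> + \<eta>)) * (1 - card E * ((a / c - B) / B))"
        proof -
          have aux: "1 - z \<le> (1 - x) * (1 - y)" if "x \<le> x'" "y \<le> y'" "x' + y' = z" "0 \<le> x * y"
            for x y z x' y' :: real using that by (simp add: algebra_simps)
          have "0 \<le> n * (\<delta> + \<eta>) * (card E * ((a / c - B) / B))"
            using \<epsilon>0 Bac(1) assms(1) by (intro mult_nonneg_nonneg) auto
          moreover have "3 / (4 * real n ^ 10) + 1 / (4 * real n ^ 10) = 1 / real n ^ 10"
            using n0 by (simp add: field_simps)
          ultimately show ?thesis by (intro aux[OF \<epsilon>n ce])
        qed
        then have "(1 - 1 / real n ^ 10) * gibbs E ?C B \<tau> \<le>
            (1 - n * (\<delta> + \<eta>)) * (1 - card E * ((a / c - B) / B)) * gibbs E ?C B \<tau>"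
          using g0 by (rule mult_right_mono)
        also have "\<dots> = (1 - n * (\<delta> + \<eta>)) * ((1 - card E * ((a / c - B) / B)) * gibbs E ?C B \<tau>)"
          by (rule mult.assoc)
        also have "\<dots> \<le> (1 - n * (\<delta> + \<eta>)) * gibbs E ?C (a / c) \<tau>"
          using gibbs_perturb[OF fin \<tau> simple_graph_finite[OF gr] assms(1) Bac(1)] 1 by (rule mult_left_mono)
        also have "\<dots> \<le> pmf (output_pmf B S n E q (poly p n)) \<tau>" by (rule out(3)[OF \<tau>])
        finally show ?thesis .
      qed
      then show ?thesis using out(1,2) by blast
    qed
    show ?thesis
    proof (intro exI[of _ S] exI[of _ p] allI impI conjI)
      fix n E assume H: "1 \<le> n" "simple_graph {..<n} E" "max_degree_le {..<n} E \<Delta>"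
        "average_growth {..<n} E b (depth M n)"
      note m = main[OF H]
      show "let \<nu> = output_pmf B S n E None (poly p n) in
           halts_within B S (input n E None) (poly p n) \<and>
           set_pmf \<nu> \<subseteq> configs {..<n} \<and> tv_dist \<nu> (ising {..<n} E B) \<le> 1 / real n ^ 10"
      proof -
        have "query_ok n None" by (simp add: query_ok_def)
        note r = m[OF this, unfolded start_configs_def option.case]
        have "tv_dist (output_pmf B S n E None (poly p n)) (ising {..<n} E B) \<le> 1 / real n ^ 10"
        proof (rule tv_dist_le)
          show "(1 - 1 / real n ^ 10) * pmf (ising {..<n} E B) x \<le> pmf (output_pmf B S n E None (poly p n)) x" for x
          proof (cases "x \<in> configs {..<n}")
            case True
            then show ?thesis using r pmf_ising_gibbs[OF assms(1) True] by simp
          next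
            case False
            then show ?thesis using pmf_ising[of "{..<n}" B E x] assms(1) by simp
          qed
        qed simp
        then show ?thesis using r by (simp add: Let_def)
      qed
      fix u v assume uv: "u < n" "v < n" "u \<noteq> v"
      show "let \<nu> = output_pmf B S n E (Some (u, v)) (poly p n) in
             halts_within B S (input n E (Some (u, v))) (poly p n) \<and>
             set_pmf \<nu> \<subseteq> {\<tau> \<in> configs {..<n}. \<tau> u = 1 \<and> \<tau> v = 2} \<and>
             tv_dist \<nu> (ising_cond {..<n} E B u v) \<le> 1 / real n ^ 10"
      proof -
        have "query_ok n (Some (u, v))" using uv by (simp add: query_ok_def)
        note r = m[OF this, unfolded start_configs_def option.case prod.case]
        have "tv_dist (output_pmf B S n E (Some (u, v)) (poly p n)) (ising_cond {..<n} E B u v) \<le> 1 / real n ^ 10"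
        proof (rule tv_dist_le)
          show "(1 - 1 / real n ^ 10) * pmf (ising_cond {..<n} E B u v) x \<le>
            pmf (output_pmf B S n E (Some (u, v)) (poly p n)) x" for x
            using r by (simp add: pmf_ising_cond[OF assms(1) uv])
        qed simp
        then show ?thesis using r by (simp add: Let_def pinned_def)
      qed
    qed
  qed
  ultimately show ?thesis by blast
qed

end
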